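(* Let $G$ be a finite group. Let $\pi\colon G\to \mathrm{SU}(n)$ be a non-trivial irreducible representation and let $\bar\pi\colon G\to \mathrm{PU}(n)$ be the corresponding projective representation. Assume that $\pi(G)$ does not normalize a non-trivial torus in $\mathrm{SU}(n)$; equivalently, every $\pi(G)$-invariant abelian Lie subalgebra of $\mathfrak{su}(n)$ is trivial. (In particular, this assumption holds when $G$ does not admit a non-trivial homomorphism to $\mathrm{Sym}(n)$; it also holds when $\pi$ is non-trivial and irreducible of least dimension, i.e. $n$ is the least dimension of a non-trivial irreducible complex representation of $G$.) Then the set of discrete subgroups of $\mathrm{PU}(n)$ containing $\bar\pi(G)$ is uniformly discrete. In particular, $\bar\pi(G)$ is contained in a maximal discrete subgroup of $\mathrm{PU}(n)$.
   Context: $\mathrm{PU}(n)=\mathrm{U}(n)/S^1$ with its usual compact Lie group topology; $\bar\pi$ is the composition of $\pi$ with $\mathrm{SU}(n)\to \mathrm{PU}(n)$. A torus in $\mathrm{SU}(n)$ is a compact connected abelian subgroup, and it is non-trivial if it is not $\{1\}$. Invariance of Lie subalgebras of $\mathfrak{su}(n)$ refers to the adjoint (conjugation) action of $\pi(G)$. $\mathrm{Sym}(n)$ is the symmetric group on $n$ letters. A set of subgroups of a topological group is uniformly discrete if there is a neighbourhood of the identity meeting each of these subgroups only in the identity. A maximal discrete subgroup is a discrete subgroup that is not properly contained in any other discrete subgroup. *)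

theory Defs
  imports
    "Jordan_Normal_Form.Schur_Decomposition"
    "Jordan_Normal_Form.VS_Connect"
    "HOL-Algebra.Sym_Groups"
    "HOL-Algebra.Group_Action"
    "HOL-Analysis.Function_Topology"
begin

hide_const (open) Multiset.mult

section \<open>The groups \<open>GL(n, \<complex>)\<close>, \<open>U(n)\<close>, \<open>SU(n)\<close> and \<open>PU(n)\<close>\<close>

definition GL_group :: "nat \<Rightarrow> complex mat monoid" where
  "GL_group n = units_of (ring_mat TYPE(complex) n ())"

definition U_group :: "nat \<Rightarrow> complex mat monoid" where
  "U_group n =
     \<lparr> carrier = {A \<in> carrier_mat n n. A * mat_adjoint A = 1\<^sub>m n \<and> mat_adjoint A * A = 1\<^sub>m n},
       mult = (*), one = 1\<^sub>m n \<rparr>"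

definition SU_group :: "nat \<Rightarrow> complex mat monoid" where
  "SU_group n = (U_group n)\<lparr>carrier := {A \<in> carrier (U_group n). det A = 1}\<rparr>"

definition circle_scalars :: "nat \<Rightarrow> complex mat set" where
  "circle_scalars n = {c \<cdot>\<^sub>m 1\<^sub>m n | c. cmod c = 1}"

definition PU_group :: "nat \<Rightarrow> complex mat set monoid" where
  "PU_group n = U_group n Mod circle_scalars n"

definition PU_class :: "nat \<Rightarrow> complex mat \<Rightarrow> complex mat set" where
  "PU_class n A = circle_scalars n #>\<^bsub>U_group n\<^esub> A"

section \<open>Topologies\<close>

text \<open>Square matrices carry the topology of \<open>\<complex>\<close> to the power \<open>n\<^sup>2\<close>, via their entries.\<close>

definition mat_topology :: "nat \<Rightarrow> complex mat topology" where
  "mat_topology n =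
     pullback_topology (carrier_mat n n) (\<lambda>A. \<lambda>ij\<in>{..<n} \<times> {..<n}. A $$ ij)
       (product_topology (\<lambda>_. euclidean) ({..<n} \<times> {..<n}))"

definition U_topology :: "nat \<Rightarrow> complex mat topology" where
  "U_topology n = subtopology (mat_topology n) (carrier (U_group n))"

definition SU_topology :: "nat \<Rightarrow> complex mat topology" where
  "SU_topology n = subtopology (mat_topology n) (carrier (SU_group n))"

text \<open>The quotient topology with respect to \<open>U(n) \<rightarrow> PU(n)\<close>; see \<open>quotient_map_PU_class\<close> below.\<close>

definition PU_topology :: "nat \<Rightarrow> complex mat set topology" where
  "PU_topology n =
     topology (\<lambda>V. V \<subseteq> carrier (PU_group n) \<and>
                    openin (U_topology n) {A \<in> carrier (U_group n). PU_class n A \<in> V})"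

definition discrete_subgroup :: "'a topology \<Rightarrow> ('a, 'b) monoid_scheme \<Rightarrow> 'a set \<Rightarrow> bool" where
  "discrete_subgroup T G H \<longleftrightarrow> subgroup H G \<and> subtopology T H = discrete_topology H"

definition maximal_discrete_subgroup ::
    "'a topology \<Rightarrow> ('a, 'b) monoid_scheme \<Rightarrow> 'a set \<Rightarrow> bool" where
  "maximal_discrete_subgroup T G M \<longleftrightarrow>
     discrete_subgroup T G M \<and> (\<nexists>H. discrete_subgroup T G H \<and> M \<subset> H)"

definition uniformly_discrete ::
    "'a topology \<Rightarrow> ('a, 'b) monoid_scheme \<Rightarrow> 'a set set \<Rightarrow> bool" where
  "uniformly_discrete T G \<H> \<longleftrightarrow>
     (\<exists>V. openin T V \<and> \<one>\<^bsub>G\<^esub> \<in> V \<and> (\<forall>H\<in>\<H>. H \<inter> V = {\<one>\<^bsub>G\<^esub>}))"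

section \<open>Complex representations\<close>

definition irreducible_rep ::
    "('a, 'b) monoid_scheme \<Rightarrow> nat \<Rightarrow> ('a \<Rightarrow> complex mat) \<Rightarrow> bool" where
  "irreducible_rep G m \<rho> \<longleftrightarrow>
     \<rho> \<in> hom G (GL_group m) \<and> 0 < m \<and>
     (\<forall>W. VectorSpace.subspace class_ring W (module_vec TYPE(complex) m) \<and>
           (\<forall>g\<in>carrier G. \<forall>w\<in>W. \<rho> g *\<^sub>v w \<in> W)
        \<longrightarrow> W = {0\<^sub>v m} \<or> W = carrier_vec m)"

definition nontrivial_rep ::
    "('a, 'b) monoid_scheme \<Rightarrow> nat \<Rightarrow> ('a \<Rightarrow> complex mat) \<Rightarrow> bool" where
  "nontrivial_rep G m \<rho> \<longleftrightarrow> (\<exists>g\<in>carrier G. \<rho> g \<noteq> 1\<^sub>m m)"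

definition least_nontrivial_irrep_dim :: "('a, 'b) monoid_scheme \<Rightarrow> nat" where
  "least_nontrivial_irrep_dim G = (LEAST m. \<exists>\<rho>. irreducible_rep G m \<rho> \<and> nontrivial_rep G m \<rho>)"

section \<open>Tori in \<open>SU(n)\<close> and Lie subalgebras of \<open>su(n)\<close>\<close>

definition SU_torus :: "nat \<Rightarrow> complex mat set \<Rightarrow> bool" where
  "SU_torus n T \<longleftrightarrow>
     subgroup T (SU_group n) \<and> (\<forall>s\<in>T. \<forall>t\<in>T. s * t = t * s) \<and>
     compactin (SU_topology n) T \<and> connectedin (SU_topology n) T"

definition normalizes_nontrivial_torus :: "nat \<Rightarrow> complex mat set \<Rightarrow> bool" where
  "normalizes_nontrivial_torus n K \<longleftrightarrow>
     (\<exists>T. SU_torus n T \<and> T \<noteq> {1\<^sub>m n} \<and> K \<subseteq> normalizer (SU_group n) T)"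

definition su_algebra :: "nat \<Rightarrow> complex mat set" where
  "su_algebra n = {X \<in> carrier_mat n n. mat_adjoint X = - X \<and> (\<Sum>i<n. X $$ (i, i)) = 0}"

definition su_Lie_subalgebra :: "nat \<Rightarrow> complex mat set \<Rightarrow> bool" where
  "su_Lie_subalgebra n \<hh> \<longleftrightarrow>
     \<hh> \<subseteq> su_algebra n \<and> 0\<^sub>m n n \<in> \<hh> \<and>
     (\<forall>X\<in>\<hh>. \<forall>Y\<in>\<hh>. X + Y \<in> \<hh>) \<and>
     (\<forall>r::real. \<forall>X\<in>\<hh>. complex_of_real r \<cdot>\<^sub>m X \<in> \<hh>) \<and>
     (\<forall>X\<in>\<hh>. \<forall>Y\<in>\<hh>. X * Y - Y * X \<in> \<hh>)"

definition abelian_Lie :: "nat \<Rightarrow> complex mat set \<Rightarrow> bool" where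
  "abelian_Lie n \<hh> \<longleftrightarrow> (\<forall>X\<in>\<hh>. \<forall>Y\<in>\<hh>. X * Y - Y * X = 0\<^sub>m n n)"

definition Ad_invariant :: "nat \<Rightarrow> complex mat set \<Rightarrow> complex mat set \<Rightarrow> bool" where
  "Ad_invariant n K \<hh> \<longleftrightarrow> (\<forall>k\<in>K. \<forall>X\<in>\<hh>. k * X * inv\<^bsub>SU_group n\<^esub> k \<in> \<hh>)"

section \<open>Basic facts\<close>

lemma mat_adjoint_carrier: "A \<in> carrier_mat n m \<Longrightarrow> mat_adjoint A \<in> carrier_mat m n"
  by (auto simp: mat_adjoint_def)

lemma mat_adjoint_index:
  fixes A :: "complex mat"
  assumes "A \<in> carrier_mat n m" "i < m" "j < n"
  shows "mat_adjoint A $$ (i, j) = cnj (A $$ (j, i))"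
  using assms by (auto simp: mat_adjoint_def mat_of_rows_index)

lemma mat_adjoint_mult:
  fixes A :: "complex mat"
  assumes A: "A \<in> carrier_mat n n" and B: "B \<in> carrier_mat n n"
  shows "mat_adjoint (A * B) = mat_adjoint B * mat_adjoint A"
proof (rule eq_matI)
  have AB: "A * B \<in> carrier_mat n n" using A B by simp
  note c = mat_adjoint_carrier[OF A] mat_adjoint_carrier[OF B] mat_adjoint_carrier[OF AB]
  show "dim_row (mat_adjoint (A * B)) = dim_row (mat_adjoint B * mat_adjoint A)"
    "dim_col (mat_adjoint (A * B)) = dim_col (mat_adjoint B * mat_adjoint A)" using c by auto
  fix i j assume "i < dim_row (mat_adjoint B * mat_adjoint A)"
    "j < dim_col (mat_adjoint B * mat_adjoint A)"
  then have ij: "i < n" "j < n" using c by auto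
  show "mat_adjoint (A * B) $$ (i, j) = (mat_adjoint B * mat_adjoint A) $$ (i, j)"
    using ij A B c mat_adjoint_index[OF AB ij]
    by (simp add: scalar_prod_def mat_adjoint_index[OF A] mat_adjoint_index[OF B] mult.commute)
qed

lemma mat_adjoint_adjoint:
  fixes A :: "complex mat"
  assumes A: "A \<in> carrier_mat n n"
  shows "mat_adjoint (mat_adjoint A) = A"
  using mat_adjoint_carrier[OF A] mat_adjoint_carrier[OF mat_adjoint_carrier[OF A]] A
  by (intro eq_matI) (auto simp: mat_adjoint_index[where n = n and m = n])

lemma mat_adjoint_smult_one:
  fixes c :: complex
  shows "mat_adjoint (c \<cdot>\<^sub>m 1\<^sub>m n) = cnj c \<cdot>\<^sub>m 1\<^sub>m n"
proof -
  have c: "c \<cdot>\<^sub>m 1\<^sub>m n \<in> carrier_mat n n" by simp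
  show ?thesis
    using mat_adjoint_carrier[OF c]
    by (intro eq_matI) (auto simp: mat_adjoint_index[OF c])
qed

lemma mat_adjoint_one: "mat_adjoint (1\<^sub>m n :: complex mat) = 1\<^sub>m n"
proof -
  have "1 \<cdot>\<^sub>m 1\<^sub>m n = (1\<^sub>m n :: complex mat)" by (intro eq_matI) auto
  then show ?thesis using mat_adjoint_smult_one[of 1 n] by simp
qed

lemma U_group_simps [simp]:
  "mult (U_group n) = (*)" "one (U_group n) = 1\<^sub>m n"
  by (simp_all add: U_group_def)

lemma U_group_carrier:
  "A \<in> carrier (U_group n) \<longleftrightarrow>
     A \<in> carrier_mat n n \<and> A * mat_adjoint A = 1\<^sub>m n \<and> mat_adjoint A * A = 1\<^sub>m n"
  by (simp add: U_group_def)

lemma mat_mult_middle: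
  fixes A :: "complex mat"
  assumes c: "A \<in> carrier_mat n n" "B \<in> carrier_mat n n" "C \<in> carrier_mat n n" "D \<in> carrier_mat n n"
    and BC: "B * C = 1\<^sub>m n" and AD: "A * D = 1\<^sub>m n"
  shows "(A * B) * (C * D) = 1\<^sub>m n"
proof -
  have "(A * B) * (C * D) = A * (B * (C * D))" using c by (intro assoc_mult_mat) auto
  also have "B * (C * D) = (B * C) * D" using c by (intro assoc_mult_mat[symmetric]) auto
  finally show ?thesis using BC AD c by simp
qed

lemma U_group_group: "group (U_group n)"
proof (rule groupI, goal_cases)
  case (1 A B)
  then have c: "A \<in> carrier_mat n n" "B \<in> carrier_mat n n"
      "mat_adjoint A \<in> carrier_mat n n" "mat_adjoint B \<in> carrier_mat n n"
    by (auto simp: U_group_carrier intro: mat_adjoint_carrier)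
  have "(A * B) * (mat_adjoint B * mat_adjoint A) = 1\<^sub>m n"
    by (rule mat_mult_middle) (use 1 c in \<open>auto simp: U_group_carrier\<close>)
  moreover have "(mat_adjoint B * mat_adjoint A) * (A * B) = 1\<^sub>m n"
    by (rule mat_mult_middle) (use 1 c in \<open>auto simp: U_group_carrier\<close>)
  ultimately show ?case using c by (simp add: U_group_carrier mat_adjoint_mult[OF c(1,2)])
next
  case 2 then show ?case by (simp add: U_group_carrier mat_adjoint_one)
next
  case (3 A B C) then show ?case by (auto simp: U_group_carrier intro: assoc_mult_mat)
next
  case (4 A) then show ?case by (auto simp: U_group_carrier)
next
  case (5 A)
  then have "mat_adjoint A \<in> carrier (U_group n)"
    by (auto simp: U_group_carrier mat_adjoint_adjoint intro: mat_adjoint_carrier)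
  then show ?case using 5 by (auto simp: U_group_carrier)
qed

lemma U_group_inv: "A \<in> carrier (U_group n) \<Longrightarrow> inv\<^bsub>U_group n\<^esub> A = mat_adjoint A"
  by (rule group.inv_equality[OF U_group_group])
    (auto simp: U_group_carrier mat_adjoint_adjoint intro: mat_adjoint_carrier)

lemma SU_subgroup: "subgroup (carrier (SU_group n)) (U_group n)"
proof (rule group.subgroupI[OF U_group_group], goal_cases)
  case 1 then show ?case by (auto simp: SU_group_def)
next
  case 2
  have "1\<^sub>m n \<in> carrier (SU_group n)"
    using group.is_monoid[OF U_group_group, of n, THEN monoid.one_closed] by (simp add: SU_group_def)
  then show ?case by auto
next
  case (3 A)
  then have A: "A \<in> carrier (U_group n)" "det A = 1" by (auto simp: SU_group_def)
  have i: "inv\<^bsub>U_group n\<^esub> A \<in> carrier (U_group n)"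
    using A by (simp add: group.inv_closed[OF U_group_group])
  have "det (A * inv\<^bsub>U_group n\<^esub> A) = det A * det (inv\<^bsub>U_group n\<^esub> A)"
    by (rule det_mult) (use A i in \<open>auto simp: U_group_carrier\<close>)
  moreover have "A * inv\<^bsub>U_group n\<^esub> A = 1\<^sub>m n"
    using group.r_inv[OF U_group_group A(1)] by simp
  ultimately show ?case using A i by (simp add: SU_group_def)
next
  case (4 A B)
  then show ?case
    using group.is_monoid[OF U_group_group, of n, THEN monoid.m_closed, of A B]
    by (auto simp: SU_group_def U_group_carrier det_mult)
qed

lemma SU_group_group: "group (SU_group n)"
  using subgroup.subgroup_is_group[OF SU_subgroup U_group_group, of n]
  by (simp add: SU_group_def)

lemma scalar_commute:
  fixes A :: "complex mat"
  assumes "A \<in> carrier_mat n n"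
  shows "(c \<cdot>\<^sub>m 1\<^sub>m n) * A = A * (c \<cdot>\<^sub>m 1\<^sub>m n)"
  using assms mult_smult_distrib[OF assms one_carrier_mat, of c]
    mult_smult_assoc_mat[OF one_carrier_mat assms, of c] by simp

lemma circle_scalars_subset: "circle_scalars n \<subseteq> carrier (U_group n)"
proof
  fix A assume "A \<in> circle_scalars n"
  then obtain c where c: "A = c \<cdot>\<^sub>m 1\<^sub>m n" "cmod c = 1" by (auto simp: circle_scalars_def)
  have cc: "c * cnj c = 1" using c(2) by (simp flip: complex_norm_square)
  have "(c \<cdot>\<^sub>m 1\<^sub>m n) * (cnj c \<cdot>\<^sub>m 1\<^sub>m n) = 1\<^sub>m n" "(cnj c \<cdot>\<^sub>m 1\<^sub>m n) * (c \<cdot>\<^sub>m 1\<^sub>m n) = 1\<^sub>m n"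
    using cc by (auto intro!: eq_matI simp: mult_smult_distrib[of _ n n] mult.commute)
  then show "A \<in> carrier (U_group n)"
    by (simp add: c U_group_carrier mat_adjoint_smult_one)
qed

lemma circle_scalars_normal: "circle_scalars n \<lhd> U_group n"
proof -
  interpret U: group "U_group n" by (rule U_group_group)
  have sub: "subgroup (circle_scalars n) (U_group n)"
  proof (rule U.subgroupI, goal_cases)
    case 1 show ?case by (rule circle_scalars_subset)
  next
    case 2
    have "1 \<cdot>\<^sub>m 1\<^sub>m n \<in> circle_scalars n" unfolding circle_scalars_def by (intro CollectI exI[of _ 1]) simp
    then show ?case by blast
  next
    case (3 A)
    then obtain c where c: "A = c \<cdot>\<^sub>m 1\<^sub>m n" "cmod c = 1" by (auto simp: circle_scalars_def)
    have "inv\<^bsub>U_group n\<^esub> A = cnj c \<cdot>\<^sub>m 1\<^sub>m n"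
      using 3 circle_scalars_subset U_group_inv c mat_adjoint_smult_one by (metis subsetD)
    then show ?case unfolding circle_scalars_def using c(2) by (auto intro: exI[of _ "cnj c"])
  next
    case (4 A B)
    then obtain c d where "A = c \<cdot>\<^sub>m 1\<^sub>m n" "cmod c = 1" "B = d \<cdot>\<^sub>m 1\<^sub>m n" "cmod d = 1"
      by (auto simp: circle_scalars_def)
    then have "A * B = (c * d) \<cdot>\<^sub>m 1\<^sub>m n" "cmod (c * d) = 1"
      by (auto intro!: eq_matI simp: mult_smult_distrib[of _ n n] norm_mult)
    then show ?case unfolding circle_scalars_def by auto
  qed
  show ?thesis
  proof (rule U.normalI[OF sub], rule ballI)
    fix A assume A: "A \<in> carrier (U_group n)"
    then show "circle_scalars n #>\<^bsub>U_group n\<^esub> A = A <#\<^bsub>U_group n\<^esub> circle_scalars n"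
      by (auto simp: r_coset_def l_coset_def circle_scalars_def U_group_carrier scalar_commute)
  qed
qed

lemma PU_group_group: "group (PU_group n)"
  unfolding PU_group_def by (rule normal.factorgroup_is_group[OF circle_scalars_normal])

lemma PU_group_carrier: "carrier (PU_group n) = PU_class n ` carrier (U_group n)"
  by (auto simp: PU_group_def FactGroup_def RCOSETS_def PU_class_def)

lemma PU_class_hom: "PU_class n \<in> hom (U_group n) (PU_group n)"
  using normal.r_coset_hom_Mod[OF circle_scalars_normal, of n]
  by (simp add: PU_class_def[abs_def] PU_group_def)

lemma SU_group_hom_GL: "\<pi> \<in> hom G (SU_group n) \<Longrightarrow> \<pi> \<in> hom G (GL_group n)"
proof -
  assume "\<pi> \<in> hom G (SU_group n)"
  moreover have "A \<in> carrier (GL_group n)" if "A \<in> carrier (SU_group n)" for A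
    using that by (auto simp: SU_group_def U_group_carrier GL_group_def units_of_def
        Units_def ring_mat_def intro: mat_adjoint_carrier)
  ultimately show ?thesis
    by (auto simp: hom_def Pi_def SU_group_def GL_group_def units_of_def ring_mat_def)
qed

lemma topspace_mat_topology: "topspace (mat_topology n) = carrier_mat n n"
  by (auto simp: mat_topology_def topspace_pullback_topology)

lemma topspace_U_topology: "topspace (U_topology n) = carrier (U_group n)"
  by (auto simp: U_topology_def topspace_mat_topology U_group_carrier)

lemma openin_PU_topology:
  "openin (PU_topology n) V \<longleftrightarrow>
     V \<subseteq> carrier (PU_group n) \<and>
     openin (U_topology n) {A \<in> carrier (U_group n). PU_class n A \<in> V}"
proof -
  let ?P = "\<lambda>V. {A \<in> carrier (U_group n). PU_class n A \<in> V}"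
  have "?P (S \<inter> T) = ?P S \<inter> ?P T" for S T by auto
  moreover have "?P (\<Union>\<K>) = \<Union>(?P ` \<K>)" for \<K> by auto
  ultimately have "istopology (\<lambda>V. V \<subseteq> carrier (PU_group n) \<and> openin (U_topology n) (?P V))"
    unfolding istopology_def by (auto intro!: openin_Int openin_Union simp del: Union_iff)
  then show ?thesis by (simp add: PU_topology_def topology_inverse')
qed

lemma topspace_PU_topology: "topspace (PU_topology n) = carrier (PU_group n)"
proof -
  have "{A \<in> carrier (U_group n). PU_class n A \<in> carrier (PU_group n)} = topspace (U_topology n)"
    by (auto simp: PU_group_carrier topspace_U_topology)
  then have "openin (PU_topology n) (carrier (PU_group n))"
    unfolding openin_PU_topology by simp
  moreover have "topspace (PU_topology n) \<subseteq> carrier (PU_group n)"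
    using openin_PU_topology[of n "topspace (PU_topology n)"] by simp
  ultimately show ?thesis by (meson openin_subset subset_antisym)
qed

lemma quotient_map_PU_class: "quotient_map (U_topology n) (PU_topology n) (PU_class n)"
  unfolding quotient_map_def
  by (auto simp: topspace_PU_topology topspace_U_topology PU_group_carrier openin_PU_topology)

end

theory Submission
  imports
    Defs
    "HOL-Analysis.Abstract_Limits"
    "HOL-Analysis.L2_Norm"
    "Jordan_Normal_Form.Spectral_Radius"
begin

text \<open>
  Every part of the theorem passes through one condition on \<open>K = \<pi>(G)\<close>: there is a set \<open>S\<close> of
  pairwise commuting matrices, closed under adjoints and under conjugation by \<open>K\<close>, with a member that
  is not a scalar matrix (\<open>commuting_matrices\<close> describes such sets). A non-trivial torus normalized
  by \<open>K\<close> is such a set, because a connected set of scalar matrices of determinant \<open>1\<close> is a single point,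
  and so is a non-zero invariant abelian subalgebra of \<open>su(n)\<close>, because a traceless scalar matrix is zero.

  Conversely, let such an \<open>S\<close> be given. The traceless skew-Hermitian matrices in the bicommutant of \<open>S\<close>
  form a non-zero invariant abelian Lie subalgebra. The minimal orthogonal projections in the bicommutant
  are mutually orthogonal, have sum \<open>1\<close>, and are permuted by \<open>K\<close>, transitively since \<open>\<pi>\<close> is irreducible.
  If they are \<open>P\<^sub>1, \<dots>, P\<^sub>k\<close>, then the matrices \<open>\<Sum> z\<^sub>j P\<^sub>j\<close> with \<open>\<bar>z\<^sub>j\<bar> = 1\<close> and \<open>\<Prod> z\<^sub>j = 1\<close> form a torus
  normalized by \<open>K\<close> (\<open>permuted_family_torus\<close>). Its members have determinant \<open>1\<close> because, by transitivity,
  \<open>det (z P\<^sub>j + (1 - P\<^sub>j))\<close> is the same multiplicative function of \<open>z\<close> for every \<open>j\<close>.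

  A non-zero projection has trace at least \<open>1\<close>, so that \<open>k \<le> n\<close>, and \<open>G\<close> acts non-trivially on the
  \<open>k\<close> projections; this is a non-trivial homomorphism to \<open>Sym(n)\<close>. The associated permutation
  representation of dimension \<open>n\<close> is reducible, since it preserves the line of constant vectors. Hence
  it has a non-trivial irreducible constituent of dimension less than \<open>n\<close>, and \<open>n\<close> is not least.

  Uniform discreteness is Zassenhaus' argument. Let \<open>H\<close> be a discrete subgroup of \<open>PU(n)\<close> that contains
  the image of \<open>G\<close>, and let \<open>S\<close> be the set of those matrices in the preimage of \<open>H\<close> in \<open>U(n)\<close> whose
  Frobenius distance from \<open>1\<close> is less than \<open>1/4\<close>. For \<open>A\<close> and \<open>B\<close> in \<open>S\<close> the iterated commutators
  \<open>[A, B]\<close>, \<open>[A, [A, B]]\<close>, \<dots> tend to \<open>1\<close>, hence become scalar as \<open>H\<close> is discrete, and then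
  \<open>commute_if_commutes_with_commutator\<close> leads back to \<open>A B = B A\<close>. So \<open>S\<close> consists of scalar matrices
  if \<open>K\<close> normalizes no non-trivial torus, and the image of the ball of radius \<open>1/4\<close> in \<open>PU(n)\<close>
  meets every such \<open>H\<close> in \<open>1\<close> only. A subgroup that meets some neighbourhood of \<open>1\<close> in \<open>1\<close> only is discrete, so
  the union of a chain of such subgroups \<open>H\<close> is discrete again, and Zorn's lemma gives a maximal one.
\<close>

section \<open>Adjoint, trace and Frobenius norm\<close>

lemma index_mat_mult_sum:
  fixes A B :: "complex mat"
  assumes "A \<in> carrier_mat n k" "B \<in> carrier_mat k m" "i < n" "j < m"
  shows "(A * B) $$ (i, j) = (\<Sum>l<k. A $$ (i, l) * B $$ (l, j))"
  using assms by (simp add: scalar_prod_def atLeast0LessThan)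

lemma index_mat_vec_sum:
  fixes A :: "complex mat"
  assumes "A \<in> carrier_mat n k" "v \<in> carrier_vec k" "i < n"
  shows "(A *\<^sub>v v) $ i = (\<Sum>l<k. A $$ (i, l) * v $ l)"
  using assms by (simp add: scalar_prod_def atLeast0LessThan)

lemma mat_eq_if_mult_vec_eq:
  fixes A B :: "complex mat"
  assumes A: "A \<in> carrier_mat n m" and B: "B \<in> carrier_mat n m"
    and eq: "\<And>v. v \<in> carrier_vec m \<Longrightarrow> A *\<^sub>v v = B *\<^sub>v v"
  shows "A = B"
proof (rule eq_matI)
  fix i j assume "i < dim_row B" "j < dim_col B"
  then have ij: "i < n" "j < m" using B by auto
  have "(\<Sum>l<m. A $$ (i, l) * unit_vec m j $ l) = (\<Sum>l<m. B $$ (i, l) * unit_vec m j $ l)"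
    using eq[of "unit_vec m j"] index_mat_vec_sum[OF A _ ij(1)] index_mat_vec_sum[OF B _ ij(1)]
    by (metis unit_vec_carrier)
  then show "A $$ (i, j) = B $$ (i, j)"
    using ij by (simp add: unit_vec_def if_distrib[of "\<lambda>x. _ * x"] cong: if_cong)
qed (use A B in auto)

lemma eq_if_minus_eq_zero:
  fixes A B :: "complex mat"
  assumes A: "A \<in> carrier_mat n m" and B: "B \<in> carrier_mat n m" and zero: "A - B = 0\<^sub>m n m"
  shows "A = B"
proof (rule eq_matI)
  fix i j assume "i < dim_row B" "j < dim_col B"
  then show "A $$ (i, j) = B $$ (i, j)"
    using arg_cong[OF zero, of "\<lambda>M. M $$ (i, j)"] A B by (simp del: index_zero_mat(2,3))
qed (use A B in auto)

lemma adjoint_mult: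
  fixes A B :: "complex mat"
  assumes A: "A \<in> carrier_mat n k" and B: "B \<in> carrier_mat k m"
  shows "mat_adjoint (A * B) = mat_adjoint B * mat_adjoint A"
proof (rule eq_matI)
  have AB: "A * B \<in> carrier_mat n m" using A B by simp
  note c = mat_adjoint_carrier[OF A] mat_adjoint_carrier[OF B] mat_adjoint_carrier[OF AB]
  show "dim_row (mat_adjoint (A * B)) = dim_row (mat_adjoint B * mat_adjoint A)"
    "dim_col (mat_adjoint (A * B)) = dim_col (mat_adjoint B * mat_adjoint A)" using c by auto
  fix i j assume "i < dim_row (mat_adjoint B * mat_adjoint A)"
    "j < dim_col (mat_adjoint B * mat_adjoint A)"
  then have ij: "i < m" "j < n" using c by auto
  show "mat_adjoint (A * B) $$ (i, j) = (mat_adjoint B * mat_adjoint A) $$ (i, j)"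
    unfolding mat_adjoint_index[OF AB ij] index_mat_mult_sum[OF A B ij(2,1)]
      index_mat_mult_sum[OF c(2,1) ij]
    using ij by (simp add: mat_adjoint_index[OF A] mat_adjoint_index[OF B] mult.commute)
qed

lemma adjoint_adjoint:
  fixes A :: "complex mat"
  assumes A: "A \<in> carrier_mat n m"
  shows "mat_adjoint (mat_adjoint A) = A"
  using mat_adjoint_carrier[OF A] mat_adjoint_carrier[OF mat_adjoint_carrier[OF A]] A
  by (intro eq_matI)
    (auto simp: mat_adjoint_index[OF A] mat_adjoint_index[OF mat_adjoint_carrier[OF A]])

lemma
  fixes A B :: "complex mat"
  assumes A: "A \<in> carrier_mat n m" and B: "B \<in> carrier_mat n m"
  shows adjoint_add: "mat_adjoint (A + B) = mat_adjoint A + mat_adjoint B"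
    and adjoint_minus: "mat_adjoint (A - B) = mat_adjoint A - mat_adjoint B"
proof -
  have AB: "A + B \<in> carrier_mat n m" "A - B \<in> carrier_mat n m"
    using A B minus_carrier_mat[OF B, of A] by auto
  note c = mat_adjoint_carrier[OF A] mat_adjoint_carrier[OF B] AB[THEN mat_adjoint_carrier]
  show "mat_adjoint (A + B) = mat_adjoint A + mat_adjoint B"
    "mat_adjoint (A - B) = mat_adjoint A - mat_adjoint B"
    using A B c by (auto simp: mat_adjoint_index[OF A] mat_adjoint_index[OF B]
      mat_adjoint_index[OF AB(1)] mat_adjoint_index[OF AB(2)] intro!: eq_matI)
qed

lemma adjoint_smult:
  fixes A :: "complex mat"
  assumes A: "A \<in> carrier_mat n m"
  shows "mat_adjoint (a \<cdot>\<^sub>m A) = cnj a \<cdot>\<^sub>m mat_adjoint A"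
proof -
  have AB: "a \<cdot>\<^sub>m A \<in> carrier_mat n m" using A by auto
  note c = mat_adjoint_carrier[OF A] mat_adjoint_carrier[OF AB]
  show ?thesis using A c by (intro eq_matI)
    (auto simp: mat_adjoint_index[OF A] mat_adjoint_index[OF AB])
qed

lemma adjoint_zero: "mat_adjoint (0\<^sub>m n m :: complex mat) = 0\<^sub>m m n"
  using mat_adjoint_carrier[OF zero_carrier_mat[of n m], where 'a = complex]
  by (intro eq_matI) (auto simp: mat_adjoint_index[of "0\<^sub>m n m" n m])

definition mtrace :: "complex mat \<Rightarrow> complex" where
  "mtrace A = (\<Sum>i<dim_row A. A $$ (i, i))"

lemma mtrace_comm:
  assumes A: "A \<in> carrier_mat n m" and B: "B \<in> carrier_mat m n"
  shows "mtrace (A * B) = mtrace (B * A)"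
proof -
  have "mtrace (A * B) = (\<Sum>i<n. \<Sum>l<m. A $$ (i, l) * B $$ (l, i))"
    using A unfolding mtrace_def by (simp add: index_mat_mult_sum[OF A B] del: index_mult_mat(1))
  also have "\<dots> = (\<Sum>l<m. \<Sum>i<n. B $$ (l, i) * A $$ (i, l))"
    by (subst sum.swap) (simp add: mult.commute)
  also have "\<dots> = mtrace (B * A)"
    using B unfolding mtrace_def by (simp add: index_mat_mult_sum[OF B A] del: index_mult_mat(1))
  finally show ?thesis .
qed

lemma mtrace_add:
  "A \<in> carrier_mat n n \<Longrightarrow> B \<in> carrier_mat n n \<Longrightarrow> mtrace (A + B) = mtrace A + mtrace B"
  by (auto simp: mtrace_def sum.distrib)

lemma mtrace_minus:
  "A \<in> carrier_mat n n \<Longrightarrow> B \<in> carrier_mat n n \<Longrightarrow> mtrace (A - B) = mtrace A - mtrace B"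
  by (auto simp: mtrace_def sum_subtractf)

lemma mtrace_smult: "A \<in> carrier_mat n n \<Longrightarrow> mtrace (c \<cdot>\<^sub>m A) = c * mtrace A"
  by (auto simp: mtrace_def sum_distrib_left)

lemma mtrace_one: "mtrace (1\<^sub>m n) = of_nat n"
  by (simp add: mtrace_def)

lemma mtrace_adjoint: "A \<in> carrier_mat n n \<Longrightarrow> mtrace (mat_adjoint A) = cnj (mtrace A)"
  using mat_adjoint_carrier[of A n n] by (auto simp: mtrace_def mat_adjoint_index[of A n n])

definition frob :: "complex mat \<Rightarrow> real" where
  "frob A = L2_set (\<lambda>ij. cmod (A $$ ij)) ({..<dim_row A} \<times> {..<dim_col A})"

lemma frob_nonneg [simp]: "0 \<le> frob A"
  by (simp add: frob_def)

lemma frob_square: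
  "A \<in> carrier_mat n m \<Longrightarrow> (frob A)\<^sup>2 = (\<Sum>i<n. \<Sum>j<m. (cmod (A $$ (i, j)))\<^sup>2)"
  by (auto simp: frob_def L2_set_def sum_nonneg sum.cartesian_product)

lemma frob_square_mtrace:
  assumes A: "A \<in> carrier_mat n m"
  shows "of_real ((frob A)\<^sup>2) = mtrace (mat_adjoint A * A)"
proof -
  note c = mat_adjoint_carrier[OF A]
  have "mtrace (mat_adjoint A * A) = (\<Sum>j<m. \<Sum>i<n. cnj (A $$ (i, j)) * A $$ (i, j))"
    using A c unfolding mtrace_def
    by (simp add: index_mat_mult_sum[OF c A] mat_adjoint_index[OF A] del: index_mult_mat(1))
  also have "\<dots> = (\<Sum>i<n. \<Sum>j<m. of_real ((cmod (A $$ (i, j)))\<^sup>2))"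
    by (subst sum.swap)
      (simp add: complex_norm_square mult.commute del: of_real_power of_real_mult flip: complex_norm_square)
  finally show ?thesis by (simp add: frob_square[OF A])
qed

lemma frob_eq_0_iff: "A \<in> carrier_mat n m \<Longrightarrow> frob A = 0 \<longleftrightarrow> A = 0\<^sub>m n m"
  by (auto simp: frob_def L2_set_eq_0_iff)

lemma frob_adjoint:
  assumes A: "A \<in> carrier_mat n m"
  shows "frob (mat_adjoint A) = frob A"
proof -
  note c = mat_adjoint_carrier[OF A]
  have "of_real ((frob (mat_adjoint A))\<^sup>2) = (of_real ((frob A)\<^sup>2) :: complex)"
    unfolding frob_square_mtrace[OF A] frob_square_mtrace[OF c] adjoint_adjoint[OF A]
    by (rule mtrace_comm[OF A c])
  then show ?thesis by (metis of_real_eq_iff frob_nonneg power2_eq_iff_nonneg)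
qed

lemma frob_triangle_minus:
  assumes A: "A \<in> carrier_mat n m" and B: "B \<in> carrier_mat n m"
  shows "frob (A - B) \<le> frob A + frob B"
proof -
  let ?I = "{..<n} \<times> {..<m}"
  have "frob (A - B) = L2_set (\<lambda>ij. cmod (A $$ ij - B $$ ij)) ?I"
    using A B by (auto simp: frob_def intro!: L2_set_cong)
  also have "\<dots> \<le> L2_set (\<lambda>ij. cmod (A $$ ij) + cmod (B $$ ij)) ?I"
    by (intro L2_set_mono norm_triangle_ineq4) auto
  also have "\<dots> \<le> frob A + frob B"
    using A B L2_set_triangle_ineq[of "\<lambda>ij. cmod (A $$ ij)" "\<lambda>ij. cmod (B $$ ij)" ?I]
    by (auto simp: frob_def)
  finally show ?thesis .
qed

text \<open>
  By the Cauchy-Schwarz inequality for each entry of the product; the bound has constant \<open>1\<close> in every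
  dimension, and this is why the radius \<open>1/4\<close> below does not depend on \<open>n\<close>.
\<close>

lemma frob_mult:
  assumes A: "A \<in> carrier_mat n k" and B: "B \<in> carrier_mat k m"
  shows "frob (A * B) \<le> frob A * frob B"
proof (rule power2_le_imp_le)
  have AB: "A * B \<in> carrier_mat n m" using A B by auto
  have entry: "(cmod ((A * B) $$ (i, j)))\<^sup>2
      \<le> (\<Sum>l<k. (cmod (A $$ (i, l)))\<^sup>2) * (\<Sum>l<k. (cmod (B $$ (l, j)))\<^sup>2)"
    if "i < n" "j < m" for i j
  proof -
    have "cmod ((A * B) $$ (i, j)) \<le> (\<Sum>l<k. cmod (A $$ (i, l)) * cmod (B $$ (l, j)))"
      unfolding index_mat_mult_sum[OF A B that] by (metis (no_types, lifting) norm_mult norm_sum sum.cong)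
    also have "\<dots> \<le> L2_set (\<lambda>l. cmod (A $$ (i, l))) {..<k} * L2_set (\<lambda>l. cmod (B $$ (l, j))) {..<k}"
      using L2_set_mult_ineq[of "\<lambda>l. cmod (A $$ (i, l))" "\<lambda>l. cmod (B $$ (l, j))" "{..<k}"] by simp
    finally have "(cmod ((A * B) $$ (i, j)))\<^sup>2 \<le> \<dots>\<^sup>2" by (simp add: power_mono)
    then show ?thesis by (simp add: power_mult_distrib L2_set_def sum_nonneg)
  qed
  have "(frob (A * B))\<^sup>2 \<le> (\<Sum>i<n. \<Sum>j<m.
      (\<Sum>l<k. (cmod (A $$ (i, l)))\<^sup>2) * (\<Sum>l<k. (cmod (B $$ (l, j)))\<^sup>2))"
    unfolding frob_square[OF AB] by (intro sum_mono entry) auto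
  also have "\<dots> = (\<Sum>i<n. \<Sum>l<k. (cmod (A $$ (i, l)))\<^sup>2) * (\<Sum>j<m. \<Sum>l<k. (cmod (B $$ (l, j)))\<^sup>2)"
    by (simp add: sum_product)
  also have "\<dots> = (frob A * frob B)\<^sup>2"
    unfolding power_mult_distrib frob_square[OF A] frob_square[OF B]
    by (subst (3) sum.swap) simp
  finally show "(frob (A * B))\<^sup>2 \<le> (frob A * frob B)\<^sup>2" .
qed simp

lemma cmod_mtrace_mult_le:
  assumes A: "A \<in> carrier_mat n m" and B: "B \<in> carrier_mat m n"
  shows "cmod (mtrace (A * B)) \<le> frob A * frob B"
proof -
  let ?I = "{..<n} \<times> {..<m}"
  have B': "frob B = L2_set (\<lambda>ij. cmod (B $$ (snd ij, fst ij))) ?I"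
  proof -
    have "frob B = frob (mat_adjoint B)" by (rule frob_adjoint[OF B, symmetric])
    also have "\<dots> = L2_set (\<lambda>ij. cmod (B $$ (snd ij, fst ij))) ?I"
      using mat_adjoint_carrier[OF B]
      by (auto simp: frob_def mat_adjoint_index[OF B] intro!: L2_set_cong)
    finally show ?thesis .
  qed
  have "mtrace (A * B) = (\<Sum>i<n. \<Sum>l<m. A $$ (i, l) * B $$ (l, i))"
    using A unfolding mtrace_def by (simp add: index_mat_mult_sum[OF A B] del: index_mult_mat(1))
  also have "\<dots> = (\<Sum>ij\<in>?I. A $$ ij * B $$ (snd ij, fst ij))"
    by (simp add: sum.cartesian_product case_prod_unfold)
  also have "cmod \<dots> \<le> (\<Sum>ij\<in>?I. \<bar>cmod (A $$ ij)\<bar> * \<bar>cmod (B $$ (snd ij, fst ij))\<bar>)"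
    by (rule order_trans[OF norm_sum]) (simp add: norm_mult)
  also have "\<dots> \<le> frob A * frob B"
    unfolding B' using A L2_set_mult_ineq[of "\<lambda>ij. cmod (A $$ ij)" "\<lambda>ij. cmod (B $$ (snd ij, fst ij))" ?I]
    by (auto simp: frob_def)
  finally show ?thesis .
qed

lemma frob_isometry_mult:
  assumes A: "A \<in> carrier_mat n m" and U: "U \<in> carrier_mat k n" and "mat_adjoint U * U = 1\<^sub>m n"
  shows "frob (U * A) = frob A"
proof -
  note cU = mat_adjoint_carrier[OF U] and cA = mat_adjoint_carrier[OF A]
  have UA: "U * A \<in> carrier_mat k m" using U A by auto
  have "mat_adjoint (U * A) * (U * A) = mat_adjoint A * (mat_adjoint U * (U * A))"
    using cA cU UA by (simp add: adjoint_mult[OF U A] assoc_mult_mat[of _ m n _ k _ m])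
  also have "mat_adjoint U * (U * A) = (mat_adjoint U * U) * A"
    using A U cU by (simp add: assoc_mult_mat[of _ n k _ n _ m])
  finally have eq: "mat_adjoint (U * A) * (U * A) = mat_adjoint A * A"
    using A assms by simp
  have "of_real ((frob (U * A))\<^sup>2) = (of_real ((frob A)\<^sup>2) :: complex)"
    unfolding frob_square_mtrace[OF A] frob_square_mtrace[OF UA] eq ..
  then show ?thesis by (metis of_real_eq_iff frob_nonneg power2_eq_iff_nonneg)
qed

lemma frob_mult_coisometry:
  assumes A: "A \<in> carrier_mat m n" and U: "U \<in> carrier_mat n k" and "U * mat_adjoint U = 1\<^sub>m n"
  shows "frob (A * U) = frob A"
proof -
  have "frob (A * U) = frob (mat_adjoint U * mat_adjoint A)"
    using frob_adjoint[of "A * U" m k] A U by (simp add: adjoint_mult[OF A U])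
  also have "\<dots> = frob (mat_adjoint A)"
    by (rule frob_isometry_mult) (use assms adjoint_adjoint[OF U] in \<open>auto intro: mat_adjoint_carrier\<close>)
  also have "\<dots> = frob A" by (rule frob_adjoint[OF A])
  finally show ?thesis .
qed

lemma sq_mat_laws:
  fixes A B C :: "complex mat"
  assumes "A \<in> carrier_mat n n" "B \<in> carrier_mat n n" "C \<in> carrier_mat n n"
  shows "(A * B) * C = A * (B * C)" "A * (B + C) = A * B + A * C" "(A + B) * C = A * C + B * C"
    "A * (B - C) = A * B - A * C" "(A - B) * C = A * C - B * C"
  using assms by (simp_all add: mult_add_distrib_mat[of _ n n] add_mult_distrib_mat[of _ n n]
      mult_minus_distrib_mat[of _ n n] minus_mult_distrib_mat[of _ n n])

lemma zero_mat_mult_vec: "v \<in> carrier_vec m \<Longrightarrow> 0\<^sub>m n m *\<^sub>v v = (0\<^sub>v n :: complex vec)"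
  by (intro eq_vecI) auto

section \<open>Orthogonal projections\<close>

definition orth_proj :: "nat \<Rightarrow> complex mat \<Rightarrow> bool" where
  "orth_proj n P \<longleftrightarrow> P \<in> carrier_mat n n \<and> P * P = P \<and> mat_adjoint P = P"

lemma orth_projD:
  assumes "orth_proj n P"
  shows "P \<in> carrier_mat n n" "P * P = P" "mat_adjoint P = P"
  using assms by (auto simp: orth_proj_def)

lemma orth_proj_one: "orth_proj n (1\<^sub>m n)"
  by (simp add: orth_proj_def mat_adjoint_one)

lemma orth_proj_minus:
  assumes P: "orth_proj n P" and Q: "orth_proj n Q" and PQ: "P * Q = Q" "Q * P = Q"
  shows "orth_proj n (P - Q)"
proof -
  note c = orth_projD[OF P] orth_projD[OF Q]
  have "(P - Q) * (P - Q) = (P * P - Q * P) - (P * Q - Q * Q)"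
    using c(1,4) sq_mat_laws(4)[of "P - Q" n P Q] sq_mat_laws(5)[of P n Q P]
      sq_mat_laws(5)[of P n Q Q] minus_carrier_mat[OF c(4), of P] by simp
  also have "\<dots> = P - Q" using c PQ by (intro eq_matI) auto
  finally show ?thesis
    using c minus_carrier_mat[OF c(4), of P] by (simp add: orth_proj_def adjoint_minus[OF c(1,4)])
qed

lemma orth_proj_complement: "orth_proj n P \<Longrightarrow> orth_proj n (1\<^sub>m n - P)"
  using orth_proj_minus[OF orth_proj_one, of n P] orth_projD(1)[of n P] by simp

lemma orth_proj_mult:
  assumes P: "orth_proj n P" and Q: "orth_proj n Q" and PQ: "P * Q = Q * P"
  shows "orth_proj n (P * Q)"
proof -
  note c = orth_projD[OF P] orth_projD[OF Q]
  have "P * Q * (P * Q) = P * (Q * P * Q)"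
    using c(1,4) by (simp add: sq_mat_laws(1)[where n = n])
  also have "Q * P * Q = P * (Q * Q)" using c(1,4) PQ by (metis assoc_mult_mat)
  also have "P * (P * (Q * Q)) = (P * P) * Q" using c(1,4,5) by simp
  finally have "P * Q * (P * Q) = P * Q" using c by simp
  moreover have "mat_adjoint (P * Q) = P * Q" using c PQ by (metis adjoint_mult)
  ultimately show ?thesis using c by (simp add: orth_proj_def)
qed

lemma orth_proj_conj:
  assumes P: "orth_proj n P" and U: "U \<in> carrier (U_group n)"
  shows "orth_proj n (U * P * mat_adjoint U)"
proof -
  note c = orth_projD[OF P]
  from U have cU: "U \<in> carrier_mat n n" "mat_adjoint U \<in> carrier_mat n n" "mat_adjoint U * U = 1\<^sub>m n"
    by (auto simp: U_group_carrier intro: mat_adjoint_carrier)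
  have "U * P * mat_adjoint U * (U * P * mat_adjoint U) = U * P * (mat_adjoint U * U) * P * mat_adjoint U"
    using c(1) cU(1,2) by (simp add: assoc_mult_mat[of _ n n _ n _ n])
  also have "\<dots> = U * (P * P) * mat_adjoint U" unfolding cU(3) using c(1) cU(1,2) by simp
  finally have "U * P * mat_adjoint U * (U * P * mat_adjoint U) = U * P * mat_adjoint U"
    unfolding c(2) .
  moreover have "mat_adjoint (U * P * mat_adjoint U) = U * P * mat_adjoint U"
    using c cU(1,2) by (simp add: adjoint_mult[of _ n n _ n] adjoint_adjoint[of _ n n])
  ultimately show ?thesis using c cU by (simp add: orth_proj_def)
qed

text \<open>
  For orthogonal projections the squared Frobenius norm is the trace, that is, the rank. It measures
  the size of projections below.
\<close>

lemma orth_proj_mtrace: "orth_proj n P \<Longrightarrow> mtrace P = of_real ((frob P)\<^sup>2)"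
  using frob_square_mtrace[of P n n] by (simp add: orth_proj_def)

lemma frob_square_orth_proj_minus:
  assumes P: "orth_proj n P" and Q: "orth_proj n Q" and D: "orth_proj n (P - Q)"
  shows "(frob (P - Q))\<^sup>2 = (frob P)\<^sup>2 - (frob Q)\<^sup>2"
proof -
  have "mtrace (P - Q) = mtrace P - mtrace Q"
    by (rule mtrace_minus[OF orth_projD(1)[OF P] orth_projD(1)[OF Q]])
  then have "of_real ((frob (P - Q))\<^sup>2) = (of_real ((frob P)\<^sup>2 - (frob Q)\<^sup>2) :: complex)"
    by (simp add: orth_proj_mtrace[OF P] orth_proj_mtrace[OF Q] orth_proj_mtrace[OF D])
  then show ?thesis by (simp only: of_real_eq_iff)
qed

lemma frob_square_one: "(frob (1\<^sub>m n))\<^sup>2 = n"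
proof -
  have "of_real ((frob (1\<^sub>m n))\<^sup>2) = (of_real (real n) :: complex)"
    using orth_proj_mtrace[OF orth_proj_one, of n] by (simp add: mtrace_one)
  then show ?thesis by (simp only: of_real_eq_iff)
qed

text \<open>
  Submultiplicativity of the norm, applied to \<open>P = P P\<close>, gives this substitute for the integrality of the rank.
\<close>

lemma orth_proj_frob_ge_1:
  assumes P: "orth_proj n P" and "P \<noteq> 0\<^sub>m n n"
  shows "1 \<le> (frob P)\<^sup>2"
proof -
  note c = orth_projD[OF P]
  have "0 < frob P" using frob_eq_0_iff[OF c(1)] assms(2) frob_nonneg[of P] by linarith
  moreover have "frob P * 1 \<le> frob P * frob P" using frob_mult[OF c(1,1)] c(2) by simp
  ultimately have "1 \<le> frob P" using mult_le_cancel_left_pos by blast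
  then show ?thesis by simp
qed

lemma orth_proj_frob_le:
  assumes P: "orth_proj n P"
  shows "(frob P)\<^sup>2 \<le> n"
  using frob_square_orth_proj_minus[OF orth_proj_one P orth_proj_complement[OF P]] frob_square_one[of n]
    zero_le_power2[of "frob (1\<^sub>m n - P)"] by linarith

lemma orth_proj_of_isometry:
  assumes J: "J \<in> carrier_mat n r" and iso: "mat_adjoint J * J = 1\<^sub>m r"
  shows "orth_proj n (J * mat_adjoint J)" "(frob (J * mat_adjoint J))\<^sup>2 = r"
proof -
  note c = mat_adjoint_carrier[OF J]
  have "J * mat_adjoint J * (J * mat_adjoint J) = J * (mat_adjoint J * J) * mat_adjoint J"
    using J c by (simp add: assoc_mult_mat[of _ n r _ n _ n] assoc_mult_mat[of _ n r _ n _ r]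
      assoc_mult_mat[of _ n r _ r _ n] assoc_mult_mat[of _ r n _ r _ n])
  then have sq: "J * mat_adjoint J * (J * mat_adjoint J) = J * mat_adjoint J"
    unfolding iso using J by simp
  show P: "orth_proj n (J * mat_adjoint J)"
    using J c sq by (simp add: orth_proj_def adjoint_mult[OF J c] adjoint_adjoint[OF J])
  have "mtrace (J * mat_adjoint J) = of_nat r" using mtrace_comm[OF J c] iso by (simp add: mtrace_one)
  then have "of_real ((frob (J * mat_adjoint J))\<^sup>2) = (of_real (real r) :: complex)"
    using orth_proj_mtrace[OF P] by simp
  then show "(frob (J * mat_adjoint J))\<^sup>2 = r" by (simp only: of_real_eq_iff)
qed

lemma adjoint_mult_index:
  assumes J: "J \<in> carrier_mat n r" and K: "K \<in> carrier_mat n s" and "i < r" "j < s"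
  shows "(mat_adjoint J * K) $$ (i, j) = (\<Sum>l<n. cnj (J $$ (l, i)) * K $$ (l, j))"
  using index_mat_mult_sum[OF mat_adjoint_carrier[OF J] K] assms
  by (simp add: mat_adjoint_index[OF J])

text \<open>
  The columns of \<open>J\<close> are an orthonormal basis of \<open>W\<close>, and \<open>J J\<^sup>*\<close> is the orthogonal projection onto \<open>W\<close>.
  The basis is a largest orthonormal system in \<open>W\<close>: if the projection onto its span moved a vector \<open>w\<close>
  of \<open>W\<close>, then the normalized difference could be added to the system.
\<close>

lemma orthonormal_basis_of_subspace:
  fixes W :: "complex vec set"
  assumes W: "W \<subseteq> carrier_vec n" and zero: "0\<^sub>v n \<in> W"
    and add: "\<And>v w. v \<in> W \<Longrightarrow> w \<in> W \<Longrightarrow> v + w \<in> W"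
    and smult: "\<And>c v. v \<in> W \<Longrightarrow> c \<cdot>\<^sub>v v \<in> W"
  obtains r J where "J \<in> carrier_mat n r" "mat_adjoint J * J = 1\<^sub>m r"
    "\<And>v. v \<in> carrier_vec n \<Longrightarrow> (J * mat_adjoint J) *\<^sub>v v = v \<longleftrightarrow> v \<in> W"
proof -
  define iso where "iso r J \<longleftrightarrow> J \<in> carrier_mat n r \<and> mat_adjoint J * J = 1\<^sub>m r
    \<and> (\<forall>v\<in>carrier_vec r. J *\<^sub>v v \<in> W)" for r J
  have bound: "r \<le> n" if "iso r J" for r J
    using that orth_proj_of_isometry[of J n r] orth_proj_frob_le[of n "J * mat_adjoint J"]
    unfolding iso_def by auto
  have "iso 0 (0\<^sub>m n 0)"
  proof -
    have "mat_adjoint (0\<^sub>m n 0) * 0\<^sub>m n 0 = (1\<^sub>m 0 :: complex mat)"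
      by (rule eq_matI) (auto simp: adjoint_zero)
    moreover have "0\<^sub>m n 0 *\<^sub>v v = 0\<^sub>v n" if "v \<in> carrier_vec 0" for v :: "complex vec"
      using that by (intro eq_vecI) (auto simp: scalar_prod_def)
    ultimately show ?thesis using zero by (simp add: iso_def)
  qed
  then obtain r where "\<exists>J. iso r J" and max: "\<And>s. \<exists>J. iso s J \<Longrightarrow> s \<le> r"
    using ex_has_greatest_nat[of "\<lambda>r. \<exists>J. iso r J" 0 "\<lambda>r. r" "Suc n"] bound
    by (metis le_imp_less_Suc)
  then obtain J where J: "iso r J" by blast
  then have cJ: "J \<in> carrier_mat n r" and JJ: "mat_adjoint J * J = 1\<^sub>m r"
    and JW: "\<And>v. v \<in> carrier_vec r \<Longrightarrow> J *\<^sub>v v \<in> W"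
    by (auto simp: iso_def)
  note cA = mat_adjoint_carrier[OF cJ]
  have PW: "(J * mat_adjoint J) *\<^sub>v v \<in> W" if "v \<in> carrier_vec n" for v
    using JW[of "mat_adjoint J *\<^sub>v v"] cJ cA that by (simp add: assoc_mult_mat_vec[of _ n r _ n])
  have "(J * mat_adjoint J) *\<^sub>v w = w" if w: "w \<in> W" for w
  proof (rule ccontr)
    assume neq: "(J * mat_adjoint J) *\<^sub>v w \<noteq> w"
    have cw: "w \<in> carrier_vec n" using w W by auto
    define u0 where "u0 = w - (J * mat_adjoint J) *\<^sub>v w"
    have u0W: "u0 \<in> W"
    proof -
      have "u0 = w + (-1) \<cdot>\<^sub>v ((J * mat_adjoint J) *\<^sub>v w)"
        unfolding u0_def using cw cJ cA by (intro eq_vecI) auto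
      then show ?thesis using add[OF w smult[OF PW[OF cw]]] by simp
    qed
    then have cu0: "u0 \<in> carrier_vec n" using W by auto
    have "mat_adjoint J *\<^sub>v ((J * mat_adjoint J) *\<^sub>v w) = (mat_adjoint J * J) *\<^sub>v (mat_adjoint J *\<^sub>v w)"
      using cJ cA cw
      by (simp add: assoc_mult_mat_vec[of _ n r _ n] assoc_mult_mat_vec[of _ r n _ r]
          assoc_mult_mat_vec[of "mat_adjoint J" r n J r "mat_adjoint J *\<^sub>v w"])
    then have orth0: "mat_adjoint J *\<^sub>v u0 = 0\<^sub>v r"
      unfolding u0_def JJ using cJ cA cw
      by (subst mult_minus_distrib_mat_vec[of _ r n]) auto
    define N where "N = (\<Sum>l<n. (cmod (u0 $ l))\<^sup>2)"
    have "N \<noteq> 0"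
    proof
      assume "N = 0"
      then have "u0 $ l = 0" if "l < n" for l
        using that by (auto simp: N_def sum_nonneg_eq_0_iff)
      then have "w $ l = ((J * mat_adjoint J) *\<^sub>v w) $ l" if "l < n" for l
        using that cJ cA cw unfolding u0_def by fastforce
      then have "(J * mat_adjoint J) *\<^sub>v w = w" using cw cJ by (intro eq_vecI) auto
      then show False using neq by simp
    qed
    moreover have "0 \<le> N" unfolding N_def by (simp add: sum_nonneg)
    ultimately have N: "0 < N" by simp
    define u where "u = complex_of_real (1 / sqrt N) \<cdot>\<^sub>v u0"
    have cu: "u \<in> carrier_vec n" and uW: "u \<in> W" using cu0 u0W smult by (auto simp: u_def)
    have orth: "(\<Sum>l<n. cnj (J $$ (l, i)) * u $ l) = 0" if "i < r" for i
    proof -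
      have "(\<Sum>l<n. cnj (J $$ (l, i)) * u0 $ l) = (mat_adjoint J *\<^sub>v u0) $ i"
        using index_mat_vec_sum[OF cA cu0 that] that by (simp add: mat_adjoint_index[OF cJ])
      then have "(\<Sum>l<n. cnj (J $$ (l, i)) * u0 $ l) = 0" using orth0 that by simp
      moreover have "(\<Sum>l<n. cnj (J $$ (l, i)) * u $ l)
          = complex_of_real (1 / sqrt N) * (\<Sum>l<n. cnj (J $$ (l, i)) * u0 $ l)"
        using cu0 by (simp add: u_def sum_distrib_left mult.left_commute)
      ultimately show ?thesis by simp
    qed
    have unit: "(\<Sum>l<n. cnj (u $ l) * u $ l) = 1"
    proof -
      have "(\<Sum>l<n. cnj (u $ l) * u $ l) = of_real (1 / N) * (\<Sum>l<n. of_real ((cmod (u0 $ l))\<^sup>2))"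
        using cu0 N unfolding u_def complex_norm_square
        by (auto simp: sum_distrib_left field_simps simp flip: of_real_mult intro!: sum.cong)
      also have "(\<Sum>l<n. of_real ((cmod (u0 $ l))\<^sup>2)) = complex_of_real N" by (simp add: N_def)
      finally show ?thesis using N by simp
    qed
    define J' where "J' = mat n (Suc r) (\<lambda>(i, j). if j < r then J $$ (i, j) else u $ i)"
    have cJ': "J' \<in> carrier_mat n (Suc r)" by (simp add: J'_def)
    have JJ': "mat_adjoint J' * J' = 1\<^sub>m (Suc r)"
    proof (rule eq_matI)
      fix i j assume "i < dim_row (1\<^sub>m (Suc r) :: complex mat)" "j < dim_col (1\<^sub>m (Suc r) :: complex mat)"
      then have ij: "i < Suc r" "j < Suc r" by auto
      have e: "(mat_adjoint J' * J') $$ (i, j) = (\<Sum>l<n. cnj (J' $$ (l, i)) * J' $$ (l, j))"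
        by (rule adjoint_mult_index[OF cJ' cJ' ij])
      have old: "(\<Sum>l<n. cnj (J $$ (l, i)) * J $$ (l, j)) = (if i = j then 1 else 0)" if "i < r" "j < r"
        using adjoint_mult_index[OF cJ cJ that] JJ that by simp
      have swap: "(\<Sum>l<n. cnj (u $ l) * J $$ (l, j)) = 0" if "j < r"
      proof -
        have "(\<Sum>l<n. cnj (u $ l) * J $$ (l, j)) = cnj (\<Sum>l<n. cnj (J $$ (l, j)) * u $ l)"
          by (simp add: mult.commute)
        then show ?thesis using orth[OF that] by simp
      qed
      show "(mat_adjoint J' * J') $$ (i, j) = 1\<^sub>m (Suc r) $$ (i, j)"
        unfolding e using ij old swap orth[of i] unit by (auto simp: J'_def less_Suc_eq)
    qed (use cJ' mat_adjoint_carrier[OF cJ'] in auto)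
    have "J' *\<^sub>v v \<in> W" if cv: "v \<in> carrier_vec (Suc r)" for v
    proof -
      define v' where "v' = vec r (\<lambda>i. v $ i)"
      have cv': "v' \<in> carrier_vec r" by (simp add: v'_def)
      have "J' *\<^sub>v v = J *\<^sub>v v' + v $ r \<cdot>\<^sub>v u"
      proof (rule eq_vecI)
        fix i assume "i < dim_vec (J *\<^sub>v v' + v $ r \<cdot>\<^sub>v u)"
        then have i: "i < n" using cu by auto
        show "(J' *\<^sub>v v) $ i = (J *\<^sub>v v' + v $ r \<cdot>\<^sub>v u) $ i"
          using i cu cJ cv' index_mat_vec_sum[OF cJ' cv i] index_mat_vec_sum[OF cJ cv' i]
          by (simp add: J'_def v'_def mult.commute)
      qed (use cu cJ' in auto)
      then show ?thesis using add[OF JW[OF cv'] smult[OF uW]] by simp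
    qed
    then have "iso (Suc r) J'" using cJ' JJ' by (simp add: iso_def)
    then show False using max[of "Suc r"] by auto
  qed
  then show ?thesis using that[OF cJ JJ] PW by metis
qed

text \<open>
  Invariance of the range under \<open>C\<close> says \<open>P C P = C P\<close>, and under the adjoint of \<open>C\<close> it says, after
  taking adjoints, \<open>P C P = P C\<close>.
\<close>

lemma orth_proj_commute_if_range_invariant:
  assumes P: "orth_proj n P" and C: "C \<in> carrier_mat n n"
    and inv: "\<And>v. v \<in> carrier_vec n \<Longrightarrow> P *\<^sub>v v = v \<Longrightarrow> P *\<^sub>v (C *\<^sub>v v) = C *\<^sub>v v"
    and inv_adjoint: "\<And>v. v \<in> carrier_vec n \<Longrightarrow> P *\<^sub>v v = v \<Longrightarrow>
      P *\<^sub>v (mat_adjoint C *\<^sub>v v) = mat_adjoint C *\<^sub>v v"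
  shows "C * P = P * C"
proof -
  note c = orth_projD[OF P]
  have PDP: "P * (D * P) = D * P"
    if D: "D \<in> carrier_mat n n"
      and inv: "\<And>v. v \<in> carrier_vec n \<Longrightarrow> P *\<^sub>v v = v \<Longrightarrow> P *\<^sub>v (D *\<^sub>v v) = D *\<^sub>v v" for D
  proof (rule mat_eq_if_mult_vec_eq)
    fix v :: "complex vec" assume v: "v \<in> carrier_vec n"
    then have "P *\<^sub>v (D *\<^sub>v (P *\<^sub>v v)) = D *\<^sub>v (P *\<^sub>v v)"
      using c by (intro inv) (auto simp flip: assoc_mult_mat_vec)
    then show "P * (D * P) *\<^sub>v v = D * P *\<^sub>v v"
      using c(1) D v by (simp add: assoc_mult_mat_vec[of _ n n _ n])
  qed (use c D in auto)
  note cC = mat_adjoint_carrier[OF C]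
  have "mat_adjoint (P * (mat_adjoint C * P)) = mat_adjoint (mat_adjoint C * P)"
    using PDP[OF cC inv_adjoint] by simp
  then have "P * C * P = P * C"
    using c C cC by (simp add: adjoint_mult[of _ n n _ n] adjoint_adjoint[OF C] mult_carrier_mat[of _ n n _ n])
  then show ?thesis using PDP[OF C inv] c(1) C by simp
qed

lemma eigenvalue_exists:
  fixes A :: "complex mat"
  assumes A: "A \<in> carrier_mat n n" and "0 < n"
  obtains e v where "v \<in> carrier_vec n" "v \<noteq> 0\<^sub>v n" "A *\<^sub>v v = e \<cdot>\<^sub>v v"
  using spectrum_non_empty[OF A] assms
  by (auto simp: spectrum_def eigenvalue_def eigenvector_def)

definition scalar_matrix :: "nat \<Rightarrow> complex mat \<Rightarrow> bool" where
  "scalar_matrix n A \<longleftrightarrow> (\<exists>c. A = c \<cdot>\<^sub>m 1\<^sub>m n)"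

text \<open>
  \<open>P\<close> is the projection onto an eigenspace of \<open>A\<close>. A matrix that commutes with the Hermitian matrix \<open>A\<close>
  preserves the eigenspace, and so does its adjoint.
\<close>

lemma hermitian_spectral_projection:
  assumes A: "A \<in> carrier_mat n n" and herm: "mat_adjoint A = A" and ns: "\<not> scalar_matrix n A"
  obtains P where "orth_proj n P" "P \<noteq> 0\<^sub>m n n" "P \<noteq> 1\<^sub>m n"
    "\<And>C. C \<in> carrier_mat n n \<Longrightarrow> C * A = A * C \<Longrightarrow> C * P = P * C"
proof -
  have "0 < n"
  proof (rule ccontr)
    assume "\<not> 0 < n"
    then have "A = 0 \<cdot>\<^sub>m 1\<^sub>m n" using A by (intro eq_matI) auto
    then show False using ns by (auto simp: scalar_matrix_def)
  qed
  then obtain e v0 where v0: "v0 \<in> carrier_vec n" "v0 \<noteq> 0\<^sub>v n" "A *\<^sub>v v0 = e \<cdot>\<^sub>v v0"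
    using eigenvalue_exists[OF A] by blast
  define W where "W = {v \<in> carrier_vec n. A *\<^sub>v v = e \<cdot>\<^sub>v v}"
  have W0: "0\<^sub>v n \<in> W" using A by (auto simp: W_def)
  have W1: "v + w \<in> W" if "v \<in> W" "w \<in> W" for v w
    using that A by (auto simp: W_def mult_add_distrib_mat_vec smult_add_distrib_vec)
  have W2: "c \<cdot>\<^sub>v v \<in> W" if "v \<in> W" for c v
    using that A by (auto simp: W_def mult_mat_vec smult_smult_assoc mult.commute)
  obtain r J where J: "J \<in> carrier_mat n r" "mat_adjoint J * J = 1\<^sub>m r"
    and PW: "\<And>v. v \<in> carrier_vec n \<Longrightarrow> (J * mat_adjoint J) *\<^sub>v v = v \<longleftrightarrow> v \<in> W"
  proof -
    have "W \<subseteq> carrier_vec n" by (auto simp: W_def)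
    from orthonormal_basis_of_subspace[OF this W0 W1 W2] that show thesis by metis
  qed
  define P where "P = J * mat_adjoint J"
  have P: "orth_proj n P" unfolding P_def by (rule orth_proj_of_isometry[OF J])
  note cP = orth_projD(1)[OF P]
  have inv: "P *\<^sub>v (C *\<^sub>v v) = C *\<^sub>v v"
    if C: "C \<in> carrier_mat n n" "C * A = A * C" and v: "v \<in> carrier_vec n" "P *\<^sub>v v = v" for C v
  proof -
    have Av: "A *\<^sub>v v = e \<cdot>\<^sub>v v" using PW v by (auto simp: P_def W_def)
    have "A *\<^sub>v (C *\<^sub>v v) = (C * A) *\<^sub>v v" using A C v by simp
    also have "\<dots> = e \<cdot>\<^sub>v (C *\<^sub>v v)" using A C(1) v(1) Av by (simp add: mult_mat_vec)
    finally have "C *\<^sub>v v \<in> W" using C v by (simp add: W_def)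
    then show ?thesis using PW[of "C *\<^sub>v v"] C v by (simp add: P_def)
  qed
  have "C * P = P * C" if C: "C \<in> carrier_mat n n" "C * A = A * C" for C
  proof (rule orth_proj_commute_if_range_invariant[OF P C(1)])
    have "mat_adjoint C * A = A * mat_adjoint C"
      using arg_cong[OF C(2), of mat_adjoint] A C(1) herm by (simp add: adjoint_mult[of _ n n _ n])
    then show "P *\<^sub>v (mat_adjoint C *\<^sub>v v) = mat_adjoint C *\<^sub>v v"
      if "v \<in> carrier_vec n" "P *\<^sub>v v = v" for v
      using inv that mat_adjoint_carrier[OF C(1)] by blast
  qed (use inv C in blast)
  moreover have "P \<noteq> 0\<^sub>m n n"
    using PW[OF v0(1)] v0 zero_mat_mult_vec[OF v0(1)] by (auto simp: P_def[symmetric] W_def)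
  moreover have "P \<noteq> 1\<^sub>m n"
  proof
    assume "P = 1\<^sub>m n"
    then have Av: "A *\<^sub>v v = e \<cdot>\<^sub>v v" if "v \<in> carrier_vec n" for v
      using PW[OF that] that by (auto simp: P_def[symmetric] W_def)
    have "A = e \<cdot>\<^sub>m 1\<^sub>m n"
    proof (intro mat_eq_if_mult_vec_eq[OF A])
      fix v :: "complex vec" assume v: "v \<in> carrier_vec n"
      then show "A *\<^sub>v v = e \<cdot>\<^sub>m 1\<^sub>m n *\<^sub>v v"
        unfolding Av[OF v] by (intro eq_vecI) auto
    qed auto
    then show False using ns by (auto simp: scalar_matrix_def)
  qed
  ultimately show ?thesis using that P by blast
qed

lemma subspace_of_vectorsI:
  assumes "W \<subseteq> carrier_vec n" "0\<^sub>v n \<in> W" "\<And>v w. v \<in> W \<Longrightarrow> w \<in> W \<Longrightarrow> v + w \<in> W"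
    "\<And>c v. v \<in> W \<Longrightarrow> c \<cdot>\<^sub>v v \<in> W"
  shows "VectorSpace.subspace class_ring W (module_vec TYPE(complex) n)"
proof -
  interpret vec_space "TYPE(complex)" n .
  show ?thesis
    by (rule subspace.intro[OF vec_vs], rule submodule.intro[OF vec_module])
      (use assms in \<open>auto simp: module_vec_simps\<close>)
qed

lemma subspace_of_vectorsD:
  assumes "VectorSpace.subspace class_ring W (module_vec TYPE(complex) n)"
  shows "W \<subseteq> carrier_vec n" "0\<^sub>v n \<in> W" "\<And>v w. v \<in> W \<Longrightarrow> w \<in> W \<Longrightarrow> v + w \<in> W"
    "\<And>c v. v \<in> W \<Longrightarrow> c \<cdot>\<^sub>v v \<in> W"
proof -
  from assms have s: "submodule class_ring W (module_vec TYPE(complex) n)"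
    by (rule subspace.submod)
  from submodule.subset[OF s] submodule.zero_closed[OF s] submodule.m_closed[OF s]
    submodule.smult_closed[OF s]
  show "W \<subseteq> carrier_vec n" "0\<^sub>v n \<in> W" "\<And>v w. v \<in> W \<Longrightarrow> w \<in> W \<Longrightarrow> v + w \<in> W"
    "\<And>c v. v \<in> W \<Longrightarrow> c \<cdot>\<^sub>v v \<in> W"
    by (auto simp: module_vec_simps class_ring_simps)
qed

text \<open>
  The part of Schur's lemma that is needed: the range of \<open>P\<close> is an invariant subspace.
\<close>

lemma irreducible_commuting_projection:
  assumes irr: "irreducible_rep G n \<rho>" and P: "orth_proj n P"
    and \<rho>: "\<And>g. g \<in> carrier G \<Longrightarrow> \<rho> g \<in> carrier_mat n n"
    and comm: "\<And>g. g \<in> carrier G \<Longrightarrow> \<rho> g * P = P * \<rho> g"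
  shows "P = 0\<^sub>m n n \<or> P = 1\<^sub>m n"
proof -
  note c = orth_projD[OF P]
  define W where "W = {v \<in> carrier_vec n. P *\<^sub>v v = v}"
  have "VectorSpace.subspace class_ring W (module_vec TYPE(complex) n)"
    using c(1) by (intro subspace_of_vectorsI)
      (auto simp: W_def mult_add_distrib_mat_vec mult_mat_vec)
  moreover have "\<rho> g *\<^sub>v w \<in> W" if "g \<in> carrier G" "w \<in> W" for g w
  proof -
    have "P *\<^sub>v (\<rho> g *\<^sub>v w) = \<rho> g *\<^sub>v (P *\<^sub>v w)"
      using that c(1) \<rho>[of g] comm[of g]
      by (simp add: W_def assoc_mult_mat_vec[of P n n "\<rho> g" n w, symmetric]
          assoc_mult_mat_vec[of "\<rho> g" n n P n w] del: assoc_mult_mat_vec)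
        (metis assoc_mult_mat_vec)
    then show ?thesis using that \<rho>[of g] mult_mat_vec_carrier[of "\<rho> g" n n w] by (simp add: W_def)
  qed
  ultimately have "W = {0\<^sub>v n} \<or> W = carrier_vec n"
    using irr unfolding irreducible_rep_def by blast
  then show ?thesis
  proof
    assume W0: "W = {0\<^sub>v n}"
    have "P *\<^sub>v v = 0\<^sub>m n n *\<^sub>v v" if v: "v \<in> carrier_vec n" for v
    proof -
      have "P *\<^sub>v (P *\<^sub>v v) = P *\<^sub>v v" using c(1,2) v by (simp flip: assoc_mult_mat_vec)
      then have "P *\<^sub>v v \<in> W" using c(1) v by (simp add: W_def)
      then show ?thesis using W0 v zero_mat_mult_vec[OF v] by simp
    qed
    then show ?thesis using mat_eq_if_mult_vec_eq[OF c(1)] by simp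
  next
    assume W1: "W = carrier_vec n"
    have "P *\<^sub>v v = 1\<^sub>m n *\<^sub>v v" if v: "v \<in> carrier_vec n" for v
      using W1 v by (auto simp: W_def)
    then show ?thesis using mat_eq_if_mult_vec_eq[OF c(1)] by simp
  qed
qed

section \<open>Finite sums of matrices and conjugation\<close>

lemma smult_smult_mat: "a \<cdot>\<^sub>m (b \<cdot>\<^sub>m A) = (a * b) \<cdot>\<^sub>m (A :: complex mat)"
  by (intro eq_matI) auto

text \<open>
  Matrices of varying size have no common zero, so sums over finite sets are taken entrywise in a
  fixed size \<open>n\<close>.
\<close>

definition msum :: "nat \<Rightarrow> ('i \<Rightarrow> complex mat) \<Rightarrow> 'i set \<Rightarrow> complex mat" where
  "msum n f F = mat n n (\<lambda>ij. \<Sum>x\<in>F. f x $$ ij)"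

lemma msum_carrier [simp]: "msum n f F \<in> carrier_mat n n"
  by (simp add: msum_def)

lemma msum_cong: "(\<And>x. x \<in> F \<Longrightarrow> f x = g x) \<Longrightarrow> msum n f F = msum n g F"
  by (auto simp: msum_def intro!: eq_matI)

lemma msum_mult_right:
  assumes f: "\<And>x. x \<in> F \<Longrightarrow> f x \<in> carrier_mat n n" and B: "B \<in> carrier_mat n n"
  shows "msum n f F * B = msum n (\<lambda>x. f x * B) F"
proof (rule eq_matI)
  fix i j assume "i < dim_row (msum n (\<lambda>x. f x * B) F)" "j < dim_col (msum n (\<lambda>x. f x * B) F)"
  then have ij: "i < n" "j < n" by (auto simp: msum_def)
  have "(msum n f F * B) $$ (i, j) = (\<Sum>l<n. (\<Sum>x\<in>F. f x $$ (i, l)) * B $$ (l, j))"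
    unfolding index_mat_mult_sum[OF msum_carrier B ij] using ij by (simp add: msum_def)
  also have "\<dots> = (\<Sum>x\<in>F. \<Sum>l<n. f x $$ (i, l) * B $$ (l, j))"
    by (subst sum.swap) (simp add: sum_distrib_right)
  also have "\<dots> = msum n (\<lambda>x. f x * B) F $$ (i, j)"
    using ij f by (simp add: msum_def index_mat_mult_sum[OF f B ij] del: index_mult_mat)
  finally show "(msum n f F * B) $$ (i, j) = msum n (\<lambda>x. f x * B) F $$ (i, j)" .
qed (use B in \<open>auto simp: msum_def\<close>)

lemma msum_mult_left:
  assumes f: "\<And>x. x \<in> F \<Longrightarrow> f x \<in> carrier_mat n n" and B: "B \<in> carrier_mat n n"
  shows "B * msum n f F = msum n (\<lambda>x. B * f x) F"
proof (rule eq_matI)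
  fix i j assume "i < dim_row (msum n (\<lambda>x. B * f x) F)" "j < dim_col (msum n (\<lambda>x. B * f x) F)"
  then have ij: "i < n" "j < n" by (auto simp: msum_def)
  have "(B * msum n f F) $$ (i, j) = (\<Sum>l<n. B $$ (i, l) * (\<Sum>x\<in>F. f x $$ (l, j)))"
    unfolding index_mat_mult_sum[OF B msum_carrier ij] using ij by (simp add: msum_def)
  also have "\<dots> = (\<Sum>x\<in>F. \<Sum>l<n. B $$ (i, l) * f x $$ (l, j))"
    by (subst sum.swap) (simp add: sum_distrib_left)
  also have "\<dots> = msum n (\<lambda>x. B * f x) F $$ (i, j)"
    using ij f by (simp add: msum_def index_mat_mult_sum[OF B f ij] del: index_mult_mat)
  finally show "(B * msum n f F) $$ (i, j) = msum n (\<lambda>x. B * f x) F $$ (i, j)" .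
qed (use B in \<open>auto simp: msum_def\<close>)

lemma msum_adjoint:
  assumes f: "\<And>x. x \<in> F \<Longrightarrow> f x \<in> carrier_mat n n"
  shows "mat_adjoint (msum n f F) = msum n (\<lambda>x. mat_adjoint (f x)) F"
proof (rule eq_matI)
  fix i j assume "i < dim_row (msum n (\<lambda>x. mat_adjoint (f x)) F)"
    "j < dim_col (msum n (\<lambda>x. mat_adjoint (f x)) F)"
  then have ij: "i < n" "j < n" by (auto simp: msum_def)
  then show "mat_adjoint (msum n f F) $$ (i, j) = msum n (\<lambda>x. mat_adjoint (f x)) F $$ (i, j)"
    unfolding mat_adjoint_index[OF msum_carrier ij] by (simp add: msum_def mat_adjoint_index[OF f])
qed (use mat_adjoint_carrier[OF msum_carrier[of n f F]] in \<open>auto simp: msum_def\<close>)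

lemma msum_mtrace:
  assumes f: "\<And>x. x \<in> F \<Longrightarrow> f x \<in> carrier_mat n n"
  shows "mtrace (msum n f F) = (\<Sum>x\<in>F. mtrace (f x))"
proof -
  have "(\<Sum>i<n. \<Sum>x\<in>F. f x $$ (i, i)) = (\<Sum>x\<in>F. \<Sum>i<n. f x $$ (i, i))" by (rule sum.swap)
  also have "\<dots> = (\<Sum>x\<in>F. mtrace (f x))" using f by (auto simp: mtrace_def intro!: sum.cong)
  finally show ?thesis by (simp add: mtrace_def msum_def)
qed

lemma msum_single:
  assumes "finite F" "x \<in> F" "f x \<in> carrier_mat n n" "\<And>y. y \<in> F \<Longrightarrow> y \<noteq> x \<Longrightarrow> f y = 0\<^sub>m n n"
  shows "msum n f F = f x"
proof (rule eq_matI)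
  fix i j assume "i < dim_row (f x)" "j < dim_col (f x)"
  then have ij: "i < n" "j < n" using assms by auto
  have "(\<Sum>y\<in>F. f y $$ (i, j)) = f x $$ (i, j)"
    using assms ij by (subst sum.remove[of F x]) auto
  then show "msum n f F $$ (i, j) = f x $$ (i, j)" using ij by (simp add: msum_def)
qed (use assms in \<open>auto simp: msum_def\<close>)

text \<open>
  Conjugation by \<open>U\<close>, which is meant to be unitary: the adjoint stands for the inverse.
\<close>

definition uconj :: "complex mat \<Rightarrow> complex mat \<Rightarrow> complex mat" where
  "uconj U A = U * A * mat_adjoint U"

lemma U_groupD:
  assumes "U \<in> carrier (U_group n)"
  shows "U \<in> carrier_mat n n" "mat_adjoint U \<in> carrier_mat n n" "mat_adjoint U * U = 1\<^sub>m n"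
    "U * mat_adjoint U = 1\<^sub>m n" "mat_adjoint U \<in> carrier (U_group n)" "mat_adjoint (mat_adjoint U) = U"
  using assms adjoint_adjoint[of U n n] by (auto simp: U_group_carrier intro: mat_adjoint_carrier)

lemma cancel_middle:
  fixes A :: "complex mat"
  assumes c: "A \<in> carrier_mat n n" "B \<in> carrier_mat n n" "C \<in> carrier_mat n n" "D \<in> carrier_mat n n"
    and BC: "B * C = 1\<^sub>m n"
  shows "(A * B) * (C * D) = A * D"
proof -
  have "(A * B) * (C * D) = A * ((B * C) * D)" using c by (simp add: sq_mat_laws(1)[where n = n])
  then show ?thesis using c BC by simp
qed

lemma uconj_carrier [simp]:
  "U \<in> carrier (U_group n) \<Longrightarrow> A \<in> carrier_mat n n \<Longrightarrow> uconj U A \<in> carrier_mat n n"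
  using U_groupD(1,2)[of U n] by (simp add: uconj_def)

lemma uconj_mult:
  assumes "U \<in> carrier (U_group n)" "A \<in> carrier_mat n n" "B \<in> carrier_mat n n"
  shows "uconj U (A * B) = uconj U A * uconj U B"
proof -
  note u = U_groupD[OF assms(1)]
  have "uconj U A * uconj U B = (U * A * mat_adjoint U) * (U * (B * mat_adjoint U))"
    using u(1,2) assms by (simp add: uconj_def sq_mat_laws(1)[where n = n])
  also have "\<dots> = U * A * (B * mat_adjoint U)"
    by (rule cancel_middle[where n = n]) (use u assms in auto)
  finally show ?thesis using u(1,2) assms by (simp add: uconj_def sq_mat_laws(1)[where n = n])
qed

lemma uconj_inverse:
  assumes "U \<in> carrier (U_group n)" "A \<in> carrier_mat n n"
  shows "uconj U (uconj (mat_adjoint U) A) = A" "uconj (mat_adjoint U) (uconj U A) = A"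
proof -
  have *: "uconj V (uconj (mat_adjoint V) A) = A" if "V \<in> carrier (U_group n)" for V
  proof -
    note u = U_groupD[OF that]
    have "uconj V (uconj (mat_adjoint V) A) = (V * mat_adjoint V) * A * (V * mat_adjoint V)"
      using u(1,2) assms(2) unfolding uconj_def u(6)
      by (simp add: sq_mat_laws(1)[where n = n] mult_carrier_mat[of _ n n _ n])
    then show ?thesis using u(4) assms by simp
  qed
  show "uconj U (uconj (mat_adjoint U) A) = A" by (rule *[OF assms(1)])
  show "uconj (mat_adjoint U) (uconj U A) = A"
    using *[OF U_groupD(5)[OF assms(1)]] U_groupD(6)[OF assms(1)] by simp
qed

lemma uconj_comp:
  assumes "U \<in> carrier (U_group n)" "V \<in> carrier (U_group n)" "A \<in> carrier_mat n n"
  shows "uconj (U * V) A = uconj U (uconj V A)"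
  using U_groupD(1,2)[OF assms(1)] U_groupD(1,2)[OF assms(2)] assms(3)
  by (simp add: uconj_def adjoint_mult[of _ n n _ n] sq_mat_laws(1)[where n = n]
      mult_carrier_mat[of _ n n _ n])

lemma uconj_adjoint:
  assumes "U \<in> carrier (U_group n)" "A \<in> carrier_mat n n"
  shows "mat_adjoint (uconj U A) = uconj U (mat_adjoint A)"
  using U_groupD(1,2,6)[OF assms(1)] assms(2) mat_adjoint_carrier[OF assms(2)]
  by (simp add: uconj_def adjoint_mult[of _ n n _ n] sq_mat_laws(1)[where n = n]
      mult_carrier_mat[of _ n n _ n])

lemma uconj_smult:
  assumes "U \<in> carrier (U_group n)" "A \<in> carrier_mat n n"
  shows "uconj U (c \<cdot>\<^sub>m A) = c \<cdot>\<^sub>m uconj U A"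
  using U_groupD(1,2)[OF assms(1)] assms(2)
  by (simp add: uconj_def mult_smult_distrib[of _ n n _ n] mult_smult_assoc_mat[of _ n n _ n])

lemma uconj_minus:
  assumes "U \<in> carrier (U_group n)" "A \<in> carrier_mat n n" "B \<in> carrier_mat n n"
  shows "uconj U (A - B) = uconj U A - uconj U B"
  using U_groupD(1,2)[OF assms(1)] assms(2,3)
  by (simp add: uconj_def sq_mat_laws(4,5)[where n = n])

lemma uconj_one: "U \<in> carrier (U_group n) \<Longrightarrow> uconj U (1\<^sub>m n) = 1\<^sub>m n"
  using U_groupD[of U n] by (simp add: uconj_def)

lemma uconj_zero: "U \<in> carrier (U_group n) \<Longrightarrow> uconj U (0\<^sub>m n n) = 0\<^sub>m n n"
  using U_groupD[of U n] by (simp add: uconj_def)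

lemma uconj_msum:
  assumes U: "U \<in> carrier (U_group n)" and f: "\<And>x. x \<in> F \<Longrightarrow> f x \<in> carrier_mat n n"
  shows "uconj U (msum n f F) = msum n (\<lambda>x. uconj U (f x)) F"
proof -
  note u = U_groupD[OF U]
  have "U * msum n f F * mat_adjoint U = msum n (\<lambda>x. U * f x) F * mat_adjoint U"
    using msum_mult_left[of F f n U, OF f u(1)] by simp
  also have "\<dots> = msum n (\<lambda>x. U * f x * mat_adjoint U) F"
    using u f by (intro msum_mult_right) auto
  finally show ?thesis by (simp add: uconj_def)
qed

lemma mtrace_uconj:
  assumes U: "U \<in> carrier (U_group n)" and A: "A \<in> carrier_mat n n"
  shows "mtrace (uconj U A) = mtrace A"
proof -
  note u = U_groupD[OF U]
  have "mtrace (uconj U A) = mtrace (mat_adjoint U * (U * A))"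
    unfolding uconj_def by (rule mtrace_comm) (use u A in auto)
  also have "mat_adjoint U * (U * A) = A"
    using u A sq_mat_laws(1)[of "mat_adjoint U" n U A] by simp
  finally show ?thesis .
qed

lemma det_uconj:
  assumes U: "U \<in> carrier (U_group n)" and A: "A \<in> carrier_mat n n"
  shows "det (uconj U A) = det A"
proof -
  note u = U_groupD[OF U]
  have "det (uconj U A) = det U * det A * det (mat_adjoint U)"
    using u A by (simp add: uconj_def det_mult[of _ n])
  moreover have "det U * det (mat_adjoint U) = 1"
    using u(4) det_mult[OF u(1,2)] by simp
  ultimately show ?thesis by simp
qed

lemma commute_if_uconj_fixed:
  assumes U: "U \<in> carrier (U_group n)" and A: "A \<in> carrier_mat n n" and "uconj U A = A"
  shows "U * A = A * U"
proof -
  note u = U_groupD[OF U]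
  have "A * U = U * A * mat_adjoint U * U" using assms(3) by (simp add: uconj_def)
  also have "\<dots> = U * A * (mat_adjoint U * U)"
    by (rule sq_mat_laws(1)) (use u A in auto)
  also have "\<dots> = U * A" using u A by simp
  finally show ?thesis ..
qed

section \<open>Orthogonal families of projections\<close>

definition orth_family :: "nat \<Rightarrow> complex mat set \<Rightarrow> bool" where
  "orth_family n F \<longleftrightarrow> finite F \<and> (\<forall>P\<in>F. orth_proj n P \<and> P \<noteq> 0\<^sub>m n n)
     \<and> (\<forall>P\<in>F. \<forall>Q\<in>F. P \<noteq> Q \<longrightarrow> P * Q = 0\<^sub>m n n)"

definition mcomb :: "nat \<Rightarrow> (complex mat \<Rightarrow> complex) \<Rightarrow> complex mat set \<Rightarrow> complex mat" where
  "mcomb n z F = msum n (\<lambda>P. z P \<cdot>\<^sub>m P) F"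

lemma mcomb_carrier [simp]: "mcomb n z F \<in> carrier_mat n n"
  by (simp add: mcomb_def)

lemma mcomb_cong: "(\<And>P. P \<in> F \<Longrightarrow> z P = w P) \<Longrightarrow> mcomb n z F = mcomb n w F"
  unfolding mcomb_def by (auto intro!: msum_cong)

lemma orth_familyD:
  assumes "orth_family n F"
  shows "finite F" "\<And>P. P \<in> F \<Longrightarrow> orth_proj n P" "\<And>P. P \<in> F \<Longrightarrow> P \<in> carrier_mat n n"
    "\<And>P. P \<in> F \<Longrightarrow> P \<noteq> 0\<^sub>m n n" "\<And>P Q. P \<in> F \<Longrightarrow> Q \<in> F \<Longrightarrow> P \<noteq> Q \<Longrightarrow> P * Q = 0\<^sub>m n n"
  using assms by (auto simp: orth_family_def orth_proj_def)

lemma mcomb_mult_member: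
  assumes F: "orth_family n F" and Q: "Q \<in> F"
  shows "mcomb n z F * Q = z Q \<cdot>\<^sub>m Q"
proof -
  note d = orth_familyD[OF F]
  have "mcomb n z F * Q = msum n (\<lambda>P. (z P \<cdot>\<^sub>m P) * Q) F"
    unfolding mcomb_def by (rule msum_mult_right) (use d Q in auto)
  also have "\<dots> = (z Q \<cdot>\<^sub>m Q) * Q"
  proof (rule msum_single[OF d(1) Q])
    show "z P \<cdot>\<^sub>m P * Q = 0\<^sub>m n n" if "P \<in> F" "P \<noteq> Q" for P
      using mult_smult_assoc_mat[OF d(3)[OF that(1)] d(3)[OF Q]] d(5)[OF that(1) Q that(2)] by simp
  qed (use d(3)[OF Q] mult_carrier_mat[of "z Q \<cdot>\<^sub>m Q" n n Q n] in simp)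
  also have "\<dots> = z Q \<cdot>\<^sub>m Q"
    using d(2,3)[OF Q] by (simp add: mult_smult_assoc_mat[of _ n n] orth_projD(2))
  finally show ?thesis .
qed

text \<open>
  Combinations of an orthogonal family multiply coefficientwise, as diagonal matrices do.
\<close>

lemma mcomb_mult:
  assumes F: "orth_family n F"
  shows "mcomb n z F * mcomb n w F = mcomb n (\<lambda>P. z P * w P) F"
proof -
  note d = orth_familyD[OF F]
  have "mcomb n z F * mcomb n w F = msum n (\<lambda>Q. mcomb n z F * (w Q \<cdot>\<^sub>m Q)) F"
    unfolding mcomb_def[of n w] by (rule msum_mult_left) (use d in auto)
  also have "\<dots> = msum n (\<lambda>Q. (z Q * w Q) \<cdot>\<^sub>m Q) F"
    by (rule msum_cong)
      (simp add: mult_smult_distrib[OF mcomb_carrier d(3)] mcomb_mult_member[OF F] mult.commute smult_smult_mat)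
  finally show ?thesis by (simp add: mcomb_def)
qed

lemma mcomb_adjoint:
  assumes F: "orth_family n F"
  shows "mat_adjoint (mcomb n z F) = mcomb n (\<lambda>P. cnj (z P)) F"
proof -
  note d = orth_familyD[OF F]
  have "mat_adjoint (mcomb n z F) = msum n (\<lambda>P. mat_adjoint (z P \<cdot>\<^sub>m P)) F"
    unfolding mcomb_def by (rule msum_adjoint) (use d in auto)
  also have "\<dots> = mcomb n (\<lambda>P. cnj (z P)) F"
    unfolding mcomb_def by (rule msum_cong) (simp add: adjoint_smult[OF d(3)] orth_projD(3)[OF d(2)])
  finally show ?thesis .
qed

lemma mcomb_mtrace:
  assumes F: "orth_family n F"
  shows "mtrace (mcomb n z F) = (\<Sum>P\<in>F. z P * mtrace P)"
proof -
  note d = orth_familyD[OF F]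
  have "mtrace (mcomb n z F) = (\<Sum>P\<in>F. mtrace (z P \<cdot>\<^sub>m P))"
    unfolding mcomb_def by (rule msum_mtrace) (use d in auto)
  also have "\<dots> = (\<Sum>P\<in>F. z P * mtrace P)"
    by (rule sum.cong) (use mtrace_smult[OF d(3)] in auto)
  finally show ?thesis .
qed

lemma mcomb_commute:
  assumes F: "orth_family n F" and C: "C \<in> carrier_mat n n" and "\<And>P. P \<in> F \<Longrightarrow> C * P = P * C"
  shows "C * mcomb n z F = mcomb n z F * C"
proof -
  note d = orth_familyD[OF F]
  have "C * mcomb n z F = msum n (\<lambda>P. C * (z P \<cdot>\<^sub>m P)) F"
    unfolding mcomb_def by (rule msum_mult_left) (use d C in auto)
  also have "\<dots> = msum n (\<lambda>P. (z P \<cdot>\<^sub>m P) * C) F"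
    by (rule msum_cong) (use d C assms(3) in \<open>auto simp: mult_smult_distrib[of _ n n _ n] mult_smult_assoc_mat[of _ n n _ n]\<close>)
  also have "\<dots> = mcomb n z F * C"
    unfolding mcomb_def by (rule msum_mult_right[symmetric]) (use d C in auto)
  finally show ?thesis .
qed

lemma orth_proj_mcomb_one:
  assumes F: "orth_family n F"
  shows "orth_proj n (mcomb n (\<lambda>_. 1) F)"
  by (simp add: orth_proj_def mcomb_mult[OF F] mcomb_adjoint[OF F])

text \<open>
  The sum of the family is a projection, whose trace is at most \<open>n\<close>, while each member contributes at least \<open>1\<close> to it.
\<close>

lemma orth_family_card_le:
  assumes F: "orth_family n F"
  shows "card F \<le> n"
proof -
  note d = orth_familyD[OF F]
  let ?E = "mcomb n (\<lambda>_. 1) F"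
  have "of_real ((frob ?E)\<^sup>2) = (\<Sum>P\<in>F. mtrace P)"
    unfolding orth_proj_mtrace[OF orth_proj_mcomb_one[OF F], symmetric] mcomb_mtrace[OF F] by simp
  also have "\<dots> = of_real (\<Sum>P\<in>F. (frob P)\<^sup>2)"
    unfolding of_real_sum by (rule sum.cong) (simp_all add: orth_proj_mtrace[OF d(2)])
  finally have frob_E: "(frob ?E)\<^sup>2 = (\<Sum>P\<in>F. (frob P)\<^sup>2)" by (simp only: of_real_eq_iff)
  have "(\<Sum>P\<in>F. 1) \<le> (\<Sum>P\<in>F. (frob P)\<^sup>2)"
    using d orth_proj_frob_ge_1 by (intro sum_mono) blast
  then have "real (card F) \<le> (frob ?E)\<^sup>2" by (simp add: frob_E)
  also have "(frob ?E)\<^sup>2 \<le> n" by (rule orth_proj_frob_le[OF orth_proj_mcomb_one[OF F]])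
  finally show ?thesis by simp
qed

section \<open>Commuting families of matrices and the projections they determine\<close>

locale commuting_matrices =
  fixes n :: nat and S :: "complex mat set"
  assumes S_carrier: "S \<subseteq> carrier_mat n n"
    and S_adjoint: "A \<in> S \<Longrightarrow> mat_adjoint A \<in> S"
    and S_commute: "A \<in> S \<Longrightarrow> B \<in> S \<Longrightarrow> A * B = B * A"
    and S_nonscalar: "\<exists>A\<in>S. \<not> scalar_matrix n A"
begin

definition commutant :: "complex mat set" where
  "commutant = {C \<in> carrier_mat n n. \<forall>A\<in>S. C * A = A * C}"

definition projections :: "complex mat set" where
  "projections = {P. orth_proj n P \<and> P \<noteq> 0\<^sub>m n n \<and> (\<forall>C\<in>commutant. C * P = P * C)}"

text \<open>
  \<open>P * Q = Q\<close> says that the range of \<open>Q\<close> lies in that of \<open>P\<close>, so these are the minimal projections.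
\<close>

definition atoms :: "complex mat set" where
  "atoms = {P \<in> projections. \<forall>Q\<in>projections. P * Q = Q \<longrightarrow> Q = P}"

lemma S_carrierD: "A \<in> S \<Longrightarrow> A \<in> carrier_mat n n"
  using S_carrier by auto

lemma commutantD:
  assumes "C \<in> commutant"
  shows "C \<in> carrier_mat n n" "\<And>A. A \<in> S \<Longrightarrow> C * A = A * C"
  using assms by (auto simp: commutant_def)

text \<open>
  If both the Hermitian and the skew-Hermitian part of a matrix are scalar, then so is the matrix.
\<close>

lemma bicommutant_hermitian:
  obtains H where "H \<in> carrier_mat n n" "mat_adjoint H = H" "\<not> scalar_matrix n H"
    "\<And>C. C \<in> commutant \<Longrightarrow> C * H = H * C"
proof -
  obtain A where A: "A \<in> S" "\<not> scalar_matrix n A" using S_nonscalar by blast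
  note cA = S_carrierD[OF A(1)] and cB = S_carrierD[OF S_adjoint[OF A(1)]]
  define H1 where "H1 = A + mat_adjoint A"
  define H2 where "H2 = \<i> \<cdot>\<^sub>m (A - mat_adjoint A)"
  have c: "H1 \<in> carrier_mat n n" "H2 \<in> carrier_mat n n"
    using cA cB minus_carrier_mat[OF cB, of A] by (auto simp: H1_def H2_def)
  have "mat_adjoint H1 = mat_adjoint A + A"
    unfolding H1_def adjoint_add[OF cA cB] adjoint_adjoint[OF cA] ..
  also have "\<dots> = H1" unfolding H1_def using cA cB by (rule comm_add_mat[rotated])
  finally have adj1: "mat_adjoint H1 = H1" .
  have "mat_adjoint H2 = (- \<i>) \<cdot>\<^sub>m (mat_adjoint A - A)"
    unfolding H2_def adjoint_smult[OF minus_carrier_mat[OF cB, of A]] adjoint_minus[OF cA cB]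
      adjoint_adjoint[OF cA] by simp
  also have "\<dots> = H2" unfolding H2_def using cA cB by (intro eq_matI) (auto simp: algebra_simps)
  finally have adj2: "mat_adjoint H2 = H2" .
  have comm: "C * H1 = H1 * C" "C * H2 = H2 * C" if C: "C \<in> commutant" for C
    using commutantD[OF C] A(1) S_adjoint[OF A(1)] cA cB minus_carrier_mat[OF cB, of A]
    by (simp_all add: H1_def H2_def sq_mat_laws(2-5)[where n = n]
        mult_smult_distrib[of C n n "A - mat_adjoint A" n] mult_smult_assoc_mat[of "A - mat_adjoint A" n n C n])
  have "\<not> (scalar_matrix n H1 \<and> scalar_matrix n H2)"
  proof
    assume "scalar_matrix n H1 \<and> scalar_matrix n H2"
    then obtain a b where ab: "H1 = a \<cdot>\<^sub>m 1\<^sub>m n" "H2 = b \<cdot>\<^sub>m 1\<^sub>m n" by (auto simp: scalar_matrix_def)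
    have "A = ((a - \<i> * b) / 2) \<cdot>\<^sub>m 1\<^sub>m n"
    proof (rule eq_matI)
      fix i j assume "i < dim_row (((a - \<i> * b) / 2) \<cdot>\<^sub>m 1\<^sub>m n)" "j < dim_col (((a - \<i> * b) / 2) \<cdot>\<^sub>m 1\<^sub>m n)"
      then have ij: "i < n" "j < n" by auto
      have "A $$ (i, j) = (H1 $$ (i, j) - \<i> * H2 $$ (i, j)) / 2"
        using ij cA cB by (simp add: H1_def H2_def algebra_simps)
      then show "A $$ (i, j) = (((a - \<i> * b) / 2) \<cdot>\<^sub>m 1\<^sub>m n) $$ (i, j)"
        using ij unfolding ab by auto
    qed (use cA in auto)
    then show False using A(2) by (auto simp: scalar_matrix_def)
  qed
  then show ?thesis using that c adj1 adj2 comm by blast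
qed

lemma projection_exists: "\<exists>P\<in>projections. P \<noteq> 1\<^sub>m n"
proof -
  obtain H where H: "H \<in> carrier_mat n n" "mat_adjoint H = H" "\<not> scalar_matrix n H"
    "\<And>C. C \<in> commutant \<Longrightarrow> C * H = H * C"
    using bicommutant_hermitian by blast
  from hermitian_spectral_projection[OF H(1-3)] obtain P where
    "orth_proj n P" "P \<noteq> 0\<^sub>m n n" "P \<noteq> 1\<^sub>m n"
    "\<And>C. C \<in> carrier_mat n n \<Longrightarrow> C * H = H * C \<Longrightarrow> C * P = P * C" by blast
  then show ?thesis using H(4) commutantD(1) by (auto simp: projections_def)
qed

lemma S_subset_commutant: "S \<subseteq> commutant"
  using S_carrierD S_commute by (auto simp: commutant_def)

lemma projectionsD:
  assumes "P \<in> projections"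
  shows "orth_proj n P" "P \<noteq> 0\<^sub>m n n" "\<And>C. C \<in> commutant \<Longrightarrow> C * P = P * C"
    "P \<in> carrier_mat n n" "P * P = P" "P \<in> commutant"
proof -
  show "orth_proj n P" "P \<noteq> 0\<^sub>m n n" and c: "\<And>C. C \<in> commutant \<Longrightarrow> C * P = P * C"
    using assms by (auto simp: projections_def)
  then show P: "P \<in> carrier_mat n n" "P * P = P" by (auto simp: orth_proj_def)
  have "P * A = A * P" if "A \<in> S" for A
    using c[of A] S_subset_commutant that by auto
  then show "P \<in> commutant" using P(1) by (simp add: commutant_def)
qed

lemma projections_mult:
  assumes P: "P \<in> projections" and Q: "Q \<in> projections" and "P * Q \<noteq> 0\<^sub>m n n"
  shows "P * Q \<in> projections"
proof -
  note p = projectionsD[OF P] and q = projectionsD[OF Q]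
  have "C * (P * Q) = P * Q * C" if C: "C \<in> commutant" for C
  proof -
    note cC = commutantD(1)[OF C]
    have "C * (P * Q) = (C * P) * Q" using cC p(4) q(4) by (simp add: sq_mat_laws(1)[where n = n])
    also have "\<dots> = P * (C * Q)" unfolding p(3)[OF C] using cC p(4) q(4)
      by (simp add: sq_mat_laws(1)[where n = n])
    also have "\<dots> = P * Q * C" unfolding q(3)[OF C] using cC p(4) q(4)
      by (simp add: sq_mat_laws(1)[where n = n])
    finally show ?thesis .
  qed
  then show ?thesis
    using orth_proj_mult[OF p(1) q(1) q(3)[OF p(6)]] assms(3) by (simp add: projections_def)
qed

lemma projections_minus:
  assumes P: "orth_proj n P" "\<And>C. C \<in> commutant \<Longrightarrow> C * P = P * C"
    and Q: "orth_proj n Q" "\<And>C. C \<in> commutant \<Longrightarrow> C * Q = Q * C"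
    and PQ: "P * Q = Q" "Q * P = Q" "P \<noteq> Q"
  shows "P - Q \<in> projections"
proof -
  have cP: "P \<in> carrier_mat n n" and cQ: "Q \<in> carrier_mat n n" using P Q by (auto simp: orth_proj_def)
  have "P - Q \<noteq> 0\<^sub>m n n"
    using eq_if_minus_eq_zero[OF cP cQ] PQ(3) by blast
  moreover have "C * (P - Q) = (P - Q) * C" if C: "C \<in> commutant" for C
    using sq_mat_laws(4)[OF commutantD(1)[OF C] cP cQ] sq_mat_laws(5)[OF cP cQ commutantD(1)[OF C]]
      P(2)[OF C] Q(2)[OF C] by simp
  ultimately show ?thesis using orth_proj_minus[OF P(1) Q(1) PQ(1,2)] by (simp add: projections_def)
qed

lemma atoms_orthogonal:
  assumes P: "P \<in> atoms" and Q: "Q \<in> atoms" and "P \<noteq> Q"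
  shows "P * Q = 0\<^sub>m n n"
proof (rule ccontr)
  assume neq: "P * Q \<noteq> 0\<^sub>m n n"
  have P': "P \<in> projections" and Q': "Q \<in> projections" using P Q by (auto simp: atoms_def)
  note p = projectionsD[OF P'] and q = projectionsD[OF Q']
  have PQ: "P * Q \<in> projections" by (rule projections_mult[OF P' Q' neq])
  have "P * (P * Q) = P * Q" using p(4,5) q(4) sq_mat_laws(1)[of P n P Q] by simp
  then have "P * Q = P" using P PQ by (auto simp: atoms_def)
  moreover have "P * Q = Q * P" by (rule q(3)[OF p(6)])
  moreover have "Q * (Q * P) = Q * P" using q(4,5) p(4) sq_mat_laws(1)[of Q n Q P] by simp
  then have "Q * P = Q" using Q PQ calculation(2) by (auto simp: atoms_def)
  ultimately show False using \<open>P \<noteq> Q\<close> by simp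
qed

lemma frob_projections_minus:
  assumes Q: "Q \<in> projections" and R: "R \<in> projections" and "Q * R = R" "Q \<noteq> R"
  shows "(frob R)\<^sup>2 + 1 \<le> (frob Q)\<^sup>2"
proof -
  note q = projectionsD[OF Q] and r = projectionsD[OF R]
  have D: "Q - R \<in> projections"
    by (rule projections_minus[OF q(1,3) r(1,3) assms(3) _ assms(4)]) (simp_all add: q(3)[OF r(6)] assms(3))
  note d = projectionsD[OF D]
  show ?thesis
    using frob_square_orth_proj_minus[OF q(1) r(1) d(1)] orth_proj_frob_ge_1[OF d(1,2)] by simp
qed

text \<open>
  Take a projection below \<open>P\<close> whose trace, rounded down, is least: a strictly smaller one would have a
  trace that is smaller by at least \<open>1\<close>.
\<close>

lemma atom_below:
  assumes P: "P \<in> projections"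
  shows "\<exists>Q\<in>atoms. P * Q = Q"
proof -
  let ?below = "\<lambda>Q. Q \<in> projections \<and> P * Q = Q"
  let ?m = "\<lambda>Q. nat \<lfloor>(frob Q)\<^sup>2\<rfloor>"
  have "?below P" using P projectionsD(5)[OF P] by simp
  from ex_has_least_nat[of ?below, OF this, of ?m]
  obtain Q where Q: "?below Q" and min': "\<forall>R. ?below R \<longrightarrow> ?m Q \<le> ?m R" by blast
  have min: "?m Q \<le> ?m R" if "?below R" for R using min' that by simp
  note p = projectionsD[OF P] and q = projectionsD[OF conjunct1[OF Q]]
  have "R = Q" if R: "R \<in> projections" "Q * R = R" for R
  proof (rule ccontr)
    assume "R \<noteq> Q"
    then have *: "(frob R)\<^sup>2 + 1 \<le> (frob Q)\<^sup>2" using frob_projections_minus[of Q R] Q R by auto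
    have "P * R = (P * Q) * R"
      using sq_mat_laws(1)[OF p(4) q(4) projectionsD(4)[OF R(1)]] R(2) by simp
    then have "?below R" using Q R by simp
    then have "?m Q \<le> ?m R" by (rule min)
    moreover have "0 \<le> \<lfloor>(frob R)\<^sup>2\<rfloor>" by simp
    moreover have "\<lfloor>(frob R)\<^sup>2\<rfloor> + 1 \<le> \<lfloor>(frob Q)\<^sup>2\<rfloor>"
      using floor_mono[OF *] by (simp add: floor_add_int[symmetric])
    ultimately show False by linarith
  qed
  then have "Q \<in> atoms" using Q by (auto simp: atoms_def)
  then show ?thesis using Q by blast
qed

lemma orth_family_atoms_subset:
  assumes "F \<subseteq> atoms" "finite F"
  shows "orth_family n F"
  unfolding orth_family_def
proof (intro conjI ballI impI)
  fix P Q assume "P \<in> F"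
  then have "P \<in> projections" using assms by (auto simp: atoms_def)
  then show "orth_proj n P" "P \<noteq> 0\<^sub>m n n" using projectionsD by auto
  assume "Q \<in> F" "P \<noteq> Q"
  then show "P * Q = 0\<^sub>m n n" using \<open>P \<in> F\<close> assms atoms_orthogonal by blast
qed (rule assms)

lemma finite_atoms: "finite atoms"
proof (rule ccontr)
  assume "infinite atoms"
  then obtain F where "F \<subseteq> atoms" "finite F" "card F = Suc n"
    using infinite_arbitrarily_large by blast
  then show False using orth_family_card_le[OF orth_family_atoms_subset, of F] by simp
qed

lemma orth_family_atoms: "orth_family n atoms"
  using orth_family_atoms_subset finite_atoms by simp

text \<open>
  The complement of the sum would otherwise lie above an atom, and this atom would be annihilated by
  the complement.
\<close>

lemma atoms_sum: "mcomb n (\<lambda>_. 1) atoms = 1\<^sub>m n"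
proof (rule ccontr)
  let ?E = "mcomb n (\<lambda>_. 1) atoms"
  assume neq: "?E \<noteq> 1\<^sub>m n"
  have one: "C * 1\<^sub>m n = 1\<^sub>m n * C" if "C \<in> commutant" for C
    using commutantD(1)[OF that] by simp
  have commE: "C * ?E = ?E * C" if C: "C \<in> commutant" for C
    by (rule mcomb_commute[OF orth_family_atoms commutantD(1)[OF C]])
      (use projectionsD(3) C in \<open>auto simp: atoms_def\<close>)
  have D: "1\<^sub>m n - ?E \<in> projections"
    using projections_minus[OF orth_proj_one one orth_proj_mcomb_one[OF orth_family_atoms] commE] neq
      left_mult_one_mat[OF mcomb_carrier] right_mult_one_mat[OF mcomb_carrier] by metis
  then obtain Q where Q: "Q \<in> atoms" "(1\<^sub>m n - ?E) * Q = Q" using atom_below by blast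
  have Q': "Q \<in> projections" using Q by (simp add: atoms_def)
  note q = projectionsD[OF Q']
  have "?E * Q = Q" using mcomb_mult_member[OF orth_family_atoms Q(1)] by (auto intro!: eq_matI)
  then have "(1\<^sub>m n - ?E) * Q = Q - Q"
    using sq_mat_laws(5)[of "1\<^sub>m n" n ?E Q] q(4) by simp
  then have "Q = 0\<^sub>m n n" using Q(2) q(4) by simp
  then show False using q(2) by simp
qed

text \<open>
  This is where \<open>S\<close> contains a non-scalar matrix: a spectral projection of its Hermitian or
  skew-Hermitian part lies strictly between \<open>0\<close> and \<open>1\<close>.
\<close>

lemma one_not_atom: "1\<^sub>m n \<notin> atoms"
proof
  assume one: "1\<^sub>m n \<in> atoms"
  obtain P where P: "P \<in> projections" "P \<noteq> 1\<^sub>m n" using projection_exists by blast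
  have "1\<^sub>m n * P = P" using projectionsD(4)[OF P(1)] by simp
  then show False using one P by (auto simp: atoms_def)
qed

lemma commutant_uconj:
  assumes U: "U \<in> carrier (U_group n)"
    and inv_adj: "\<And>A. A \<in> S \<Longrightarrow> uconj (mat_adjoint U) A \<in> S"
    and C: "C \<in> commutant"
  shows "uconj U C \<in> commutant"
proof -
  have cC: "C \<in> carrier_mat n n" by (rule commutantD(1)[OF C])
  have "uconj U C * A = A * uconj U C" if A: "A \<in> S" for A
  proof -
    define B where "B = uconj (mat_adjoint U) A"
    have B: "B \<in> S" "uconj U B = A"
      using inv_adj[OF A] uconj_inverse(1)[OF U S_carrierD[OF A]] by (auto simp: B_def)
    have "uconj U C * uconj U B = uconj U B * uconj U C"
      using uconj_mult[OF U cC S_carrierD[OF B(1)]] uconj_mult[OF U S_carrierD[OF B(1)] cC]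
        commutantD(2)[OF C B(1)] by simp
    then show ?thesis by (simp add: B(2))
  qed
  then show ?thesis using cC U by (simp add: commutant_def)
qed

lemma bicommutant_uconj:
  assumes U: "U \<in> carrier (U_group n)"
    and inv: "\<And>A. A \<in> S \<Longrightarrow> uconj U A \<in> S"
    and X: "X \<in> carrier_mat n n" "\<And>C. C \<in> commutant \<Longrightarrow> C * X = X * C"
    and C: "C \<in> commutant"
  shows "C * uconj U X = uconj U X * C"
proof -
  define D where "D = uconj (mat_adjoint U) C"
  have inv': "uconj (mat_adjoint (mat_adjoint U)) A \<in> S" if "A \<in> S" for A
    using inv[OF that] U_groupD(6)[OF U] by simp
  have D: "D \<in> commutant" "uconj U D = C"
    using commutant_uconj[OF U_groupD(5)[OF U] inv' C]
      uconj_inverse(1)[OF U commutantD(1)[OF C]] by (auto simp: D_def)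
  show ?thesis
    using uconj_mult[OF U commutantD(1)[OF D(1)] X(1)] uconj_mult[OF U X(1) commutantD(1)[OF D(1)]]
      X(2)[OF D(1)] by (simp add: D(2))
qed

lemma projections_uconj:
  assumes U: "U \<in> carrier (U_group n)"
    and inv: "\<And>A. A \<in> S \<Longrightarrow> uconj U A \<in> S"
    and P: "P \<in> projections"
  shows "uconj U P \<in> projections"
proof -
  note p = projectionsD[OF P]
  have "uconj U P \<noteq> 0\<^sub>m n n"
    using uconj_inverse(2)[OF U p(4)] uconj_zero[OF U_groupD(5)[OF U]] p(2) by metis
  moreover have "orth_proj n (uconj U P)" unfolding uconj_def by (rule orth_proj_conj[OF p(1) U])
  ultimately show ?thesis
    using bicommutant_uconj[OF U inv p(4,3)] by (simp add: projections_def)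
qed

lemma atoms_uconj:
  assumes U: "U \<in> carrier (U_group n)"
    and inv: "\<And>A. A \<in> S \<Longrightarrow> uconj U A \<in> S"
    and inv_adj: "\<And>A. A \<in> S \<Longrightarrow> uconj (mat_adjoint U) A \<in> S"
    and P: "P \<in> atoms"
  shows "uconj U P \<in> atoms"
proof -
  have P': "P \<in> projections" using P by (simp add: atoms_def)
  note p = projectionsD[OF P'] and u = U_groupD[OF U]
  have "Q = uconj U P" if Q: "Q \<in> projections" "uconj U P * Q = Q" for Q
  proof -
    define R where "R = uconj (mat_adjoint U) Q"
    note q = projectionsD[OF Q(1)]
    have R: "R \<in> projections" unfolding R_def
      by (rule projections_uconj[OF u(5) inv_adj Q(1)])
    have "P * R = R"
      using arg_cong[OF Q(2), of "uconj (mat_adjoint U)"] uconj_inverse(2)[OF U p(4)]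
        uconj_mult[OF u(5) uconj_carrier[OF U p(4)] q(4)] by (simp add: R_def)
    then have "R = P" using P R by (auto simp: atoms_def)
    then show ?thesis using uconj_inverse(1)[OF U q(4)] by (simp add: R_def)
  qed
  then show ?thesis using projections_uconj[OF U inv P'] by (auto simp: atoms_def)
qed

end

section \<open>Abelian Lie subalgebras of \<open>su(n)\<close>\<close>

lemma SU_group_simps [simp]: "(\<otimes>\<^bsub>SU_group n\<^esub>) = (*)" "\<one>\<^bsub>SU_group n\<^esub> = 1\<^sub>m n"
  by (simp_all add: SU_group_def)

lemma SU_group_carrier: "A \<in> carrier (SU_group n) \<longleftrightarrow> A \<in> carrier (U_group n) \<and> det A = 1"
  by (simp add: SU_group_def)

lemma SU_group_inv:
  assumes "A \<in> carrier (SU_group n)"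
  shows "inv\<^bsub>SU_group n\<^esub> A = mat_adjoint A"
proof -
  have A: "A \<in> carrier (U_group n)" "det A = 1" using assms by (auto simp: SU_group_carrier)
  note u = U_groupD[OF A(1)]
  have "det A * det (mat_adjoint A) = 1" using u(4) det_mult[OF u(1,2)] by simp
  then have "mat_adjoint A \<in> carrier (SU_group n)" using A u by (simp add: SU_group_carrier)
  then show ?thesis
    using assms u by (intro group.inv_equality[OF SU_group_group]) auto
qed

text \<open>
  The bicommutant of a commuting set is commutative, since it lies in the commutant. It contains a
  non-scalar Hermitian matrix \<open>H\<close>, and \<open>H\<close> with its trace removed, multiplied by \<open>\<i>\<close>, is a non-zero element
  of \<open>su(n)\<close>.
\<close>

lemma (in commuting_matrices) abelian_Lie_subalgebra:
  defines "\<hh> \<equiv> {X \<in> su_algebra n. \<forall>C\<in>commutant. C * X = X * C}"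
  shows "su_Lie_subalgebra n \<hh>" "abelian_Lie n \<hh>" "\<hh> \<noteq> {0\<^sub>m n n}"
proof -
  have su: "X \<in> su_algebra n \<longleftrightarrow> X \<in> carrier_mat n n \<and> mat_adjoint X = - X \<and> mtrace X = 0" for X
    by (auto simp: su_algebra_def mtrace_def)
  have sub: "\<hh> \<subseteq> su_algebra n" by (auto simp: \<hh>_def)
  have hD: "X \<in> carrier_mat n n" "mat_adjoint X = - X" "mtrace X = 0"
    "\<And>C. C \<in> commutant \<Longrightarrow> C * X = X * C" if "X \<in> \<hh>" for X
    using that by (auto simp: \<hh>_def su)
  have hI: "X \<in> \<hh>" if "X \<in> carrier_mat n n" "mat_adjoint X = - X" "mtrace X = 0"
    "\<And>C. C \<in> commutant \<Longrightarrow> C * X = X * C" for X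
    using that by (auto simp: \<hh>_def su)
  have in_commutant: "X \<in> commutant" if X: "X \<in> \<hh>" for X
  proof -
    have "X * A = A * X" if "A \<in> S" for A
      using hD(4)[OF X, of A] S_subset_commutant that by auto
    then show ?thesis using hD(1)[OF X] by (simp add: commutant_def)
  qed
  have comm: "X * Y - Y * X = 0\<^sub>m n n" if "X \<in> \<hh>" "Y \<in> \<hh>" for X Y
    using hD(4)[OF that(2) in_commutant[OF that(1)]] hD(1)[OF that(1)] hD(1)[OF that(2)] by simp
  then show "abelian_Lie n \<hh>" by (simp add: abelian_Lie_def)
  have "C * 0\<^sub>m n n = 0\<^sub>m n n * C" if "C \<in> commutant" for C
    using commutantD(1)[OF that] by simp
  then have zero: "0\<^sub>m n n \<in> \<hh>"
    by (intro hI) (auto simp: adjoint_zero mtrace_def)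
  moreover have "X + Y \<in> \<hh>" if X: "X \<in> \<hh>" and Y: "Y \<in> \<hh>" for X Y
  proof (rule hI)
    note x = hD[OF X] and y = hD[OF Y]
    show "X + Y \<in> carrier_mat n n" "mtrace (X + Y) = 0" using x(1,3) y(1,3) mtrace_add[OF x(1) y(1)] by auto
    show "mat_adjoint (X + Y) = - (X + Y)"
      unfolding adjoint_add[OF x(1) y(1)] x(2) y(2) using x(1) y(1) by (intro eq_matI) auto
    show "C * (X + Y) = (X + Y) * C" if C: "C \<in> commutant" for C
      using sq_mat_laws(2)[OF commutantD(1)[OF C] x(1) y(1)]
        sq_mat_laws(3)[OF x(1) y(1) commutantD(1)[OF C]] x(4)[OF C] y(4)[OF C] by simp
  qed
  moreover have "complex_of_real r \<cdot>\<^sub>m X \<in> \<hh>" if X: "X \<in> \<hh>" for r X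
  proof (rule hI)
    note x = hD[OF X]
    show "complex_of_real r \<cdot>\<^sub>m X \<in> carrier_mat n n" "mtrace (complex_of_real r \<cdot>\<^sub>m X) = 0"
      using x(1,3) mtrace_smult[OF x(1)] by auto
    show "mat_adjoint (complex_of_real r \<cdot>\<^sub>m X) = - (complex_of_real r \<cdot>\<^sub>m X)"
      unfolding adjoint_smult[OF x(1)] x(2) using x(1) by (intro eq_matI) auto
    show "C * (complex_of_real r \<cdot>\<^sub>m X) = complex_of_real r \<cdot>\<^sub>m X * C" if C: "C \<in> commutant" for C
      using mult_smult_distrib[OF commutantD(1)[OF C] x(1)] mult_smult_assoc_mat[OF x(1) commutantD(1)[OF C]]
        x(4)[OF C] by simp
  qed
  moreover have "X * Y - Y * X \<in> \<hh>" if "X \<in> \<hh>" "Y \<in> \<hh>" for X Y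
    unfolding comm[OF that] by (rule zero)
  ultimately show "su_Lie_subalgebra n \<hh>"
    using sub by (simp add: su_Lie_subalgebra_def)
  obtain H where H: "H \<in> carrier_mat n n" "mat_adjoint H = H" "\<not> scalar_matrix n H"
    "\<And>C. C \<in> commutant \<Longrightarrow> C * H = H * C"
    using bicommutant_hermitian by blast
  define t where "t = mtrace H / of_nat n"
  have t: "cnj t = t" using mtrace_adjoint[OF H(1)] H(2) by (simp add: t_def)
  define K where "K = H - t \<cdot>\<^sub>m 1\<^sub>m n"
  have cK: "K \<in> carrier_mat n n" by (simp add: K_def minus_carrier_mat)
  have trK: "mtrace K = 0"
  proof (cases "n = 0")
    case True then show ?thesis using cK by (simp add: mtrace_def)
  next
    case False
    then show ?thesis using mtrace_minus[of H n "t \<cdot>\<^sub>m 1\<^sub>m n"] H(1) mtrace_smult[of "1\<^sub>m n" n t]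
      by (simp add: K_def t_def mtrace_one)
  qed
  have adjK: "mat_adjoint K = K"
    unfolding K_def using adjoint_minus[OF H(1), of "t \<cdot>\<^sub>m 1\<^sub>m n"] t H(2)
    by (simp add: mat_adjoint_smult_one)
  have "\<i> \<cdot>\<^sub>m K \<in> \<hh>"
  proof (rule hI)
    show "\<i> \<cdot>\<^sub>m K \<in> carrier_mat n n" "mtrace (\<i> \<cdot>\<^sub>m K) = 0"
      using cK trK mtrace_smult[OF cK] by auto
    show "mat_adjoint (\<i> \<cdot>\<^sub>m K) = - (\<i> \<cdot>\<^sub>m K)"
      unfolding adjoint_smult[OF cK] adjK using cK by (intro eq_matI) auto
    show "C * (\<i> \<cdot>\<^sub>m K) = \<i> \<cdot>\<^sub>m K * C" if C: "C \<in> commutant" for C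
    proof -
      have cC: "C \<in> carrier_mat n n" by (rule commutantD(1)[OF C])
      have "C * K = K * C"
        unfolding K_def using sq_mat_laws(4)[OF cC H(1), of "t \<cdot>\<^sub>m 1\<^sub>m n"]
          sq_mat_laws(5)[OF H(1) _ cC, of "t \<cdot>\<^sub>m 1\<^sub>m n"] H(4)[OF C] scalar_commute[OF cC]
        by simp
      then show ?thesis using mult_smult_distrib[OF cC cK] mult_smult_assoc_mat[OF cK cC] by simp
    qed
  qed
  moreover have "\<i> \<cdot>\<^sub>m K \<noteq> 0\<^sub>m n n"
  proof
    assume *: "\<i> \<cdot>\<^sub>m K = 0\<^sub>m n n"
    have "K = (- \<i>) \<cdot>\<^sub>m (\<i> \<cdot>\<^sub>m K)" by (intro eq_matI) auto
    then have "K = 0\<^sub>m n n" unfolding * by simp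
    then have "H = t \<cdot>\<^sub>m 1\<^sub>m n"
      using eq_if_minus_eq_zero[OF H(1), of "t \<cdot>\<^sub>m 1\<^sub>m n"] by (simp add: K_def)
    then show False using H(3) by (auto simp: scalar_matrix_def)
  qed
  ultimately show "\<hh> \<noteq> {0\<^sub>m n n}" by blast
qed

lemma commuting_matrices_of_abelian_Lie:
  assumes su: "su_Lie_subalgebra n \<hh>" and ab: "abelian_Lie n \<hh>" and nz: "\<hh> \<noteq> {0\<^sub>m n n}"
  shows "commuting_matrices n \<hh>"
proof
  have sub: "\<hh> \<subseteq> su_algebra n" and zero: "0\<^sub>m n n \<in> \<hh>"
    and smult: "\<And>r X. X \<in> \<hh> \<Longrightarrow> complex_of_real r \<cdot>\<^sub>m X \<in> \<hh>"
    using su by (auto simp: su_Lie_subalgebra_def)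
  have hD: "X \<in> carrier_mat n n" "mat_adjoint X = - X" "mtrace X = 0" if "X \<in> \<hh>" for X
    using that sub by (auto simp: su_algebra_def mtrace_def)
  then show "\<hh> \<subseteq> carrier_mat n n" by auto
  show "mat_adjoint X \<in> \<hh>" if X: "X \<in> \<hh>" for X
  proof -
    have "- X = complex_of_real (- 1) \<cdot>\<^sub>m X" by (intro eq_matI) auto
    then show ?thesis using smult[OF X, of "-1"] hD(2)[OF X] by simp
  qed
  show "X * Y = Y * X" if X: "X \<in> \<hh>" and Y: "Y \<in> \<hh>" for X Y
    using eq_if_minus_eq_zero[of "X * Y" n n "Y * X"] hD(1)[OF X] hD(1)[OF Y] ab X Y
    by (auto simp: abelian_Lie_def)
  obtain X where X: "X \<in> \<hh>" "X \<noteq> 0\<^sub>m n n" using zero nz by blast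
  have "\<not> scalar_matrix n X"
  proof
    assume "scalar_matrix n X"
    then obtain c where c: "X = c \<cdot>\<^sub>m 1\<^sub>m n" by (auto simp: scalar_matrix_def)
    have "c * of_nat n = 0" using hD(3)[OF X(1)] mtrace_smult[of "1\<^sub>m n" n c] by (simp add: c mtrace_one)
    then have "X = 0\<^sub>m n n" unfolding c by (auto intro!: eq_matI)
    then show False using X(2) by simp
  qed
  then show "\<exists>A\<in>\<hh>. \<not> scalar_matrix n A" using X(1) by blast
qed

section \<open>Families of projections permuted by a representation\<close>

locale unitary_rep = group G for G :: "('a, 'b) monoid_scheme" (structure) +
  fixes n :: nat and \<rho> :: "'a \<Rightarrow> complex mat"
  assumes finite_G: "finite (carrier G)" and rep_hom: "\<rho> \<in> hom G (U_group n)"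
begin

lemma rep_closed: "g \<in> carrier G \<Longrightarrow> \<rho> g \<in> carrier (U_group n)"
  using rep_hom by (auto simp: hom_def)

lemma rep_carrier: "g \<in> carrier G \<Longrightarrow> \<rho> g \<in> carrier_mat n n"
  using U_groupD(1)[OF rep_closed] .

lemma rep_mult: "g \<in> carrier G \<Longrightarrow> h \<in> carrier G \<Longrightarrow> \<rho> (g \<otimes> h) = \<rho> g * \<rho> h"
  using rep_hom by (auto simp: hom_def)

lemma rep_inv: "g \<in> carrier G \<Longrightarrow> \<rho> (inv g) = mat_adjoint (\<rho> g)"
  using group_hom.hom_inv[of G "U_group n" \<rho> g] U_group_inv[OF rep_closed]
  by (simp add: group_hom_def group_hom_axioms_def rep_hom U_group_group is_group)

lemma rep_one: "\<rho> \<one> = 1\<^sub>m n"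
  using group_hom.hom_one[of G "U_group n" \<rho>]
  by (simp add: group_hom_def group_hom_axioms_def rep_hom U_group_group is_group)

lemma uconj_rep_mult:
  "g \<in> carrier G \<Longrightarrow> h \<in> carrier G \<Longrightarrow> A \<in> carrier_mat n n \<Longrightarrow>
    uconj (\<rho> (g \<otimes> h)) A = uconj (\<rho> g) (uconj (\<rho> h) A)"
  by (simp add: rep_mult uconj_comp[OF rep_closed rep_closed])

text \<open>
  The condition \<open>1 \<notin> F\<close> excludes the trivial family \<open>{1}\<close>, which every representation permutes.
\<close>

definition permuted_family :: "complex mat set \<Rightarrow> bool" where
  "permuted_family F \<longleftrightarrow> orth_family n F \<and> mcomb n (\<lambda>_. 1) F = 1\<^sub>m n \<and> 1\<^sub>m n \<notin> F \<and>
     (\<forall>g\<in>carrier G. \<forall>P\<in>F. uconj (\<rho> g) P \<in> F)"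

lemma permuted_family_atoms:
  assumes S: "commuting_matrices n S" and inv: "\<And>g A. g \<in> carrier G \<Longrightarrow> A \<in> S \<Longrightarrow> uconj (\<rho> g) A \<in> S"
  shows "permuted_family (commuting_matrices.atoms n S)"
proof -
  interpret commuting_matrices n S by (rule S)
  have "uconj (\<rho> g) P \<in> atoms" if g: "g \<in> carrier G" and P: "P \<in> atoms" for g P
    using inv[OF g] inv[OF inv_closed[OF g]] by (intro atoms_uconj rep_closed g P) (auto simp: rep_inv[OF g])
  then show ?thesis
    using orth_family_atoms atoms_sum one_not_atom by (simp add: permuted_family_def)
qed

lemma bij_betw_uconj_rep:
  assumes F: "F \<subseteq> carrier_mat n n" and inv: "\<And>g P. g \<in> carrier G \<Longrightarrow> P \<in> F \<Longrightarrow> uconj (\<rho> g) P \<in> F"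
    and g: "g \<in> carrier G"
  shows "bij_betw (uconj (\<rho> g)) F F"
proof (rule bij_betwI[where g = "uconj (\<rho> (inv g))"])
  show "uconj (\<rho> g) \<in> F \<rightarrow> F" "uconj (\<rho> (inv g)) \<in> F \<rightarrow> F" using inv g by auto
  show "uconj (\<rho> (inv g)) (uconj (\<rho> g) x) = x" if "x \<in> F" for x
    unfolding rep_inv[OF g] by (rule uconj_inverse(2)[OF rep_closed[OF g]]) (use F that in auto)
  show "uconj (\<rho> g) (uconj (\<rho> (inv g)) y) = y" if "y \<in> F" for y
    unfolding rep_inv[OF g] by (rule uconj_inverse(1)[OF rep_closed[OF g]]) (use F that in auto)
qed

lemma uconj_mcomb:
  assumes F: "F \<subseteq> carrier_mat n n" and inv: "\<And>g P. g \<in> carrier G \<Longrightarrow> P \<in> F \<Longrightarrow> uconj (\<rho> g) P \<in> F"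
    and g: "g \<in> carrier G"
  shows "uconj (\<rho> g) (mcomb n z F) = mcomb n (\<lambda>P. z (uconj (\<rho> (inv g)) P)) F"
proof -
  have "uconj (\<rho> g) (mcomb n z F) = msum n (\<lambda>P. uconj (\<rho> g) (z P \<cdot>\<^sub>m P)) F"
    unfolding mcomb_def by (rule uconj_msum[OF rep_closed[OF g]]) (use F in auto)
  also have "\<dots> = msum n (\<lambda>P. z (uconj (\<rho> (inv g)) (uconj (\<rho> g) P)) \<cdot>\<^sub>m uconj (\<rho> g) P) F"
  proof (rule msum_cong)
    fix P assume "P \<in> F"
    then have P: "P \<in> carrier_mat n n" using F by auto
    show "uconj (\<rho> g) (z P \<cdot>\<^sub>m P) = z (uconj (\<rho> (inv g)) (uconj (\<rho> g) P)) \<cdot>\<^sub>m uconj (\<rho> g) P"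
      unfolding rep_inv[OF g] uconj_inverse(2)[OF rep_closed[OF g] P] uconj_smult[OF rep_closed[OF g] P] ..
  qed
  also have "\<dots> = mcomb n (\<lambda>P. z (uconj (\<rho> (inv g)) P)) F"
    unfolding mcomb_def msum_def
    by (rule arg_cong[of _ _ "mat n n"], rule ext,
        rule sum.reindex_bij_betw[OF bij_betw_uconj_rep[OF F inv g],
          where g = "\<lambda>P. (z (uconj (\<rho> (inv g)) P) \<cdot>\<^sub>m P) $$ _"])
  finally show ?thesis .
qed

end

locale irreducible_unitary_rep = unitary_rep +
  assumes irreducible: "irreducible_rep G n \<rho>"
begin

lemma n_pos: "0 < n"
  using irreducible by (simp add: irreducible_rep_def)

lemma fixed_projection:
  assumes P: "orth_proj n P" and fixed: "\<And>g. g \<in> carrier G \<Longrightarrow> uconj (\<rho> g) P = P"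
  shows "P = 0\<^sub>m n n \<or> P = 1\<^sub>m n"
  by (rule irreducible_commuting_projection[OF irreducible P rep_carrier])
    (use fixed in \<open>auto intro!: commute_if_uconj_fixed[OF rep_closed orth_projD(1)[OF P]]\<close>)

context
  fixes F assumes F: "permuted_family F"
begin

lemma family_orth: "orth_family n F" and family_sum: "mcomb n (\<lambda>_. 1) F = 1\<^sub>m n"
  and family_one_notin: "1\<^sub>m n \<notin> F" and family_invariant: "g \<in> carrier G \<Longrightarrow> P \<in> F \<Longrightarrow> uconj (\<rho> g) P \<in> F"
  using F by (auto simp: permuted_family_def)

lemmas family_members = orth_familyD[OF family_orth]

lemma family_carrier: "F \<subseteq> carrier_mat n n"
  using family_members(3) by auto

lemma family_nonempty: "F \<noteq> {}"
proof
  assume "F = {}"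
  then have "0\<^sub>m n n = (1\<^sub>m n :: complex mat)"
    using family_sum by (simp add: mcomb_def msum_def zero_mat_def)
  then have "(0\<^sub>m n n :: complex mat) $$ (0, 0) = 1\<^sub>m n $$ (0, 0)" by simp
  then show False using n_pos by simp
qed

lemma family_two_members: 
  obtains P Q where "P \<in> F" "Q \<in> F" "P \<noteq> Q"
proof -
  obtain P where P: "P \<in> F" using family_nonempty by blast
  have "F \<noteq> {P}"
  proof
    assume *: "F = {P}"
    have "mcomb n (\<lambda>_. 1) {P} = P"
      using family_members(3)[OF P] by (auto simp: mcomb_def msum_def intro!: eq_matI)
    then show False using family_sum family_one_notin P * by simp
  qed
  then show ?thesis using that P by blast
qed

text \<open>
  The sum of an orbit is a projection that is fixed by the representation, hence the identity, and it
  annihilates every member outside the orbit.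
\<close>

lemma family_transitive:
  assumes P: "P \<in> F" and Q: "Q \<in> F"
  shows "\<exists>g\<in>carrier G. uconj (\<rho> g) P = Q"
proof (rule ccontr)
  assume no: "\<not> (\<exists>g\<in>carrier G. uconj (\<rho> g) P = Q)"
  define Orb where "Orb = (\<lambda>g. uconj (\<rho> g) P) ` carrier G"
  have sub: "Orb \<subseteq> F" using family_invariant P by (auto simp: Orb_def)
  then have orb: "orth_family n Orb" using family_orth finite_subset[OF sub] by (auto simp: orth_family_def)
  have cP: "P \<in> carrier_mat n n" by (rule family_members(3)[OF P])
  have "uconj (\<rho> g) R \<in> Orb" if "g \<in> carrier G" "R \<in> Orb" for g R
  proof -
    from that(2) obtain h where h: "h \<in> carrier G" "R = uconj (\<rho> h) P" by (auto simp: Orb_def)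
    then have "uconj (\<rho> g) R = uconj (\<rho> (g \<otimes> h)) P" using uconj_rep_mult[OF that(1) h(1) cP] by simp
    then show ?thesis using that(1) h(1) by (auto simp: Orb_def)
  qed
  then have "uconj (\<rho> g) (mcomb n (\<lambda>_. 1) Orb) = mcomb n (\<lambda>_. 1) Orb" if "g \<in> carrier G" for g
    using uconj_mcomb[of Orb g "\<lambda>_. 1"] sub family_carrier that by blast
  then have E: "mcomb n (\<lambda>_. 1) Orb = 0\<^sub>m n n \<or> mcomb n (\<lambda>_. 1) Orb = 1\<^sub>m n"
    by (rule fixed_projection[OF orth_proj_mcomb_one[OF orb]])
  have "P = uconj (\<rho> \<one>) P"
    using uconj_one[of "1\<^sub>m n" n] cP by (simp add: rep_one uconj_def mat_adjoint_one)
  then have "P \<in> Orb" by (auto simp: Orb_def)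
  then have "mcomb n (\<lambda>_. 1) Orb * P = 1 \<cdot>\<^sub>m P" by (rule mcomb_mult_member[OF orb])
  also have "1 \<cdot>\<^sub>m P = P" by (intro eq_matI) auto
  finally have "mcomb n (\<lambda>_. 1) Orb \<noteq> 0\<^sub>m n n" using family_members(4)[OF P] cP by auto
  then have "Q = mcomb n (\<lambda>_. 1) Orb * Q" using E family_members(3)[OF Q] by simp
  also have "\<dots> = msum n (\<lambda>R. (1 \<cdot>\<^sub>m R) * Q) Orb"
    unfolding mcomb_def by (rule msum_mult_right) (use sub family_members(3) Q in auto)
  also have "\<dots> = msum n (\<lambda>R. 0\<^sub>m n n) Orb"
  proof (rule msum_cong)
    fix R assume "R \<in> Orb"
    then have R: "R \<in> F" "R \<noteq> Q" using sub no by (auto simp: Orb_def)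
    have "1 \<cdot>\<^sub>m R = R" by (intro eq_matI) auto
    then show "1 \<cdot>\<^sub>m R * Q = 0\<^sub>m n n" using family_members(5)[OF R(1) Q R(2)] by simp
  qed
  also have "\<dots> = 0\<^sub>m n n" by (auto simp: msum_def intro!: eq_matI)
  finally show False using family_members(4)[OF Q] by simp
qed

text \<open>
  The action on \<open>F\<close> is transported along an injection of \<open>F\<close> into \<open>{1..n}\<close>; the remaining letters are
  fixed. The action is not trivial, as a member fixed by the representation would be \<open>0\<close> or \<open>1\<close>.
\<close>

lemma nontrivial_hom_to_sym_group:
  "\<exists>\<phi>\<in>hom G (sym_group n). \<exists>g\<in>carrier G. \<phi> g \<noteq> \<one>\<^bsub>sym_group n\<^esub>"
proof -
  obtain e where e: "e ` F \<subseteq> {1..n}" "inj_on e F"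
    using card_le_inj[OF family_members(1), of "{1..n}"] orth_family_card_le[OF family_orth] by auto
  define \<phi> where "\<phi> g = (\<lambda>i. if i \<in> e ` F then e (uconj (\<rho> g) (inv_into F e i)) else i)" for g
  have val: "\<phi> g (e P) = e (uconj (\<rho> g) P)" if "P \<in> F" for g P
    using that e(2) by (simp add: \<phi>_def)
  have perm: "\<phi> g permutes {1..n}" if g: "g \<in> carrier G" for g
  proof (rule permutes_subset[OF _ e(1)], rule bij_imp_permutes)
    have "bij_betw (e \<circ> uconj (\<rho> g) \<circ> inv_into F e) (e ` F) (e ` F)"
      using bij_betw_uconj_rep[OF family_carrier family_invariant g] e(2)
      by (meson bij_betw_trans bij_betw_inv_into inj_on_imp_bij_betw)
    then show "bij_betw (\<phi> g) (e ` F) (e ` F)"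
      by (rule bij_betw_cong[THEN iffD1, rotated]) (auto simp: \<phi>_def)
  qed (auto simp: \<phi>_def)
  have "\<phi> (g \<otimes> h) = \<phi> g \<circ> \<phi> h" if gh: "g \<in> carrier G" "h \<in> carrier G" for g h
  proof
    fix i
    show "\<phi> (g \<otimes> h) i = (\<phi> g \<circ> \<phi> h) i"
    proof (cases "i \<in> e ` F")
      case True
      then obtain P where P: "P \<in> F" "i = e P" by blast
      then show ?thesis
        using val[OF P(1)] val[OF family_invariant[OF gh(2) P(1)]] uconj_rep_mult[OF gh family_members(3)[OF P(1)]] by simp
    qed (auto simp: \<phi>_def)
  qed
  then have hom: "\<phi> \<in> hom G (sym_group n)"
    using perm by (auto simp: hom_def sym_group_def)
  have "\<exists>g\<in>carrier G. \<phi> g \<noteq> id"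
  proof (rule ccontr)
    assume "\<not> ?thesis"
    then have id: "\<phi> g = id" if "g \<in> carrier G" for g using that by blast
    obtain P where P: "P \<in> F" using family_nonempty by blast
    have "uconj (\<rho> g) P = P" if g: "g \<in> carrier G" for g
    proof -
      have "e (uconj (\<rho> g) P) = e P" using val[OF P, of g] id[OF g] by simp
      then show ?thesis using e(2) family_invariant[OF g P] P by (auto dest: inj_onD)
    qed
    then show False using fixed_projection[OF family_members(2)[OF P]] family_members(4)[OF P] family_one_notin P by auto
  qed
  then show ?thesis using hom by (auto simp: sym_group_one)
qed

text \<open>
  Write \<open>e P c\<close> for the matrix that acts as \<open>c\<close> on the range of \<open>P\<close> and as the identity on its complement.
  The determinant of \<open>e P c\<close> is multiplicative in \<open>c\<close>, and it does not depend on \<open>P\<close>, because the members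
  of \<open>F\<close> are conjugate to each other. The determinant of the combination is therefore \<open>det (e P (\<Prod> z))\<close>
  for any single \<open>P\<close>.
\<close>

lemma det_mcomb_one:
  assumes prod: "(\<Prod>P\<in>F. z P) = 1"
  shows "det (mcomb n z F) = 1"
proof -
  define e where "e P c = mcomb n (\<lambda>Q. if Q = P then c else 1) F" for P c
  have e_mult: "det (e P c) * det (e P c') = det (e P (c * c'))" for P c c'
  proof -
    have "e P c * e P c' = e P (c * c')"
      unfolding e_def mcomb_mult[OF family_orth] by (rule mcomb_cong) auto
    then show ?thesis using det_mult[of "e P c" n "e P c'"] by (simp add: e_def)
  qed
  have e_conj: "det (e P c) = det (e Q c)" if PQ: "P \<in> F" "Q \<in> F" for P Q c
  proof -
    obtain g where g: "g \<in> carrier G" "uconj (\<rho> g) P = Q" using family_transitive[OF PQ] by blast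
    have "uconj (\<rho> g) (e P c) = mcomb n (\<lambda>R. if uconj (\<rho> (inv g)) R = P then c else 1) F"
      unfolding e_def by (rule uconj_mcomb[OF family_carrier _ g(1)]) (rule family_invariant)
    also have "\<dots> = e Q c"
      unfolding e_def
    proof (rule mcomb_cong)
      fix R assume "R \<in> F"
      then have "uconj (\<rho> (inv g)) R = P \<longleftrightarrow> R = Q"
        using uconj_inverse[OF rep_closed[OF g(1)]] family_members(3) PQ g by (metis rep_inv)
      then show "(if uconj (\<rho> (inv g)) R = P then c else 1) = (if R = Q then c else 1)" by simp
    qed
    finally show ?thesis using det_uconj[OF rep_closed[OF g(1)], of "e P c"] by (simp add: e_def)
  qed
  have split: "det (mcomb n (\<lambda>Q. if Q \<in> A then z Q else 1) F) = (\<Prod>P\<in>A. det (e P (z P)))"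
    if "finite A" "A \<subseteq> F" for A
    using that
  proof (induction A rule: finite_induct)
    case empty
    then show ?case by (simp add: family_sum)
  next
    case (insert P A)
    have "mcomb n (\<lambda>Q. if Q \<in> insert P A then z Q else 1) F
        = e P (z P) * mcomb n (\<lambda>Q. if Q \<in> A then z Q else 1) F"
      unfolding e_def mcomb_mult[OF family_orth] by (rule mcomb_cong) (use insert in auto)
    then have "det (mcomb n (\<lambda>Q. if Q \<in> insert P A then z Q else 1) F)
        = det (e P (z P)) * det (mcomb n (\<lambda>Q. if Q \<in> A then z Q else 1) F)"
      using det_mult[of "e P (z P)" n] by (simp add: e_def)
    then show ?case using insert by simp
  qed
  obtain P0 where P0: "P0 \<in> F" using family_nonempty by blast
  have e1: "det (e P0 1) = 1" by (simp add: e_def family_sum)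
  have collect: "(\<Prod>P\<in>A. det (e P0 (z P))) = det (e P0 (\<Prod>P\<in>A. z P))" if "finite A" for A
    using that
  proof (induction A rule: finite_induct)
    case (insert P A)
    then show ?case using e_mult[of P0 "z P"] by simp
  qed (simp add: e1)
  have "det (mcomb n z F) = det (mcomb n (\<lambda>Q. if Q \<in> F then z Q else 1) F)"
    by (rule arg_cong[of _ _ det], rule mcomb_cong) simp
  also have "\<dots> = (\<Prod>P\<in>F. det (e P (z P)))" by (rule split[OF family_members(1)]) simp
  also have "\<dots> = (\<Prod>P\<in>F. det (e P0 (z P)))" by (rule prod.cong[OF refl e_conj[OF _ P0]])
  also have "\<dots> = 1" unfolding collect[OF family_members(1)] prod by (rule e1)
  finally show ?thesis .
qed

end

end

section \<open>Tori\<close>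

lemma continuous_map_mat_entry:
  assumes "i < n" "j < n"
  shows "continuous_map (mat_topology n) euclidean (\<lambda>A. A $$ (i, j))"
proof -
  have "continuous_map (mat_topology n) euclidean
      ((\<lambda>f. f (i, j)) \<circ> (\<lambda>A. \<lambda>ij\<in>{..<n} \<times> {..<n}. A $$ ij))"
    unfolding mat_topology_def
    by (rule continuous_map_pullback, rule continuous_map_product_projection) (use assms in auto)
  then show ?thesis using assms by (simp add: comp_def)
qed

lemma continuous_map_into_mat_topology:
  assumes "\<And>x. x \<in> topspace X \<Longrightarrow> f x \<in> carrier_mat n n"
    and "\<And>i j. i < n \<Longrightarrow> j < n \<Longrightarrow> continuous_map X euclidean (\<lambda>x. f x $$ (i, j))"
  shows "continuous_map X (mat_topology n) f"
  unfolding mat_topology_def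
proof (rule continuous_map_pullback')
  show "continuous_map X (product_topology (\<lambda>_. euclidean) ({..<n} \<times> {..<n}))
      ((\<lambda>A. \<lambda>ij\<in>{..<n} \<times> {..<n}. A $$ ij) \<circ> f)"
    using assms(2) by (auto simp: continuous_map_componentwise comp_def)
qed (use assms(1) in auto)

lemma continuous_map_euclidean_mult:
  fixes f g :: "'a \<Rightarrow> complex"
  assumes "continuous_map X euclidean f" "continuous_map X euclidean g"
  shows "continuous_map X euclidean (\<lambda>x. f x * g x)"
  using assms by (simp add: continuous_map_atin tendsto_mult)

lemma continuous_map_euclidean_prod:
  fixes f :: "'a \<Rightarrow> 'i \<Rightarrow> complex"
  assumes "finite I" "\<And>i. i \<in> I \<Longrightarrow> continuous_map X euclidean (\<lambda>x. f x i)"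
  shows "continuous_map X euclidean (\<lambda>x. \<Prod>i\<in>I. f x i)"
  using assms
  by (induction I rule: finite_induct) (auto intro: continuous_map_euclidean_mult)

lemma in_normalizer_iff:
  assumes k: "k \<in> carrier (SU_group n)" and T: "T \<subseteq> carrier (SU_group n)"
  shows "k \<in> normalizer (SU_group n) T \<longleftrightarrow> uconj k ` T = T"
proof -
  have "k <#\<^bsub>SU_group n\<^esub> T #>\<^bsub>SU_group n\<^esub> inv\<^bsub>SU_group n\<^esub> k = uconj k ` T"
    by (auto simp: l_coset_def r_coset_def SU_group_inv[OF k] uconj_def)
  then show ?thesis using k T by (simp add: normalizer_def stabilizer_def)
qed

lemma connected_finite_imp_singleton:
  fixes S :: "'a :: t1_space set"
  assumes S: "connected S" "finite S" and a: "a \<in> S"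
  shows "S = {a}"
proof (rule ccontr)
  assume "S \<noteq> {a}"
  then have "S \<subseteq> {a} \<union> (S - {a})" "{a} \<inter> (S - {a}) \<inter> S = {}" "{a} \<inter> S \<noteq> {}" "(S - {a}) \<inter> S \<noteq> {}"
    using a by auto
  moreover have "closed {a}" "closed (S - {a})" using S(2) by (auto intro: finite_imp_closed)
  ultimately show False using S(1) unfolding connected_closed by blast
qed

text \<open>
  A scalar matrix of determinant \<open>1\<close> is given by an \<open>n\<close>-th root of unity, and a connected set of these
  has one element.
\<close>

lemma nontrivial_torus_nonscalar:
  assumes T: "SU_torus n T" and nt: "T \<noteq> {1\<^sub>m n}"
  shows "\<exists>A\<in>T. \<not> scalar_matrix n A"
proof (rule ccontr)
  assume "\<not> ?thesis"
  then have sc: "\<And>A. A \<in> T \<Longrightarrow> \<exists>c. A = c \<cdot>\<^sub>m 1\<^sub>m n" by (auto simp: scalar_matrix_def)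
  have sub: "subgroup T (SU_group n)" and conn: "connectedin (SU_topology n) T"
    using T by (auto simp: SU_torus_def)
  have TSU: "T \<subseteq> carrier (SU_group n)" and one: "1\<^sub>m n \<in> T"
    using subgroup.subset[OF sub] subgroup.one_closed[OF sub] by auto
  have cT: "A \<in> carrier_mat n n" "det A = 1" if "A \<in> T" for A
    using that TSU by (auto simp: SU_group_carrier U_group_carrier)
  have "T \<subseteq> {1\<^sub>m n}"
  proof (cases "n = 0")
    case True
    have "A = 1\<^sub>m n" if "A \<in> T" for A
      using cT(1)[OF that] True by (intro eq_matI) auto
    then show ?thesis by blast
  next
    case False
    have "connectedin euclidean ((\<lambda>A. A $$ (0, 0)) ` T)"
      using connectedin_continuous_map_image[OF continuous_map_mat_entry[of 0 n 0], of T] conn False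
      by (simp add: SU_topology_def connectedin_subtopology)
    then have "connected ((\<lambda>A. A $$ (0, 0)) ` T)" by (simp add: connectedin_iff_connected)
    moreover have roots: "(\<lambda>A. A $$ (0, 0)) ` T \<subseteq> {c. c ^ n = 1}"
    proof
      fix c assume "c \<in> (\<lambda>A. A $$ (0, 0)) ` T"
      then obtain A where A: "A \<in> T" "c = A $$ (0, 0)" by blast
      obtain d where d: "A = d \<cdot>\<^sub>m 1\<^sub>m n" using sc[OF A(1)] by blast
      have "d ^ n = 1" using cT(2)[OF A(1)] by (simp add: d)
      then show "c \<in> {c. c ^ n = 1}" using A(2) d False by simp
    qed
    have "finite ((\<lambda>A. A $$ (0, 0)) ` T)"
      by (rule finite_subset[OF roots], rule finite_roots_unity) (use False in simp)
    ultimately obtain a where a: "(\<lambda>A. A $$ (0, 0)) ` T = {a}"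
      using connected_finite_imp_singleton one by blast
    show ?thesis
    proof
      fix A assume A: "A \<in> T"
      obtain d where d: "A = d \<cdot>\<^sub>m 1\<^sub>m n" using sc[OF A] by blast
      have "A $$ (0, 0) = 1\<^sub>m n $$ (0, 0)" using a A one by (metis image_eqI singletonD)
      then have "d = 1" using False by (simp add: d)
      then show "A \<in> {1\<^sub>m n}" unfolding d by (auto intro!: eq_matI)
    qed
  qed
  then show False using nt one by blast
qed

lemma commuting_matrices_torus:
  assumes T: "SU_torus n T" and nt: "T \<noteq> {1\<^sub>m n}"
  shows "commuting_matrices n T"
proof
  have sub: "subgroup T (SU_group n)" using T by (simp add: SU_torus_def)
  note TSU = subgroup.subset[OF sub]
  show "T \<subseteq> carrier_mat n n" using TSU by (auto simp: SU_group_carrier U_group_carrier)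
  show "mat_adjoint A \<in> T" if A: "A \<in> T" for A
    using subgroup.m_inv_closed[OF sub A] SU_group_inv[of A n] TSU A by auto
  show "A * B = B * A" if "A \<in> T" "B \<in> T" for A B
    using T that by (auto simp: SU_torus_def)
  show "\<exists>A\<in>T. \<not> scalar_matrix n A" by (rule nontrivial_torus_nonscalar[OF T nt])
qed

lemma prod_cis: "finite A \<Longrightarrow> (\<Prod>x\<in>A. cis (f x)) = cis (\<Sum>x\<in>A. f x)"
  by (induction A rule: finite_induct) (auto simp: cis_mult)

text \<open>
  The sum of any choice of angles is a multiple of \<open>2 * pi\<close>, which is subtracted from one of them.
\<close>

lemma unit_complex_angles:
  assumes F: "finite F" "F \<noteq> {}" and unit: "\<And>x. x \<in> F \<Longrightarrow> cmod (z x) = 1" and prod: "(\<Prod>x\<in>F. z x) = 1"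
  obtains \<theta> where "\<And>x. x \<in> F \<Longrightarrow> z x = cis (\<theta> x)" "(\<Sum>x\<in>F. \<theta> x) = 0"
proof -
  obtain x0 where x0: "x0 \<in> F" using F by blast
  have z: "z x = cis (Arg (z x))" if "x \<in> F" for x
    using unit[OF that] cis_Arg[of "z x"] by (cases "z x = 0") (auto simp: sgn_eq)
  have "cis (\<Sum>x\<in>F. Arg (z x)) = (\<Prod>x\<in>F. cis (Arg (z x)))" by (rule prod_cis[OF F(1), symmetric])
  also have "\<dots> = (\<Prod>x\<in>F. z x)" by (rule prod.cong[OF refl z[symmetric]])
  finally have "cos (\<Sum>x\<in>F. Arg (z x)) = 1" using prod by (metis cis.sel(1) one_complex.sel(1))
  then obtain k :: int where k: "(\<Sum>x\<in>F. Arg (z x)) = of_int k * 2 * pi"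
    using cos_one_2pi_int by blast
  define \<theta> where "\<theta> x = Arg (z x) - (if x = x0 then of_int k * 2 * pi else 0)" for x
  have "(\<Sum>x\<in>F. \<theta> x) = 0"
    using F(1) x0 k by (simp add: \<theta>_def sum_subtractf)
  moreover have "z x = cis (\<theta> x)" if "x \<in> F" for x
  proof -
    have "cis (of_int k * 2 * pi) = 1" using cis_multiple_2pi[of "of_int k"] by (simp add: mult_ac)
    then have "cis (Arg (z x0) - of_int k * 2 * pi) = cis (Arg (z x0))"
      by (simp flip: cis_divide)
    then show ?thesis using z[OF that] by (auto simp: \<theta>_def)
  qed
  ultimately show ?thesis using that by blast
qed

lemma compact_unit_circle: "compact {c :: complex. cmod c = 1}"
proof -
  have "c = cis (Arg c)" if "cmod c = 1" for c
    using that cis_Arg[of c] by (cases "c = 0") (auto simp: sgn_eq)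
  then have "{c. cmod c = 1} = cis ` {- pi..pi}"
    using Arg_bounded by (force simp: image_iff)
  also have "compact \<dots>"
    by (intro compact_continuous_image continuous_intros compact_Icc)
  finally show ?thesis .
qed

context irreducible_unitary_rep
begin

text \<open>
  The torus of all \<open>\<Sum> z P\<close>, \<open>P \<in> F\<close>, with coefficients \<open>z\<close> on the unit circle and of product \<open>1\<close>. It is compact
  as the image of a closed subset of a product of circles. It is connected because scaling angles of
  sum \<open>0\<close> by \<open>t \<in> [0, 1]\<close> joins each member to the identity.
\<close>

lemma permuted_family_torus:
  assumes F: "permuted_family F" and SU: "\<rho> ` carrier G \<subseteq> carrier (SU_group n)"
  shows "normalizes_nontrivial_torus n (\<rho> ` carrier G)"
proof -
  note fam = family_orth[OF F] and d = family_members[OF F]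
  define Z where "Z = {z. (\<forall>P\<in>F. cmod (z P) = 1) \<and> (\<Prod>P\<in>F. z P) = 1}"
  define T where "T = (\<lambda>z. mcomb n z F) ` Z"
  have Zmult: "(\<lambda>P. z P * w P) \<in> Z" if "z \<in> Z" "w \<in> Z" for z w
    using that by (auto simp: Z_def norm_mult prod.distrib)
  have Zcnj: "(\<lambda>P. cnj (z P)) \<in> Z" if "z \<in> Z" for z
    using that by (auto simp: Z_def simp flip: cnj_prod)
  have Z1: "(\<lambda>_. 1) \<in> Z" by (simp add: Z_def)
  have TSU: "mcomb n z F \<in> carrier (SU_group n)" if z: "z \<in> Z" for z
  proof -
    have "mcomb n (\<lambda>P. z P * cnj (z P)) F = mcomb n (\<lambda>_. 1) F"
      by (rule mcomb_cong) (use z in \<open>auto simp: Z_def simp flip: complex_norm_square\<close>)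
    then have "mcomb n (\<lambda>P. z P * cnj (z P)) F = 1\<^sub>m n" using family_sum[OF F] by simp
    then show ?thesis
      using det_mcomb_one[OF F, of z] z
      by (auto simp: SU_group_carrier U_group_carrier mcomb_adjoint[OF fam] mcomb_mult[OF fam] Z_def mult.commute)
  qed
  have sub: "subgroup T (SU_group n)"
  proof (rule group.subgroupI[OF SU_group_group])
    show "T \<subseteq> carrier (SU_group n)" using TSU by (auto simp: T_def)
    show "T \<noteq> {}" using Z1 by (auto simp: T_def)
    show "inv\<^bsub>SU_group n\<^esub> A \<in> T" if "A \<in> T" for A
      using that TSU Zcnj by (auto simp: T_def SU_group_inv mcomb_adjoint[OF fam])
    show "A \<otimes>\<^bsub>SU_group n\<^esub> B \<in> T" if "A \<in> T" "B \<in> T" for A B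
      using that Zmult by (auto simp: T_def mcomb_mult[OF fam])
  qed
  have commute: "s * t = t * s" if "s \<in> T" "t \<in> T" for s t
    using that by (auto simp: T_def mcomb_mult[OF fam] mult.commute)
  have entry: "mcomb n z F $$ (i, j) = (\<Sum>P\<in>F. z P * P $$ (i, j))" if "i < n" "j < n" for z i j
  proof -
    have "(z P \<cdot>\<^sub>m P) $$ (i, j) = z P * P $$ (i, j)" if "P \<in> F" for P
      using d(3)[OF that] \<open>i < n\<close> \<open>j < n\<close> by simp
    then show ?thesis using that by (simp add: mcomb_def msum_def)
  qed

  have compact: "compactin (mat_topology n) T"
  proof -
    let ?X = "product_topology (\<lambda>_. euclidean :: complex topology) F"
    have cont: "continuous_map ?X (mat_topology n) (\<lambda>z. mcomb n z F)"
      by (rule continuous_map_into_mat_topology)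
        (auto simp: entry intro!: continuous_map_sum d(1) continuous_map_euclidean_mult
          continuous_map_product_projection continuous_map_const[THEN iffD2])
    have "compactin ?X (PiE F (\<lambda>_. {c. cmod c = 1}))"
      using compact_unit_circle by (simp add: compactin_PiE compactin_euclidean_iff)
    moreover have "continuous_map ?X euclidean (\<lambda>z. \<Prod>P\<in>F. z P)"
      by (rule continuous_map_euclidean_prod[OF d(1)]) (rule continuous_map_product_projection)
    then have "closedin ?X {z \<in> topspace ?X. (\<Prod>P\<in>F. z P) \<in> {1}}"
      by (rule closedin_continuous_map_preimage) simp
    ultimately have K: "compactin ?X (PiE F (\<lambda>_. {c. cmod c = 1}) \<inter> {z \<in> topspace ?X. (\<Prod>P\<in>F. z P) \<in> {1}})"
      (is "compactin _ ?K") by (rule compact_Int_closedin)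
    have "T = (\<lambda>z. mcomb n z F) ` ?K"
    proof
      show "T \<subseteq> (\<lambda>z. mcomb n z F) ` ?K"
      proof
        fix A assume "A \<in> T"
        then obtain z where z: "z \<in> Z" "A = mcomb n z F" by (auto simp: T_def)
        have "restrict z F \<in> ?K" using z(1) by (auto simp: Z_def)
        moreover have "A = mcomb n (restrict z F) F" unfolding z(2) by (rule mcomb_cong) simp
        ultimately show "A \<in> (\<lambda>z. mcomb n z F) ` ?K" by blast
      qed
      show "(\<lambda>z. mcomb n z F) ` ?K \<subseteq> T" by (auto simp: T_def Z_def PiE_iff)
    qed
    then show ?thesis using image_compactin[OF K cont] by simp
  qed

  have connected: "connectedin (mat_topology n) T"
  proof -
    let ?U = "{C. connectedin (mat_topology n) C \<and> 1\<^sub>m n \<in> C \<and> C \<subseteq> T}"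
    have "T \<subseteq> \<Union> ?U"
    proof
      fix A assume "A \<in> T"
      then obtain z where z: "z \<in> Z" "A = mcomb n z F" by (auto simp: T_def)
      obtain \<theta> where \<theta>: "\<And>P. P \<in> F \<Longrightarrow> z P = cis (\<theta> P)" "(\<Sum>P\<in>F. \<theta> P) = 0"
        using unit_complex_angles[OF d(1) family_nonempty[OF F], of z] z(1) by (auto simp: Z_def)
      define \<gamma> where "\<gamma> t = mcomb n (\<lambda>P. cis (t * \<theta> P)) F" for t
      have "continuous_map euclideanreal (mat_topology n) \<gamma>"
        unfolding \<gamma>_def
        by (rule continuous_map_into_mat_topology) (auto simp: entry intro!: continuous_intros)
      then have "connectedin (mat_topology n) (\<gamma> ` {0..1})"
        by (rule connectedin_continuous_map_image) (simp add: connectedin_iff_connected)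
      moreover have "\<gamma> 0 = 1\<^sub>m n" by (simp add: \<gamma>_def family_sum[OF F])
      then have "1\<^sub>m n \<in> \<gamma> ` {0..1}" by (metis atLeastAtMost_iff image_eqI order_refl zero_le_one)
      moreover have "\<gamma> t \<in> T" for t
      proof -
        have "(\<Sum>P\<in>F. t * \<theta> P) = 0" using \<theta>(2) by (simp flip: sum_distrib_left)
        then have "(\<lambda>P. cis (t * \<theta> P)) \<in> Z" by (simp add: Z_def prod_cis[OF d(1)])
        then show ?thesis by (auto simp: \<gamma>_def T_def)
      qed
      moreover have "A = \<gamma> 1" unfolding z(2) \<gamma>_def by (rule mcomb_cong) (simp add: \<theta>(1))
      then have "A \<in> \<gamma> ` {0..1}" by (metis atLeastAtMost_iff image_eqI order_refl zero_le_one)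
      ultimately show "A \<in> \<Union> ?U" by blast
    qed
    then have "T = \<Union> ?U" by blast
    moreover have "connectedin (mat_topology n) (\<Union> ?U)"
      by (rule connectedin_Union) auto
    ultimately show ?thesis by simp
  qed

  have torus: "SU_torus n T"
    using sub commute compact connected subgroup.subset[OF sub]
    by (auto simp: SU_torus_def SU_topology_def compactin_subtopology connectedin_subtopology)

  have "T \<noteq> {1\<^sub>m n}"
  proof
    assume T1: "T = {1\<^sub>m n}"
    obtain P Q where PQ: "P \<in> F" "Q \<in> F" "P \<noteq> Q" using family_two_members[OF F] by blast
    \<comment> \<open>The element with coefficient \<open>-1\<close> at \<open>P\<close> and at \<open>Q\<close>, and \<open>1\<close> elsewhere.\<close>
    define z :: "complex mat \<Rightarrow> complex"
      where "z R = (if R = P then -1 else 1) * (if R = Q then -1 else 1)" for R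
    have "z \<in> Z"
      using PQ d(1) by (simp add: Z_def z_def prod.distrib norm_mult)
    then have "mcomb n z F = 1\<^sub>m n" using T1 by (auto simp: T_def)
    then have neg: "P = (-1) \<cdot>\<^sub>m P"
      using mcomb_mult_member[OF fam PQ(1), of z] d(3)[OF PQ(1)] PQ(3) by (simp add: z_def)
    have "P $$ (i, j) = 0" if "i < n" "j < n" for i j
    proof -
      have "P $$ (i, j) = ((-1) \<cdot>\<^sub>m P) $$ (i, j)" by (rule arg_cong[OF neg])
      also have "\<dots> = - P $$ (i, j)" using that d(3)[OF PQ(1)] by simp
      finally show ?thesis by simp
    qed
    then have "P = 0\<^sub>m n n" using d(3)[OF PQ(1)] by (intro eq_matI) auto
    then show False using d(4)[OF PQ(1)] by simp
  qed
  moreover have "\<rho> ` carrier G \<subseteq> normalizer (SU_group n) T"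
  proof
    fix k assume "k \<in> \<rho> ` carrier G"
    then obtain g where g: "g \<in> carrier G" "k = \<rho> g" by blast
    have inv: "uconj (\<rho> g) A \<in> T" if g: "g \<in> carrier G" and A: "A \<in> T" for g A
    proof -
      obtain z where z: "z \<in> Z" "A = mcomb n z F" using A by (auto simp: T_def)
      have *: "uconj (\<rho> g) A = mcomb n (\<lambda>P. z (uconj (\<rho> (inv g)) P)) F"
        unfolding z(2) by (rule uconj_mcomb[OF family_carrier[OF F] _ g]) (rule family_invariant[OF F])
      have bij: "bij_betw (uconj (\<rho> (inv g))) F F"
        by (rule bij_betw_uconj_rep[OF family_carrier[OF F]]) (use family_invariant[OF F] g in auto)
      have "(\<Prod>P\<in>F. z (uconj (\<rho> (inv g)) P)) = 1"
        using prod.reindex_bij_betw[OF bij, of z] z(1) by (simp add: Z_def)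
      moreover have "cmod (z (uconj (\<rho> (inv g)) P)) = 1" if "P \<in> F" for P
        using family_invariant[OF F inv_closed[OF g] that] z(1) by (simp add: Z_def)
      ultimately have "(\<lambda>P. z (uconj (\<rho> (inv g)) P)) \<in> Z" by (simp add: Z_def)
      then show ?thesis unfolding * by (auto simp: T_def)
    qed
    have "T \<subseteq> carrier_mat n n" by (auto simp: T_def)
    from bij_betw_uconj_rep[OF this inv g(1)] have "uconj k ` T = T"
      by (simp add: bij_betw_def g(2))
    then show "k \<in> normalizer (SU_group n) T"
      using in_normalizer_iff[of k n T] SU g subgroup.subset[OF sub] by auto
  qed
  ultimately show ?thesis using torus by (auto simp: normalizes_nontrivial_torus_def)
qed

lemma commuting_matrices_imp_torus:
  assumes "commuting_matrices n S" and "\<And>g A. g \<in> carrier G \<Longrightarrow> A \<in> S \<Longrightarrow> uconj (\<rho> g) A \<in> S"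
    and "\<rho> ` carrier G \<subseteq> carrier (SU_group n)"
  shows "normalizes_nontrivial_torus n (\<rho> ` carrier G)"
  by (rule permuted_family_torus[OF permuted_family_atoms]) (use assms in auto)

lemma torus_imp_commuting_matrices:
  assumes "normalizes_nontrivial_torus n (\<rho> ` carrier G)" and SU: "\<rho> ` carrier G \<subseteq> carrier (SU_group n)"
  obtains S where "commuting_matrices n S" "\<And>g A. g \<in> carrier G \<Longrightarrow> A \<in> S \<Longrightarrow> uconj (\<rho> g) A \<in> S"
proof -
  obtain T where T: "SU_torus n T" "T \<noteq> {1\<^sub>m n}" "\<rho> ` carrier G \<subseteq> normalizer (SU_group n) T"
    using assms(1) by (auto simp: normalizes_nontrivial_torus_def)
  then have TSU: "T \<subseteq> carrier (SU_group n)" by (auto simp: SU_torus_def dest: subgroup.subset)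
  have "uconj (\<rho> g) A \<in> T" if g: "g \<in> carrier G" and A: "A \<in> T" for g A
  proof -
    have "\<rho> g \<in> carrier (SU_group n)" "\<rho> g \<in> normalizer (SU_group n) T" using g SU T(3) by auto
    then have "uconj (\<rho> g) ` T = T" using in_normalizer_iff[OF _ TSU] by blast
    then show ?thesis using A by blast
  qed
  then show ?thesis using that commuting_matrices_torus[OF T(1,2)] by blast
qed

end

section \<open>Commutators near the identity\<close>

definition ucomm :: "complex mat \<Rightarrow> complex mat \<Rightarrow> complex mat" where
  "ucomm A B = A * B * mat_adjoint A * mat_adjoint B"

lemma U_group_closed:
  assumes "A \<in> carrier (U_group n)" "B \<in> carrier (U_group n)"
  shows "A * B \<in> carrier (U_group n)"
  using monoid.m_closed[OF group.is_monoid[OF U_group_group], of A n B] assms by simp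

lemma frob_uconj_minus_one:
  assumes U: "U \<in> carrier (U_group n)" and A: "A \<in> carrier_mat n n"
  shows "frob (uconj U A - 1\<^sub>m n) = frob (A - 1\<^sub>m n)"
proof -
  note u = U_groupD[OF U]
  have c: "A - 1\<^sub>m n \<in> carrier_mat n n" by (simp add: minus_carrier_mat)
  have "uconj U A - 1\<^sub>m n = uconj U (A - 1\<^sub>m n)"
    using uconj_minus[OF U A, of "1\<^sub>m n"] uconj_one[OF U] by simp
  also have "frob \<dots> = frob (U * (A - 1\<^sub>m n))"
    unfolding uconj_def by (rule frob_mult_coisometry[of _ n n]) (use u c in auto)
  also have "\<dots> = frob (A - 1\<^sub>m n)" by (rule frob_isometry_mult[OF c u(1,3)])
  finally show ?thesis .
qed

text \<open>
  Up to a unitary factor, \<open>[A, B] - 1\<close> is \<open>A B - B A\<close>, and the latter is unchanged if \<open>1\<close> is subtracted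
  from \<open>A\<close> and from \<open>B\<close>.
\<close>

lemma frob_ucomm_minus_one_le:
  assumes A: "A \<in> carrier (U_group n)" and B: "B \<in> carrier (U_group n)"
  shows "frob (ucomm A B - 1\<^sub>m n) \<le> 2 * frob (A - 1\<^sub>m n) * frob (B - 1\<^sub>m n)"
proof -
  note a = U_groupD[OF A] and b = U_groupD[OF B]
  let ?a = "A - 1\<^sub>m n" and ?b = "B - 1\<^sub>m n"
  have c: "?a \<in> carrier_mat n n" "?b \<in> carrier_mat n n" by (simp_all add: minus_carrier_mat)
  let ?V = "mat_adjoint A * mat_adjoint B"
  have V: "?V \<in> carrier (U_group n)" by (rule U_group_closed[OF a(5) b(5)])
  note v = U_groupD[OF V]
  have cAB: "A * B \<in> carrier_mat n n" "B * A \<in> carrier_mat n n" using a(1) b(1) by auto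
  have one: "(B * A) * ?V = 1\<^sub>m n"
    by (rule mat_mult_middle[of _ n]) (use a b in auto)
  have "ucomm A B = (A * B) * ?V"
    unfolding ucomm_def by (rule sq_mat_laws(1)) (use a b cAB in auto)
  then have "ucomm A B - 1\<^sub>m n = (A * B - B * A) * ?V"
    using sq_mat_laws(5)[OF cAB v(1)] one by simp
  also have "frob \<dots> = frob (A * B - B * A)"
    by (rule frob_mult_coisometry[of _ n n]) (use v cAB in \<open>auto simp: minus_carrier_mat\<close>)
  also have "A * B - B * A = ?a * ?b - ?b * ?a"
  proof -
    have "(A - 1\<^sub>m n) * (B - 1\<^sub>m n) = A * B - B - (A - 1\<^sub>m n)"
      if "A \<in> carrier_mat n n" "B \<in> carrier_mat n n" for A B :: "complex mat"
      using that sq_mat_laws(4)[of "A - 1\<^sub>m n" n B "1\<^sub>m n"] sq_mat_laws(5)[of A n "1\<^sub>m n" B]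
      by (simp add: minus_carrier_mat)
    from this[OF a(1) b(1)] this[OF b(1) a(1)] show ?thesis
      using a(1) b(1) cAB by (intro eq_matI) (auto simp: minus_carrier_mat simp del: index_mult_mat(1))
  qed
  also have "frob \<dots> \<le> frob (?a * ?b) + frob (?b * ?a)"
    by (rule frob_triangle_minus[of _ n n]) (use c in auto)
  also have "\<dots> \<le> frob ?a * frob ?b + frob ?b * frob ?a"
    using frob_mult[OF c] frob_mult[OF c(2,1)] by linarith
  also have "\<dots> = 2 * frob ?a * frob ?b" by simp
  finally show ?thesis .
qed

text \<open>
  The hypothesis says that \<open>A\<close> commutes with \<open>B A B\<^sup>*\<close>. Hence the adjoint of \<open>E = A - B A B\<^sup>*\<close> commutes with \<open>A\<close>,
  and as \<open>E B = A B - B A\<close>, the trace of \<open>E\<^sup>* E B\<close> vanishes. So \<open>\<parallel>E\<parallel>\<^sup>2\<close> is, up to sign, the trace of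
  \<open>E\<^sup>* E (B - 1)\<close>, which is at most \<open>\<parallel>E\<parallel>\<^sup>2 \<parallel>B - 1\<parallel>\<close>. This forces \<open>E = 0\<close> if \<open>B\<close> is near \<open>1\<close>.
\<close>

lemma commute_if_commutes_with_commutator:
  assumes A: "A \<in> carrier (U_group n)" and B: "B \<in> carrier (U_group n)"
    and near: "frob (B - 1\<^sub>m n) < 1" and comm: "A * ucomm A B = ucomm A B * A"
  shows "A * B = B * A"
proof -
  note a = U_groupD[OF A] and b = U_groupD[OF B]
  define C where "C = uconj B (mat_adjoint A)"
  have cC: "C \<in> carrier_mat n n" unfolding C_def by (rule uconj_carrier[OF B a(2)])
  have X: "ucomm A B = A * C"
    unfolding ucomm_def C_def uconj_def using a(1,2) b(1,2)
    by (simp add: sq_mat_laws(1)[where n = n] mult_carrier_mat[of _ n n _ n])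
  have AC: "A * C = C * A"
  proof -
    have "mat_adjoint A * (A * (A * C)) = mat_adjoint A * ((A * C) * A)" using comm by (simp add: X)
    moreover have "mat_adjoint A * (A * (A * C)) = (mat_adjoint A * A) * (A * C)"
      by (rule sq_mat_laws(1)[symmetric]) (use a cC in auto)
    moreover have "mat_adjoint A * ((A * C) * A) = (mat_adjoint A * A) * (C * A)"
      using a(1,2) cC by (simp add: sq_mat_laws(1)[where n = n] mult_carrier_mat[of _ n n _ n])
    ultimately have "1\<^sub>m n * (A * C) = 1\<^sub>m n * (C * A)" unfolding a(3) by metis
    then show ?thesis using a(1) cC by simp
  qed
  define E where "E = A - uconj B A"
  have cA': "uconj B A \<in> carrier_mat n n" by (rule uconj_carrier[OF B a(1)])
  have cE: "E \<in> carrier_mat n n" unfolding E_def by (rule minus_carrier_mat[OF cA'])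
  note cE' = mat_adjoint_carrier[OF cE]
  have adjE: "mat_adjoint E = mat_adjoint A - C"
    unfolding E_def adjoint_minus[OF a(1) cA'] C_def uconj_adjoint[OF B a(1)] ..
  have commE: "A * mat_adjoint E = mat_adjoint E * A"
    unfolding adjE sq_mat_laws(4)[OF a(1,2) cC] sq_mat_laws(5)[OF a(2) cC a(1)]
    using a AC by simp
  have EB: "E * B = A * B - B * A"
  proof -
    have "uconj B A * B = B * A * (mat_adjoint B * B)"
      unfolding uconj_def by (rule sq_mat_laws(1)) (use a b in auto)
    then show ?thesis
      unfolding E_def sq_mat_laws(5)[OF a(1) cA' b(1)] using a b by simp
  qed
  have tr0: "mtrace (mat_adjoint E * (E * B)) = 0"
  proof -
    have "mat_adjoint E * (E * B) = mat_adjoint E * (A * B) - mat_adjoint E * (B * A)"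
      unfolding EB by (rule sq_mat_laws(4)) (use cE' a b in auto)
    moreover have "mtrace (mat_adjoint E * (B * A)) = mtrace (mat_adjoint E * (A * B))"
    proof -
      have "mtrace (mat_adjoint E * (B * A)) = mtrace ((mat_adjoint E * B) * A)"
        using sq_mat_laws(1)[OF cE' b(1) a(1)] by simp
      also have "\<dots> = mtrace (A * (mat_adjoint E * B))"
        by (rule mtrace_comm[of _ n n]) (use cE' a b in auto)
      also have "A * (mat_adjoint E * B) = mat_adjoint E * (A * B)"
        using sq_mat_laws(1)[OF a(1) cE' b(1)] sq_mat_laws(1)[OF cE' a(1) b(1)] commE by simp
      finally show ?thesis .
    qed
    ultimately show ?thesis
      using mtrace_minus[of "mat_adjoint E * (A * B)" n "mat_adjoint E * (B * A)"] cE' a b by simp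
  qed
  let ?b = "B - 1\<^sub>m n"
  have cb: "?b \<in> carrier_mat n n" by (simp add: minus_carrier_mat)
  have "E * ?b = E * B - E"
    using sq_mat_laws(4)[OF cE b(1), of "1\<^sub>m n"] cE by simp
  then have "mat_adjoint E * (E * ?b) = mat_adjoint E * (E * B) - mat_adjoint E * E"
    using sq_mat_laws(4)[OF cE' _ cE, of "E * B"] cE b by simp
  then have "mtrace (mat_adjoint E * (E * ?b)) = - mtrace (mat_adjoint E * E)"
    using mtrace_minus[of "mat_adjoint E * (E * B)" n "mat_adjoint E * E"] tr0 cE cE' b by simp
  also have "\<dots> = - of_real ((frob E)\<^sup>2)" unfolding frob_square_mtrace[OF cE] ..
  finally have "(frob E)\<^sup>2 = cmod (mtrace (mat_adjoint E * (E * ?b)))"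
    by (simp add: norm_power)
  also have "\<dots> \<le> frob (mat_adjoint E) * frob (E * ?b)"
    by (rule cmod_mtrace_mult_le[of _ n n]) (use cE cE' cb in auto)
  also have "\<dots> \<le> frob E * (frob E * frob ?b)"
    unfolding frob_adjoint[OF cE] by (intro mult_left_mono frob_mult[OF cE cb]) simp
  finally have "(frob E)\<^sup>2 * 1 \<le> (frob E)\<^sup>2 * frob ?b" by (simp add: power2_eq_square mult.assoc)
  then have "frob E = 0"
    using near by (metis frob_nonneg linorder_not_less mult_le_cancel_left_pos power2_less_eq_zero_iff
        zero_less_power2)
  then have "E = 0\<^sub>m n n" using frob_eq_0_iff[OF cE] by simp
  then have "A * B - B * A = 0\<^sub>m n n" using EB b(1) by simp
  then show ?thesis by (rule eq_if_minus_eq_zero[rotated 2]) (use a b in auto)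
qed

lemma scalar_matrix_commute:
  "scalar_matrix n X \<Longrightarrow> A \<in> carrier_mat n n \<Longrightarrow> A * X = X * A"
  using scalar_commute by (auto simp: scalar_matrix_def)

text \<open>
  The iterated commutators \<open>b (k + 1) = [A, b k]\<close>, \<open>b 0 = B\<close>, satisfy \<open>\<parallel>b (k + 1) - 1\<parallel> \<le> \<parallel>b k - 1\<parallel> / 2\<close>, so some
  \<open>b k\<close> is scalar and commutes with \<open>A\<close>; from \<open>b (k + 1)\<close> one descends to \<open>b k\<close> by
  \<open>commute_if_commutes_with_commutator\<close>.
\<close>

lemma near_identity_commute:
  assumes sub: "H \<subseteq> carrier (U_group n)"
    and comm_closed: "\<And>A B. A \<in> H \<Longrightarrow> B \<in> H \<Longrightarrow> ucomm A B \<in> H"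
    and \<delta>: "0 < \<delta>" and scal: "\<And>X. X \<in> H \<Longrightarrow> frob (X - 1\<^sub>m n) < \<delta> \<Longrightarrow> scalar_matrix n X"
    and A: "A \<in> H" "frob (A - 1\<^sub>m n) < 1 / 4" and B: "B \<in> H" "frob (B - 1\<^sub>m n) < 1 / 4"
  shows "A * B = B * A"
proof -
  define b where "b k = (ucomm A ^^ k) B" for k
  have b_Suc: "b (Suc k) = ucomm A (b k)" for k by (simp add: b_def)
  have bH: "b k \<in> H" for k
    by (induction k) (use A B comm_closed in \<open>auto simp: b_def\<close>)
  have b_near: "frob (b k - 1\<^sub>m n) \<le> (1 / 2) ^ k / 4" for k
  proof (induction k)
    case 0 then show ?case using B by (simp add: b_def)
  next
    case (Suc k)
    have "frob (b (Suc k) - 1\<^sub>m n) \<le> 2 * frob (A - 1\<^sub>m n) * frob (b k - 1\<^sub>m n)"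
      unfolding b_Suc by (rule frob_ucomm_minus_one_le) (use sub A bH in auto)
    also have "\<dots> \<le> (1 / 2) * ((1 / 2) ^ k / 4)"
      using Suc A(2) by (intro mult_mono) auto
    finally show ?case by simp
  qed
  obtain k where "(1 / 2 :: real) ^ k < \<delta>" using real_arch_pow_inv[OF \<delta>, of "1 / 2"] by auto
  moreover have "(1 / 2 :: real) ^ k / 4 \<le> (1 / 2) ^ k" by simp
  ultimately have "frob (b k - 1\<^sub>m n) < \<delta>" using b_near[of k] by linarith
  then have "scalar_matrix n (b k)" by (rule scal[OF bH])
  moreover have "A \<in> carrier_mat n n" using A sub by (auto simp: U_group_carrier)
  ultimately have "A * b k = b k * A" by (rule scalar_matrix_commute)
  then have "A * b 0 = b 0 * A"
  proof (induction k)
    case (Suc k)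
    have "(1 / 2 :: real) ^ k \<le> 1" by (simp add: power_le_one)
    then have "frob (b k - 1\<^sub>m n) < 1" using b_near[of k] by linarith
    then have "A * b k = b k * A"
      using commute_if_commutes_with_commutator[of A n "b k"] Suc.prems A bH sub by (auto simp: b_Suc)
    then show ?case by (rule Suc.IH)
  qed
  then show ?thesis by (simp add: b_def)
qed

section \<open>Discrete subgroups of \<open>PU(n)\<close>\<close>

lemma continuous_map_left_mult:
  assumes C: "C \<in> carrier (U_group n)"
  shows "continuous_map (U_topology n) (U_topology n) (\<lambda>A. C * A)"
proof -
  have cC: "C \<in> carrier_mat n n" using C by (simp add: U_group_carrier)
  have "continuous_map (U_topology n) (mat_topology n) (\<lambda>A. C * A)"
  proof (rule continuous_map_into_mat_topology)
    fix A assume "A \<in> topspace (U_topology n)"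
    then show "C * A \<in> carrier_mat n n" using cC by (simp add: topspace_U_topology U_group_carrier)
  next
    fix i j assume ij: "i < n" "j < n"
    have "continuous_map (U_topology n) euclidean (\<lambda>A. \<Sum>l<n. C $$ (i, l) * A $$ (l, j))"
      unfolding U_topology_def using ij
      by (intro continuous_map_sum continuous_map_euclidean_mult continuous_map_from_subtopology
          continuous_map_mat_entry) auto
    then show "continuous_map (U_topology n) euclidean (\<lambda>A. (C * A) $$ (i, j))"
    proof (rule continuous_map_eq)
      fix A assume "A \<in> topspace (U_topology n)"
      then have "A \<in> carrier_mat n n" by (simp add: topspace_U_topology U_group_carrier)
      from index_mat_mult_sum[OF cC this ij]
      show "(\<Sum>l<n. C $$ (i, l) * A $$ (l, j)) = (C * A) $$ (i, j)" by simp
    qed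
  qed
  moreover have "C * A \<in> carrier (U_group n)" if "A \<in> carrier (U_group n)" for A
    by (rule U_group_closed[OF C that])
  ultimately show ?thesis
    using topspace_U_topology[of n] by (auto simp: U_topology_def continuous_map_in_subtopology)
qed

lemma openin_left_mult:
  assumes "C \<in> carrier (U_group n)" "openin (U_topology n) W"
  shows "openin (U_topology n) {A \<in> carrier (U_group n). C * A \<in> W}"
  using openin_continuous_map_preimage[OF continuous_map_left_mult[OF assms(1)] assms(2)]
  by (simp add: topspace_U_topology)

lemma closedin_left_mult:
  assumes "C \<in> carrier (U_group n)" "closedin (U_topology n) W"
  shows "closedin (U_topology n) {A \<in> carrier (U_group n). C * A \<in> W}"
  using closedin_continuous_map_preimage[OF continuous_map_left_mult[OF assms(1)] assms(2)]
  by (simp add: topspace_U_topology)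

lemma openin_frob_ball:
  assumes "0 < \<epsilon>"
  shows "openin (U_topology n) {A \<in> carrier (U_group n). frob (A - 1\<^sub>m n) < \<epsilon>}"
proof -
  let ?f = "\<lambda>A. \<Sum>i<n. \<Sum>j<n. (cmod (A $$ (i, j) - 1\<^sub>m n $$ (i, j)))\<^sup>2"
  have "continuous_map (U_topology n) euclideanreal ?f"
    unfolding U_topology_def
    by (intro continuous_map_sum continuous_map_real_pow continuous_map_norm continuous_map_diff
        continuous_map_from_subtopology continuous_map_mat_entry) auto
  then have "openin (U_topology n) {A \<in> topspace (U_topology n). ?f A \<in> {..<\<epsilon>\<^sup>2}}"
    by (rule openin_continuous_map_preimage) simp
  moreover have "?f A \<in> {..<\<epsilon>\<^sup>2} \<longleftrightarrow> frob (A - 1\<^sub>m n) < \<epsilon>" if "A \<in> carrier (U_group n)" for A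
  proof -
    have cA: "A \<in> carrier_mat n n" using that by (simp add: U_group_carrier)
    have "?f A = (frob (A - 1\<^sub>m n))\<^sup>2"
      using cA by (subst frob_square[of _ n n]) (auto simp: minus_carrier_mat)
    moreover have "(frob (A - 1\<^sub>m n))\<^sup>2 < \<epsilon>\<^sup>2 \<longleftrightarrow> frob (A - 1\<^sub>m n) < \<epsilon>"
      using assms power2_less_imp_less[of "frob (A - 1\<^sub>m n)" \<epsilon>]
        power_strict_mono[of "frob (A - 1\<^sub>m n)" \<epsilon> 2] by auto
    ultimately show ?thesis by simp
  qed
  ultimately show ?thesis by (simp add: topspace_U_topology cong: conj_cong)
qed

text \<open>
  Otherwise a sequence outside \<open>W\<close> would converge to \<open>1\<close> in norm, hence entrywise, hence in the topology
  of the matrix space.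
\<close>

lemma open_nbhd_contains_frob_ball:
  assumes W: "openin (U_topology n) W" and one: "1\<^sub>m n \<in> W"
  obtains \<delta> where "0 < \<delta>" "\<And>A. A \<in> carrier (U_group n) \<Longrightarrow> frob (A - 1\<^sub>m n) < \<delta> \<Longrightarrow> A \<in> W"
proof -
  let ?I = "{..<n} \<times> {..<n}"
  let ?r = "\<lambda>A :: complex mat. \<lambda>ij\<in>?I. A $$ ij"
  let ?X = "product_topology (\<lambda>_. euclidean :: complex topology) ?I"
  obtain M where M: "openin (mat_topology n) M" "W = M \<inter> carrier (U_group n)"
    using W unfolding U_topology_def openin_subtopology by blast
  obtain Y where Y: "openin ?X Y" "M = ?r -` Y \<inter> carrier_mat n n"
    using M(1) unfolding mat_topology_def openin_pullback_topology by blast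
  have "\<exists>\<delta>>0. \<forall>A\<in>carrier (U_group n). frob (A - 1\<^sub>m n) < \<delta> \<longrightarrow> A \<in> W"
  proof (rule ccontr)
    assume no: "\<not> ?thesis"
    have "\<exists>A. A \<in> carrier (U_group n) \<and> frob (A - 1\<^sub>m n) < inverse (real (Suc k)) \<and> A \<notin> W" for k
      using no by (metis inverse_positive_iff_positive of_nat_0_less_iff zero_less_Suc)
    then obtain a where a: "\<And>k. a k \<in> carrier (U_group n)"
      "\<And>k. frob (a k - 1\<^sub>m n) < inverse (real (Suc k))" "\<And>k. a k \<notin> W" by metis
    have ca: "a k \<in> carrier_mat n n" for k using a(1) by (simp add: U_group_carrier)
    have lim: "(\<lambda>k. a k $$ (i, j)) \<longlonglongrightarrow> 1\<^sub>m n $$ (i, j)" if ij: "i < n" "j < n" for i j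
    proof (rule LIM_zero_cancel, rule tendsto_0_le[OF LIMSEQ_inverse_real_of_nat, where K = 1])
      show "\<forall>\<^sub>F k in sequentially. norm (a k $$ (i, j) - 1\<^sub>m n $$ (i, j)) \<le> norm (inverse (real (Suc k))) * 1"
      proof (rule always_eventually, rule allI)
        fix k
        have "cmod ((a k - 1\<^sub>m n) $$ (i, j)) \<le> frob (a k - 1\<^sub>m n)"
          unfolding frob_def by (rule member_le_L2_set) (use ij in auto)
        then show "norm (a k $$ (i, j) - 1\<^sub>m n $$ (i, j)) \<le> norm (inverse (real (Suc k))) * 1"
          using a(2)[of k] ij ca[of k] by simp
      qed
    qed
    have "limitin ?X (\<lambda>k. ?r (a k)) (?r (1\<^sub>m n)) sequentially"
      unfolding limitin_componentwise
    proof (intro conjI ballI)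
      fix ij assume "ij \<in> ?I"
      then show "limitin euclidean (\<lambda>c. ?r (a c) ij) (?r (1\<^sub>m n) ij) sequentially"
        using lim by auto
    qed auto
    moreover have "?r (1\<^sub>m n) \<in> Y" using one M(2) Y(2) by auto
    ultimately have "\<forall>\<^sub>F k in sequentially. ?r (a k) \<in> Y" using Y(1) by (auto simp: limitin_def)
    then obtain k where "?r (a k) \<in> Y" using eventually_sequentially by auto
    then have "a k \<in> W" using M(2) Y(2) ca a(1) by auto
    then show False using a(3) by blast
  qed
  then show ?thesis using that by blast
qed

lemma PU_class_mult:
  assumes "A \<in> carrier (U_group n)" "B \<in> carrier (U_group n)"
  shows "PU_class n (A * B) = PU_class n A \<otimes>\<^bsub>PU_group n\<^esub> PU_class n B"
  using hom_mult[OF PU_class_hom assms] by simp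

lemma PU_class_closed: "A \<in> carrier (U_group n) \<Longrightarrow> PU_class n A \<in> carrier (PU_group n)"
  using PU_class_hom by (auto simp: hom_def)

lemma PU_class_inv:
  assumes "A \<in> carrier (U_group n)"
  shows "PU_class n (mat_adjoint A) = inv\<^bsub>PU_group n\<^esub> (PU_class n A)"
  using group_hom.hom_inv[of "U_group n" "PU_group n" "PU_class n" A] U_group_inv[OF assms] assms
  by (simp add: group_hom_def group_hom_axioms_def U_group_group PU_group_group PU_class_hom)

lemma PU_class_eq_one_iff:
  assumes A: "A \<in> carrier (U_group n)"
  shows "PU_class n A = \<one>\<^bsub>PU_group n\<^esub> \<longleftrightarrow> A \<in> circle_scalars n"
proof -
  have sub: "subgroup (circle_scalars n) (U_group n)"
    using circle_scalars_normal by (rule normal_imp_subgroup)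
  have "\<one>\<^bsub>PU_group n\<^esub> = circle_scalars n" by (simp add: PU_group_def FactGroup_def)
  then show ?thesis
    unfolding PU_class_def
    using group.coset_join1[OF U_group_group _ A sub] group.coset_join2[OF U_group_group A sub] by auto
qed

lemma circle_scalars_iff:
  assumes A: "A \<in> carrier (U_group n)" and n: "0 < n"
  shows "A \<in> circle_scalars n \<longleftrightarrow> scalar_matrix n A"
proof
  assume "scalar_matrix n A"
  then obtain c where c: "A = c \<cdot>\<^sub>m 1\<^sub>m n" by (auto simp: scalar_matrix_def)
  have "A * mat_adjoint A = 1\<^sub>m n" using A by (simp add: U_group_carrier)
  then have "(c * cnj c) \<cdot>\<^sub>m 1\<^sub>m n = (1\<^sub>m n :: complex mat)"
    unfolding c mat_adjoint_smult_one
    by (simp add: mult_smult_distrib[of _ n n _ n] smult_smult_mat mult.commute)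
  then have "((c * cnj c) \<cdot>\<^sub>m 1\<^sub>m n) $$ (0, 0) = (1\<^sub>m n :: complex mat) $$ (0, 0)" by simp
  then have "c * cnj c = 1" using n by simp
  then have "(cmod c)\<^sup>2 = 1" by (metis complex_norm_square of_real_eq_1_iff)
  then have "cmod c = 1" by (simp add: power2_eq_1_iff) (smt (verit) norm_ge_zero)
  then show "A \<in> circle_scalars n" by (auto simp: circle_scalars_def c)
qed (auto simp: circle_scalars_def scalar_matrix_def)

text \<open>
  Left translation carries the neighbourhood of \<open>1\<close> to a neighbourhood of any other element of \<open>H\<close>.
\<close>

lemma discrete_if_trivial_near_one:
  assumes H: "subgroup H (PU_group n)" and V: "openin (PU_topology n) V" "\<one>\<^bsub>PU_group n\<^esub> \<in> V"
    and triv: "H \<inter> V \<subseteq> {\<one>\<^bsub>PU_group n\<^esub>}"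
  shows "discrete_subgroup (PU_topology n) (PU_group n) H"
proof -
  interpret PU: group "PU_group n" by (rule PU_group_group)
  have "openin (subtopology (PU_topology n) H) {h}" if h: "h \<in> H" for h
  proof -
    have hPU: "h \<in> carrier (PU_group n)" using subgroup.subset[OF H] h by blast
    then obtain B where B: "B \<in> carrier (U_group n)" "h = PU_class n B" by (auto simp: PU_group_carrier)
    define W where "W = {x \<in> carrier (PU_group n). inv\<^bsub>PU_group n\<^esub> h \<otimes>\<^bsub>PU_group n\<^esub> x \<in> V}"
    have eq: "{A \<in> carrier (U_group n). PU_class n A \<in> W}
        = {A \<in> carrier (U_group n). mat_adjoint B * A \<in> {A \<in> carrier (U_group n). PU_class n A \<in> V}}"
      using U_groupD(5)[OF B(1)] U_group_closed
      by (auto simp: W_def PU_class_closed B(2) PU_class_mult PU_class_inv[OF B(1)])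
    have V': "openin (U_topology n) {A \<in> carrier (U_group n). PU_class n A \<in> V}"
      using V(1) by (simp add: openin_PU_topology)
    have "openin (U_topology n) {A \<in> carrier (U_group n). PU_class n A \<in> W}"
      unfolding eq by (rule openin_left_mult[OF U_groupD(5)[OF B(1)] V'])
    then have "openin (PU_topology n) W"
      by (auto simp: openin_PU_topology W_def)
    moreover have "H \<inter> W = {h}"
    proof (intro equalityI subsetI)
      fix x assume x: "x \<in> H \<inter> W"
      have "inv\<^bsub>PU_group n\<^esub> h \<otimes>\<^bsub>PU_group n\<^esub> x \<in> H"
        using x h subgroup.m_closed[OF H subgroup.m_inv_closed[OF H h]] by blast
      then have "inv\<^bsub>PU_group n\<^esub> h \<otimes>\<^bsub>PU_group n\<^esub> x = \<one>\<^bsub>PU_group n\<^esub>"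
        using x triv by (auto simp: W_def)
      moreover have "x \<in> carrier (PU_group n)" using x by (simp add: W_def)
      ultimately have "x = h" using PU.inv_solve_left[of "\<one>\<^bsub>PU_group n\<^esub>" h x] hPU by simp
      then show "x \<in> {h}" by simp
    qed (use h hPU V(2) in \<open>auto simp: W_def\<close>)
    ultimately show ?thesis unfolding openin_subtopology by (metis inf_commute)
  qed
  moreover have "topspace (subtopology (PU_topology n) H) = H"
    using subgroup.subset[OF H] by (auto simp: topspace_PU_topology)
  ultimately have "discrete_topology H = subtopology (PU_topology n) H"
    by (simp add: discrete_topology_unique)
  then show ?thesis using H by (simp add: discrete_subgroup_def)
qed

lemma closedin_circle_scalars:
  assumes n: "0 < n"
  shows "closedin (U_topology n) (circle_scalars n)"
proof -
  \<comment> \<open>A matrix is scalar iff \<open>?f ij\<close> vanishes for all \<open>ij\<close>: off the diagonal this is the entry itself,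
      on the diagonal its difference from the first entry.\<close>
  let ?f = "\<lambda>ij A. A $$ ij - (if fst ij = snd ij then A $$ (0, 0) else (0 :: complex))"
  let ?I = "{..<n} \<times> {..<n}"
  let ?C = "\<lambda>ij. {A \<in> topspace (U_topology n). ?f ij A \<in> {0}}"
  have "closedin (U_topology n) (?C (i, j))" if "i < n" "j < n" for i j
  proof (rule closedin_continuous_map_preimage[where Y = euclidean])
    show "continuous_map (U_topology n) euclidean (?f (i, j))"
      using that n unfolding U_topology_def
      by (cases "i = j") (auto intro!: continuous_map_diff continuous_map_from_subtopology continuous_map_mat_entry)
  qed simp
  then have "closedin (U_topology n) (\<Inter>(?C ` ?I))"
    using n by (intro closedin_Inter) auto
  also have "\<Inter>(?C ` ?I) = circle_scalars n"
  proof (intro equalityI subsetI)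
    fix A assume "A \<in> circle_scalars n"
    moreover from this have "A \<in> carrier (U_group n)" using circle_scalars_subset by blast
    ultimately show "A \<in> \<Inter>(?C ` ?I)" using n
      by (auto simp: topspace_U_topology circle_scalars_def)
  next
    fix A assume A: "A \<in> \<Inter>(?C ` ?I)"
    then have AU: "A \<in> carrier (U_group n)" using n by (auto simp: topspace_U_topology)
    then have cA: "A \<in> carrier_mat n n" by (simp add: U_group_carrier)
    have "A = A $$ (0, 0) \<cdot>\<^sub>m 1\<^sub>m n"
    proof (rule eq_matI)
      fix i j assume "i < dim_row (A $$ (0, 0) \<cdot>\<^sub>m 1\<^sub>m n)" "j < dim_col (A $$ (0, 0) \<cdot>\<^sub>m 1\<^sub>m n)"
      then have ij: "i < n" "j < n" by auto
      then have "A \<in> ?C (i, j)" using A by blast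
      then show "A $$ (i, j) = (A $$ (0, 0) \<cdot>\<^sub>m 1\<^sub>m n) $$ (i, j)" using ij by (auto split: if_splits)
    qed (use cA in auto)
    then have "scalar_matrix n A" by (auto simp: scalar_matrix_def)
    then show "A \<in> circle_scalars n" using circle_scalars_iff[OF AU n] by simp
  qed
  finally show ?thesis .
qed

text \<open>
  Points of \<open>PU(n)\<close> are closed, since the scalar matrices are closed in \<open>U(n)\<close>. So removing the
  finitely many elements of \<open>H\<close> other than \<open>1\<close> leaves a neighbourhood of \<open>1\<close>.
\<close>

lemma finite_subgroup_discrete:
  assumes n: "0 < n" and H: "subgroup H (PU_group n)" and fin: "finite H"
  shows "discrete_subgroup (PU_topology n) (PU_group n) H"
proof (rule discrete_if_trivial_near_one[OF H])
  interpret PU: group "PU_group n" by (rule PU_group_group)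
  let ?V = "carrier (PU_group n) - (H - {\<one>\<^bsub>PU_group n\<^esub>})"
  have closed: "closedin (U_topology n) {A \<in> carrier (U_group n). PU_class n A = h}"
    if h: "h \<in> H" for h
  proof -
    have hPU: "h \<in> carrier (PU_group n)" using subgroup.subset[OF H] h by blast
    then obtain B where B: "B \<in> carrier (U_group n)" "h = PU_class n B" by (auto simp: PU_group_carrier)
    note b = U_groupD(5)[OF B(1)]
    have "PU_class n A = h \<longleftrightarrow> mat_adjoint B * A \<in> circle_scalars n" if A: "A \<in> carrier (U_group n)" for A
    proof -
      have "mat_adjoint B * A \<in> circle_scalars n \<longleftrightarrow>
          inv\<^bsub>PU_group n\<^esub> h \<otimes>\<^bsub>PU_group n\<^esub> PU_class n A = \<one>\<^bsub>PU_group n\<^esub>"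
        by (simp add: PU_class_eq_one_iff[OF U_group_closed[OF b A], symmetric] PU_class_mult[OF b A]
            PU_class_inv[OF B(1)] B(2))
      also have "\<dots> \<longleftrightarrow> PU_class n A = h"
        using PU.inv_solve_left[of "\<one>\<^bsub>PU_group n\<^esub>" h "PU_class n A"] PU_class_closed[OF A] hPU by auto
      finally show ?thesis by simp
    qed
    then have "{A \<in> carrier (U_group n). PU_class n A = h}
        = {A \<in> carrier (U_group n). mat_adjoint B * A \<in> circle_scalars n}" by blast
    then show ?thesis using closedin_left_mult[OF b closedin_circle_scalars[OF n]] by simp
  qed
  have "closedin (U_topology n) (\<Union>h\<in>H - {\<one>\<^bsub>PU_group n\<^esub>}. {A \<in> carrier (U_group n). PU_class n A = h})"
    by (rule closedin_Union) (use fin closed in auto)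
  then have "openin (U_topology n) (topspace (U_topology n)
      - (\<Union>h\<in>H - {\<one>\<^bsub>PU_group n\<^esub>}. {A \<in> carrier (U_group n). PU_class n A = h}))"
    by (simp add: openin_diff)
  also have "topspace (U_topology n)
      - (\<Union>h\<in>H - {\<one>\<^bsub>PU_group n\<^esub>}. {A \<in> carrier (U_group n). PU_class n A = h})
      = {A \<in> carrier (U_group n). PU_class n A \<in> ?V}"
    using PU_class_closed by (auto simp: topspace_U_topology)
  finally show "openin (PU_topology n) ?V" by (auto simp: openin_PU_topology)
qed (use group.is_monoid[OF PU_group_group, THEN monoid.one_closed] in auto)

text \<open>
  The preimage in \<open>U(n)\<close> is the union of the translates of the ball by scalar matrices.
\<close>

lemma openin_PU_frob_ball:
  assumes "0 < \<epsilon>"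
  shows "openin (PU_topology n) (PU_class n ` {A \<in> carrier (U_group n). frob (A - 1\<^sub>m n) < \<epsilon>})"
    (is "openin _ (_ ` ?B)")
proof -
  have "{A \<in> carrier (U_group n). PU_class n A \<in> PU_class n ` ?B}
      = (\<Union>s\<in>circle_scalars n. {A \<in> carrier (U_group n). s * A \<in> ?B})"
  proof (intro equalityI subsetI)
    fix A assume A: "A \<in> {A \<in> carrier (U_group n). PU_class n A \<in> PU_class n ` ?B}"
    then obtain B where B: "B \<in> ?B" "PU_class n A = PU_class n B" by blast
    have "B \<in> PU_class n B"
      using group.rcos_self[OF U_group_group _ normal_imp_subgroup[OF circle_scalars_normal], of B n] B
      by (simp add: PU_class_def)
    then have "B \<in> circle_scalars n #>\<^bsub>U_group n\<^esub> A" using B(2) by (simp add: PU_class_def)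
    then obtain s where "s \<in> circle_scalars n" "B = s * A" by (auto simp: r_coset_def)
    then show "A \<in> (\<Union>s\<in>circle_scalars n. {A \<in> carrier (U_group n). s * A \<in> ?B})" using A B by auto
  next
    fix A assume "A \<in> (\<Union>s\<in>circle_scalars n. {A \<in> carrier (U_group n). s * A \<in> ?B})"
    then obtain s where s: "s \<in> circle_scalars n" "A \<in> carrier (U_group n)" "s * A \<in> ?B" by blast
    have sU: "s \<in> carrier (U_group n)" using s circle_scalars_subset by blast
    have "PU_class n (s * A) = PU_class n A"
      using PU_class_mult[OF sU s(2)] PU_class_eq_one_iff[OF sU] s(1) PU_class_closed[OF s(2)]
        group.is_monoid[OF PU_group_group, THEN monoid.l_one] by metis
    then show "A \<in> {A \<in> carrier (U_group n). PU_class n A \<in> PU_class n ` ?B}"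
      using s by (metis (mono_tags, lifting) image_eqI mem_Collect_eq)
  qed
  moreover have "openin (U_topology n) (\<Union>s\<in>circle_scalars n. {A \<in> carrier (U_group n). s * A \<in> ?B})"
  proof (rule openin_Union)
    show "openin (U_topology n) X"
      if "X \<in> (\<lambda>s. {A \<in> carrier (U_group n). s * A \<in> ?B}) ` circle_scalars n" for X
      using that circle_scalars_subset openin_left_mult[OF _ openin_frob_ball[OF assms]] by blast
  qed
  ultimately show ?thesis using PU_class_closed by (auto simp: openin_PU_topology)
qed

section \<open>Nontrivial representations of small dimension\<close>

text \<open>
  An orthogonal projection is determined by its range, so this is the factorization that comes with an
  orthonormal basis of the range.
\<close>

lemma orth_proj_isometry:
  assumes P: "orth_proj n P"
  obtains r J where "J \<in> carrier_mat n r" "mat_adjoint J * J = 1\<^sub>m r" "J * mat_adjoint J = P"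
proof -
  note c = orth_projD[OF P]
  define W where "W = {v \<in> carrier_vec n. P *\<^sub>v v = v}"
  obtain r J where J: "J \<in> carrier_mat n r" "mat_adjoint J * J = 1\<^sub>m r"
    and range: "\<And>v. v \<in> carrier_vec n \<Longrightarrow> (J * mat_adjoint J) *\<^sub>v v = v \<longleftrightarrow> v \<in> W"
  proof (rule orthonormal_basis_of_subspace[of W n])
    show "W \<subseteq> carrier_vec n" "0\<^sub>v n \<in> W" using c(1) by (auto simp: W_def)
    show "v + w \<in> W" if "v \<in> W" "w \<in> W" for v w
      using that c(1) by (auto simp: W_def mult_add_distrib_mat_vec)
    show "a \<cdot>\<^sub>v v \<in> W" if "v \<in> W" for a v
      using that c(1) by (auto simp: W_def mult_mat_vec)
  qed blast
  let ?Q = "J * mat_adjoint J"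
  have Q: "orth_proj n ?Q" by (rule orth_proj_of_isometry(1)[OF J])
  note q = orth_projD[OF Q]
  have absorb: "A * B = B"
    if "orth_proj n A" "orth_proj n B" and sub: "\<And>v. v \<in> carrier_vec n \<Longrightarrow> B *\<^sub>v v = v \<Longrightarrow> A *\<^sub>v v = v" for A B
  proof (rule mat_eq_if_mult_vec_eq)
    note a = orth_projD[OF that(1)] and b = orth_projD[OF that(2)]
    show "A * B \<in> carrier_mat n n" "B \<in> carrier_mat n n" using a b by auto
    fix v :: "complex vec" assume v: "v \<in> carrier_vec n"
    have "B *\<^sub>v (B *\<^sub>v v) = B *\<^sub>v v" using assoc_mult_mat_vec[OF b(1,1) v] b(2) by simp
    then have "A *\<^sub>v (B *\<^sub>v v) = B *\<^sub>v v" using sub[of "B *\<^sub>v v"] b(1) v by simp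
    then show "A * B *\<^sub>v v = B *\<^sub>v v" using assoc_mult_mat_vec[OF a(1) b(1) v] by simp
  qed
  have "?Q * P = P" by (rule absorb[OF Q P]) (use range in \<open>auto simp: W_def\<close>)
  moreover have PQ: "P * ?Q = ?Q" by (rule absorb[OF P Q]) (use range in \<open>auto simp: W_def\<close>)
  then have "?Q * P = ?Q" using adjoint_mult[OF c(1) q(1)] c(3) q(3) by simp
  ultimately have "?Q = P" by simp
  then show ?thesis using that J by blast
qed

context unitary_rep
begin

text \<open>
  The representation on the range of \<open>P\<close>, written in the orthonormal basis formed by the columns of \<open>J\<close>.
\<close>

lemma compressed_rep:
  assumes P: "orth_proj n P" and comm: "\<And>g. g \<in> carrier G \<Longrightarrow> \<rho> g * P = P * \<rho> g"
    and J: "J \<in> carrier_mat n r" "mat_adjoint J * J = 1\<^sub>m r" "J * mat_adjoint J = P"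
  defines "\<sigma> \<equiv> \<lambda>g. mat_adjoint J * \<rho> g * J"
  shows "\<sigma> \<in> hom G (U_group r)" "\<And>g. g \<in> carrier G \<Longrightarrow> \<sigma> g = 1\<^sub>m r \<Longrightarrow> \<rho> g * P = P"
proof -
  note c = orth_projD[OF P] and j = mat_adjoint_carrier[OF J(1)]
  have \<sigma>c: "\<sigma> g \<in> carrier_mat r r" if "g \<in> carrier G" for g
    using J j rep_carrier[OF that] by (simp add: \<sigma>_def mult_carrier_mat[of _ r n])
  have JP: "mat_adjoint J * P = mat_adjoint J"
  proof -
    have "mat_adjoint J * (J * mat_adjoint J) = mat_adjoint J * J * mat_adjoint J"
      using J(1) j by (simp add: assoc_mult_mat[of _ r n _ r _ n])
    then show ?thesis using J j by simp
  qed
  note rect_assoc = assoc_mult_mat[of _ r n _ r _ r] assoc_mult_mat[of _ r n _ n _ r] assoc_mult_mat[of _ r r _ n _ r]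
    assoc_mult_mat[of _ n n _ r _ r] assoc_mult_mat[of _ n n _ r _ n] assoc_mult_mat[of _ n r _ n _ r]
    assoc_mult_mat[of _ n r _ r _ n] assoc_mult_mat[of _ n r _ n _ n] assoc_mult_mat[of _ n n _ n _ n]
    assoc_mult_mat[of _ n n _ n _ r] assoc_mult_mat[of _ r n _ n _ n] assoc_mult_mat[of _ r n _ r _ n]
    mult_carrier_mat[of _ n n] mult_carrier_mat[of _ n r] mult_carrier_mat[of _ r n]
  have \<sigma>_mult: "\<sigma> g * \<sigma> h = \<sigma> (g \<otimes> h)" if g: "g \<in> carrier G" and h: "h \<in> carrier G" for g h
  proof -
    note cg = rep_carrier[OF g] and ch = rep_carrier[OF h]
    have "\<sigma> g * \<sigma> h = mat_adjoint J * (\<rho> g * (J * mat_adjoint J) * \<rho> h) * J"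
      using J(1) j cg ch unfolding \<sigma>_def by (simp add: rect_assoc)
    also have "\<rho> g * (J * mat_adjoint J) * \<rho> h = P * \<rho> (g \<otimes> h)"
      unfolding J(3) comm[OF g] rep_mult[OF g h] using c cg ch by (simp add: sq_mat_laws(1)[where n = n])
    also have "mat_adjoint J * (P * \<rho> (g \<otimes> h)) = mat_adjoint J * P * \<rho> (g \<otimes> h)"
      using j c(1) rep_carrier[OF m_closed[OF g h]] by (simp add: assoc_mult_mat[of _ r n _ n _ n])
    finally show ?thesis by (simp add: \<sigma>_def JP)
  qed
  have \<sigma>_one: "\<sigma> \<one> = 1\<^sub>m r" using J j by (simp add: \<sigma>_def rep_one)
  have \<sigma>_adj: "mat_adjoint (\<sigma> g) = \<sigma> (inv g)" if g: "g \<in> carrier G" for g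
  proof -
    note cg = rep_carrier[OF g]
    have "mat_adjoint (\<sigma> g) = mat_adjoint J * (mat_adjoint (\<rho> g) * J)"
      unfolding \<sigma>_def adjoint_mult[OF mult_carrier_mat[OF j cg] J(1)] adjoint_mult[OF j cg]
        adjoint_adjoint[OF J(1)] ..
    then show ?thesis
      using J(1) j mat_adjoint_carrier[OF cg]
      by (simp add: \<sigma>_def rep_inv[OF g] assoc_mult_mat[of _ r n _ n _ r])
  qed
  have "\<sigma> g \<in> carrier (U_group r)" if g: "g \<in> carrier G" for g
    using \<sigma>c[OF g] \<sigma>_mult[OF g inv_closed[OF g]] \<sigma>_mult[OF inv_closed[OF g] g] g
    by (simp add: U_group_carrier \<sigma>_adj[OF g] \<sigma>_one)
  then show "\<sigma> \<in> hom G (U_group r)" using \<sigma>_mult by (auto simp: hom_def)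
  show "\<rho> g * P = P" if g: "g \<in> carrier G" and triv: "\<sigma> g = 1\<^sub>m r" for g
  proof -
    note cg = rep_carrier[OF g]
    have "\<rho> g * P = P * \<rho> g * P"
      using comm[OF g] c cg sq_mat_laws(1)[OF cg c(1,1)] by simp
    also have "\<dots> = J * \<sigma> g * mat_adjoint J"
      unfolding J(3)[symmetric] \<sigma>_def using J(1) j cg by (simp add: rect_assoc)
    also have "\<dots> = P" unfolding triv using J by simp
    finally show ?thesis .
  qed
qed

text \<open>
  The representation is the sum of its compressions to \<open>W\<close> and to the orthogonal complement of \<open>W\<close>, and
  these cannot both be trivial.
\<close>

lemma reducible_imp_smaller_rep:
  assumes nontriv: "\<exists>g\<in>carrier G. \<rho> g \<noteq> 1\<^sub>m n"
    and W: "VectorSpace.subspace class_ring W (module_vec TYPE(complex) n)"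
    and inv: "\<And>g w. g \<in> carrier G \<Longrightarrow> w \<in> W \<Longrightarrow> \<rho> g *\<^sub>v w \<in> W"
    and proper: "W \<noteq> {0\<^sub>v n}" "W \<noteq> carrier_vec n"
  shows "\<exists>m<n. \<exists>\<sigma>\<in>hom G (U_group m). \<exists>g\<in>carrier G. \<sigma> g \<noteq> 1\<^sub>m m"
proof -
  note sub = subspace_of_vectorsD[OF W]
  obtain r J where J: "J \<in> carrier_mat n r" "mat_adjoint J * J = 1\<^sub>m r"
    and range: "\<And>v. v \<in> carrier_vec n \<Longrightarrow> (J * mat_adjoint J) *\<^sub>v v = v \<longleftrightarrow> v \<in> W"
    using orthonormal_basis_of_subspace[OF sub] by metis
  define P where "P = J * mat_adjoint J"
  have P: "orth_proj n P" unfolding P_def by (rule orth_proj_of_isometry(1)[OF J])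
  note c = orth_projD[OF P]
  have comm: "\<rho> g * P = P * \<rho> g" if g: "g \<in> carrier G" for g
  proof (rule orth_proj_commute_if_range_invariant[OF P rep_carrier[OF g]])
    have keep: "P *\<^sub>v (\<rho> h *\<^sub>v v) = \<rho> h *\<^sub>v v"
      if "h \<in> carrier G" "v \<in> carrier_vec n" "P *\<^sub>v v = v" for h v
      using inv[OF that(1), of v] range[of v] range[of "\<rho> h *\<^sub>v v"] that rep_carrier[OF that(1)]
      by (simp add: P_def)
    show "P *\<^sub>v (\<rho> g *\<^sub>v v) = \<rho> g *\<^sub>v v" if "v \<in> carrier_vec n" "P *\<^sub>v v = v" for v
      by (rule keep[OF g that])
    show "P *\<^sub>v (mat_adjoint (\<rho> g) *\<^sub>v v) = mat_adjoint (\<rho> g) *\<^sub>v v" if "v \<in> carrier_vec n" "P *\<^sub>v v = v" for v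
      using keep[OF inv_closed[OF g] that] by (simp add: rep_inv[OF g])
  qed
  define Q where "Q = 1\<^sub>m n - P"
  have Q: "orth_proj n Q" unfolding Q_def by (rule orth_proj_complement[OF P])
  have cQ: "Q \<in> carrier_mat n n" by (rule orth_projD(1)[OF Q])
  have commQ: "\<rho> g * Q = Q * \<rho> g" if g: "g \<in> carrier G" for g
    unfolding Q_def
    using sq_mat_laws(4)[OF rep_carrier[OF g] _ c(1), of "1\<^sub>m n"]
      sq_mat_laws(5)[OF _ c(1) rep_carrier[OF g], of "1\<^sub>m n"] comm[OF g] rep_carrier[OF g] by simp
  have P0: "P \<noteq> 0\<^sub>m n n"
  proof
    assume *: "P = 0\<^sub>m n n"
    have "W \<subseteq> {0\<^sub>v n}"
    proof
      fix w assume w: "w \<in> W"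
      then have "w \<in> carrier_vec n" using sub(1) by auto
      then show "w \<in> {0\<^sub>v n}" using range[of w] w zero_mat_mult_vec[of w n n] by (simp add: P_def[symmetric] *)
    qed
    then show False using proper(1) sub(2) by blast
  qed
  have P1: "P \<noteq> 1\<^sub>m n"
  proof
    assume *: "P = 1\<^sub>m n"
    have "carrier_vec n \<subseteq> W" using range by (auto simp: P_def[symmetric] *)
    then show False using proper(2) sub(1) by blast
  qed
  have Q0: "Q \<noteq> 0\<^sub>m n n"
    using eq_if_minus_eq_zero[OF one_carrier_mat c(1)] P1 by (auto simp: Q_def)
  have frob: "(frob Q)\<^sup>2 = real n - (frob P)\<^sup>2"
    using frob_square_orth_proj_minus[OF orth_proj_one P orth_proj_complement[OF P]]
    by (simp add: frob_square_one Q_def)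
  obtain g where g: "g \<in> carrier G" "\<rho> g \<noteq> 1\<^sub>m n" using nontriv by blast
  note cg = rep_carrier[OF g(1)]
  have "\<rho> g * P \<noteq> P \<or> \<rho> g * Q \<noteq> Q"
  proof (rule ccontr)
    assume "\<not> ?thesis"
    moreover have "\<rho> g * Q = \<rho> g - \<rho> g * P"
      unfolding Q_def using sq_mat_laws(4)[OF cg _ c(1), of "1\<^sub>m n"] cg by simp
    ultimately have *: "\<rho> g - P = Q" "\<rho> g * P = P" by auto
    have "\<rho> g = 1\<^sub>m n"
    proof (rule eq_matI)
      fix i j assume ij: "i < dim_row (1\<^sub>m n :: complex mat)" "j < dim_col (1\<^sub>m n :: complex mat)"
      have "(\<rho> g - P) $$ (i, j) = (1\<^sub>m n - P) $$ (i, j)" using *(1) by (simp add: Q_def)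
      then show "\<rho> g $$ (i, j) = 1\<^sub>m n $$ (i, j)" using ij cg c(1) by simp
    qed (use cg in auto)
    then show False using g(2) by simp
  qed
  moreover have "\<exists>m<n. \<exists>\<sigma>\<in>hom G (U_group m). \<exists>g\<in>carrier G. \<sigma> g \<noteq> 1\<^sub>m m"
    if R: "orth_proj n R" "\<And>g. g \<in> carrier G \<Longrightarrow> \<rho> g * R = R * \<rho> g" "(frob R)\<^sup>2 < n" "\<rho> g * R \<noteq> R" for R
  proof -
    obtain r J where J: "J \<in> carrier_mat n r" "mat_adjoint J * J = 1\<^sub>m r" "J * mat_adjoint J = R"
      using orth_proj_isometry[OF R(1)] by blast
    have "r < n" using orth_proj_of_isometry(2)[OF J(1,2)] R(3) by (simp add: J(3))
    moreover have "(\<lambda>g. mat_adjoint J * \<rho> g * J) \<in> hom G (U_group r)"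
      by (rule compressed_rep(1)[OF R(1) _ J]) (rule R(2))
    moreover have "mat_adjoint J * \<rho> g * J \<noteq> 1\<^sub>m r"
      using compressed_rep(2)[OF R(1) _ J, of g] R(2,4) g(1) by auto
    ultimately show ?thesis using g(1) by (intro exI[of _ r] conjI bexI[of _ "\<lambda>g. mat_adjoint J * \<rho> g * J"] bexI[of _ g])
  qed
  moreover have "(frob P)\<^sup>2 < n" "(frob Q)\<^sup>2 < n"
    using frob orth_proj_frob_ge_1[OF P P0] orth_proj_frob_ge_1[OF Q Q0] by linarith+
  ultimately show ?thesis using P Q comm commQ by blast
qed

end

lemma U_group_hom_GL:
  assumes "\<sigma> \<in> hom G (U_group n)"
  shows "\<sigma> \<in> hom G (GL_group n)"
proof -
  have "A \<in> carrier (GL_group n)" if "A \<in> carrier (U_group n)" for A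
    using that by (auto simp: U_group_carrier GL_group_def units_of_def
        Units_def ring_mat_def intro: mat_adjoint_carrier)
  with assms show ?thesis
    by (auto simp: hom_def Pi_def GL_group_def units_of_def ring_mat_def)
qed

text \<open>
  Passing to smaller non-trivial representations must end, and it ends at an irreducible one.
\<close>

lemma nontrivial_irreducible_of_smaller_dimension:
  assumes G: "group G" "finite (carrier G)"
    and \<sigma>: "\<sigma> \<in> hom G (U_group m)" "\<exists>g\<in>carrier G. \<sigma> g \<noteq> 1\<^sub>m m"
  shows "\<exists>k\<le>m. \<exists>\<tau>. irreducible_rep G k \<tau> \<and> nontrivial_rep G k \<tau>"
  using \<sigma>
proof (induction m arbitrary: \<sigma> rule: less_induct)
  case (less m)
  interpret unitary_rep G m \<sigma>
    using G less.prems(1) by (simp add: unitary_rep_def unitary_rep_axioms_def)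
  show ?case
  proof (cases "irreducible_rep G m \<sigma>")
    case True
    then show ?thesis using less.prems(2) by (auto simp: nontrivial_rep_def)
  next
    case False
    have "0 < m"
    proof (rule ccontr)
      assume "\<not> 0 < m"
      then have "\<sigma> g = 1\<^sub>m m" if "g \<in> carrier G" for g
        using rep_carrier[OF that] by (intro eq_matI) auto
      then show False using less.prems(2) by blast
    qed
    then obtain W where W: "VectorSpace.subspace class_ring W (module_vec TYPE(complex) m)"
      "\<And>g w. g \<in> carrier G \<Longrightarrow> w \<in> W \<Longrightarrow> \<sigma> g *\<^sub>v w \<in> W" "W \<noteq> {0\<^sub>v m}" "W \<noteq> carrier_vec m"
      using False U_group_hom_GL[OF less.prems(1)] unfolding irreducible_rep_def by blast
    obtain k \<tau> where "k < m" "\<tau> \<in> hom G (U_group k)" "\<exists>g\<in>carrier G. \<tau> g \<noteq> 1\<^sub>m k"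
      using reducible_imp_smaller_rep[OF less.prems(2) W] by blast
    then show ?thesis using less.IH[of k \<tau>] by (meson less_imp_le order_trans)
  qed
qed

text \<open>
  The permutation representation of dimension \<open>n\<close> preserves the constant vectors \<open>W\<close>, which form a proper
  subspace, since a non-trivial homomorphism to \<open>Sym(n)\<close> forces \<open>n \<ge> 2\<close>. Matrix indices start at \<open>0\<close> and
  letters at \<open>1\<close>, hence the successors.
\<close>

lemma sym_group_hom_imp_small_irreducible:
  assumes G: "group G" "finite (carrier G)"
    and \<phi>: "\<phi> \<in> hom G (sym_group n)" "\<exists>g\<in>carrier G. \<phi> g \<noteq> \<one>\<^bsub>sym_group n\<^esub>"
  shows "\<exists>k<n. \<exists>\<tau>. irreducible_rep G k \<tau> \<and> nontrivial_rep G k \<tau>"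
proof -
  interpret group G by (rule G)
  have perm: "\<phi> g permutes {1..n}" if "g \<in> carrier G" for g
    using \<phi>(1) that by (auto simp: hom_def sym_group_def)
  have \<phi>_mult: "\<phi> (g \<otimes>\<^bsub>G\<^esub> h) = \<phi> g \<circ> \<phi> h" if "g \<in> carrier G" "h \<in> carrier G" for g h
    using \<phi>(1) that by (auto simp: hom_def sym_group_def)
  have \<phi>_one: "\<phi> \<one>\<^bsub>G\<^esub> = id"
    using group_hom.hom_one[of G "sym_group n" \<phi>] \<phi>(1)
    by (simp add: group_hom_def group_hom_axioms_def sym_group_is_group is_group sym_group_one)
  define \<sigma> where "\<sigma> g = mat n n (\<lambda>(i, j). if \<phi> g (Suc j) = Suc i then 1 else 0 :: complex)" for g
  have \<sigma>c: "\<sigma> g \<in> carrier_mat n n" for g by (simp add: \<sigma>_def)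
  have ran: "\<exists>l<n. \<phi> g (Suc j) = Suc l" if "g \<in> carrier G" "j < n" for g j
  proof -
    have "\<phi> g (Suc j) \<in> {1..n}" using permutes_in_image[OF perm[OF that(1)], of "Suc j"] that(2) by simp
    then show ?thesis by (intro exI[of _ "\<phi> g (Suc j) - 1"]) auto
  qed
  have \<sigma>_mult: "\<sigma> (g \<otimes>\<^bsub>G\<^esub> h) = \<sigma> g * \<sigma> h" if g: "g \<in> carrier G" and h: "h \<in> carrier G" for g h
  proof (rule eq_matI)
    fix i j assume "i < dim_row (\<sigma> g * \<sigma> h)" "j < dim_col (\<sigma> g * \<sigma> h)"
    then have ij: "i < n" "j < n" using \<sigma>c[of g] \<sigma>c[of h] by auto
    obtain l where l: "l < n" "\<phi> h (Suc j) = Suc l" using ran[OF h ij(2)] by blast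
    have "(\<sigma> g * \<sigma> h) $$ (i, j) = (\<Sum>k<n. \<sigma> g $$ (i, k) * \<sigma> h $$ (k, j))"
      by (rule index_mat_mult_sum[OF \<sigma>c \<sigma>c ij])
    also have "\<dots> = (\<Sum>k<n. if k = l then \<sigma> g $$ (i, l) else 0)"
      using ij l by (intro sum.cong) (auto simp: \<sigma>_def)
    also have "\<dots> = \<sigma> g $$ (i, l)" using l by simp
    also have "\<dots> = \<sigma> (g \<otimes>\<^bsub>G\<^esub> h) $$ (i, j)" using ij l \<phi>_mult[OF g h] by (simp add: \<sigma>_def)
    finally show "\<sigma> (g \<otimes>\<^bsub>G\<^esub> h) $$ (i, j) = (\<sigma> g * \<sigma> h) $$ (i, j)" by simp
  qed (simp_all add: \<sigma>_def)
  have \<sigma>_one: "\<sigma> \<one>\<^bsub>G\<^esub> = 1\<^sub>m n" by (rule eq_matI) (auto simp: \<sigma>_def \<phi>_one)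
  have \<sigma>_adj: "mat_adjoint (\<sigma> g) = \<sigma> (inv\<^bsub>G\<^esub> g)" if g: "g \<in> carrier G" for g
  proof (rule eq_matI)
    fix i j assume "i < dim_row (\<sigma> (inv\<^bsub>G\<^esub> g))" "j < dim_col (\<sigma> (inv\<^bsub>G\<^esub> g))"
    then have ij: "i < n" "j < n" by (auto simp: \<sigma>_def)
    have "\<phi> g \<circ> \<phi> (inv\<^bsub>G\<^esub> g) = id" "\<phi> (inv\<^bsub>G\<^esub> g) \<circ> \<phi> g = id"
      using \<phi>_mult[OF g inv_closed[OF g]] \<phi>_mult[OF inv_closed[OF g] g] g \<phi>_one by auto
    then have "\<phi> g (Suc i) = Suc j \<longleftrightarrow> \<phi> (inv\<^bsub>G\<^esub> g) (Suc j) = Suc i"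
      by (metis comp_apply id_apply)
    then show "mat_adjoint (\<sigma> g) $$ (i, j) = \<sigma> (inv\<^bsub>G\<^esub> g) $$ (i, j)"
      using mat_adjoint_index[OF \<sigma>c ij, of g] ij by (simp add: \<sigma>_def)
  qed (use mat_adjoint_carrier[OF \<sigma>c[of g]] in \<open>auto simp: \<sigma>_def\<close>)
  have "\<sigma> g \<in> carrier (U_group n)" if g: "g \<in> carrier G" for g
    using \<sigma>c[of g] \<sigma>_mult[OF g inv_closed[OF g]] \<sigma>_mult[OF inv_closed[OF g] g] g
    by (simp add: U_group_carrier \<sigma>_adj[OF g] \<sigma>_one)
  then have hom: "\<sigma> \<in> hom G (U_group n)" using \<sigma>_mult by (auto simp: hom_def)
  interpret unitary_rep G n \<sigma>
    using G hom by (simp add: unitary_rep_def unitary_rep_axioms_def)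
  obtain g where g: "g \<in> carrier G" "\<phi> g \<noteq> id" using \<phi>(2) by (auto simp: sym_group_one)
  obtain x where x: "\<phi> g x \<noteq> x" using g(2) by (auto simp: fun_eq_iff)
  have xn: "x \<in> {1..n}" using x permutes_not_in[OF perm[OF g(1)]] by metis
  have "\<phi> g x \<in> {1..n}" using permutes_in_image[OF perm[OF g(1)]] xn by blast
  then have n: "2 \<le> n" using x xn by auto
  have "\<sigma> g $$ (x - 1, x - 1) = 0" using x xn by (auto simp: \<sigma>_def)
  then have nontriv: "\<sigma> g \<noteq> 1\<^sub>m n" using xn by auto
  define W where "W = range (\<lambda>c. vec n (\<lambda>_. c :: complex))"
  have "\<exists>k<n. \<exists>\<sigma>\<in>hom G (U_group k). \<exists>g\<in>carrier G. \<sigma> g \<noteq> 1\<^sub>m k"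
  proof (rule reducible_imp_smaller_rep)
    show "\<exists>g\<in>carrier G. \<sigma> g \<noteq> 1\<^sub>m n" using g nontriv by blast
    show "VectorSpace.subspace class_ring W (module_vec TYPE(complex) n)"
    proof (rule subspace_of_vectorsI)
      show "W \<subseteq> carrier_vec n" by (auto simp: W_def)
      show "0\<^sub>v n \<in> W" unfolding W_def by (rule image_eqI[of _ _ 0]) auto
      show "v + w \<in> W" if "v \<in> W" "w \<in> W" for v w
      proof -
        obtain a b where "v = vec n (\<lambda>_. a)" "w = vec n (\<lambda>_. b)" using \<open>v \<in> W\<close> \<open>w \<in> W\<close> by (auto simp: W_def)
        then have "v + w = vec n (\<lambda>_. a + b)" by auto
        then show ?thesis by (auto simp: W_def)
      qed
      show "a \<cdot>\<^sub>v v \<in> W" if v: "v \<in> W" for a v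
      proof -
        obtain b where "v = vec n (\<lambda>_. b)" using v by (auto simp: W_def)
        then have "a \<cdot>\<^sub>v v = vec n (\<lambda>_. a * b)" by auto
        then show ?thesis by (auto simp: W_def)
      qed
    qed
    show "\<sigma> h *\<^sub>v w \<in> W" if h: "h \<in> carrier G" and w: "w \<in> W" for h w
    proof -
      obtain c where c: "w = vec n (\<lambda>_. c)" using w by (auto simp: W_def)
      have "\<sigma> h *\<^sub>v w = w"
      proof (rule eq_vecI)
        fix i assume "i < dim_vec w"
        then have i: "i < n" by (simp add: c)
        obtain l where l: "l < n" "\<phi> (inv\<^bsub>G\<^esub> h) (Suc i) = Suc l" using ran[OF inv_closed[OF h] i] by blast
        have "\<phi> h \<circ> \<phi> (inv\<^bsub>G\<^esub> h) = id" "\<phi> (inv\<^bsub>G\<^esub> h) \<circ> \<phi> h = id"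
          using \<phi>_mult[OF h inv_closed[OF h]] \<phi>_mult[OF inv_closed[OF h] h] h \<phi>_one by auto
        then have eq: "\<phi> h (Suc j) = Suc i \<longleftrightarrow> j = l" for j
          using l(2) by (metis comp_apply id_apply nat.inject)
        have "(\<sigma> h *\<^sub>v w) $ i = (\<Sum>j<n. \<sigma> h $$ (i, j) * w $ j)"
          by (rule index_mat_vec_sum[OF \<sigma>c _ i]) (simp add: c)
        also have "\<dots> = (\<Sum>j<n. if j = l then c else 0)"
          using i by (intro sum.cong) (auto simp: \<sigma>_def c eq)
        finally show "(\<sigma> h *\<^sub>v w) $ i = w $ i" using i l by (simp add: c)
      qed (simp add: c \<sigma>_def)
      then show ?thesis using w by simp
    qed
    show "W \<noteq> {0\<^sub>v n}"
    proof
      assume "W = {0\<^sub>v n}"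
      then have "vec n (\<lambda>_. 1) = (0\<^sub>v n :: complex vec)" by (auto simp: W_def)
      then have "vec n (\<lambda>_. 1) $ 0 = (0\<^sub>v n :: complex vec) $ 0" by simp
      then show False using n by simp
    qed
    show "W \<noteq> carrier_vec n"
    proof
      assume "W = carrier_vec n"
      then have "unit_vec n 0 \<in> W" by simp
      then obtain c :: complex where c: "unit_vec n 0 = vec n (\<lambda>_. c)" by (auto simp: W_def)
      have "unit_vec n 0 $ 0 = c" "unit_vec n 0 $ 1 = c" using n by (simp_all only: c index_vec)
      then show False using n by (simp add: unit_vec_def)
    qed
  qed
  then show ?thesis
    using nontrivial_irreducible_of_smaller_dimension[OF G] by (meson le_less_trans)
qed

section \<open>Uniform discreteness and maximal discrete subgroups\<close>

text \<open>
  The neighbourhood is the image of the ball of radius \<open>1/4\<close>. For a discrete \<open>H\<close> containing the image of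
  \<open>G\<close>, the part \<open>S\<close> of its preimage in this ball is commuting and invariant, so a non-scalar
  member of \<open>S\<close> would give a torus.
\<close>

lemma uniformly_discrete_of_no_torus:
  assumes "irreducible_unitary_rep G n \<rho>" and SU: "\<rho> ` carrier G \<subseteq> carrier (SU_group n)"
    and no_torus: "\<not> normalizes_nontrivial_torus n (\<rho> ` carrier G)"
  shows "uniformly_discrete (PU_topology n) (PU_group n)
    {H. discrete_subgroup (PU_topology n) (PU_group n) H \<and> (PU_class n \<circ> \<rho>) ` carrier G \<subseteq> H}"
proof -
  interpret irreducible_unitary_rep G n \<rho> by fact
  interpret PU: group "PU_group n" by (rule PU_group_group)
  let ?V = "PU_class n ` {A \<in> carrier (U_group n). frob (A - 1\<^sub>m n) < 1 / 4}"
  have one: "PU_class n (1\<^sub>m n) = \<one>\<^bsub>PU_group n\<^esub>"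
    using group_hom.hom_one[of "U_group n" "PU_group n" "PU_class n"]
    by (simp add: group_hom_def group_hom_axioms_def U_group_group PU_group_group PU_class_hom)
  have frob_one: "frob (1\<^sub>m n - 1\<^sub>m n) = 0" using frob_eq_0_iff[OF minus_carrier_mat[OF one_carrier_mat], of "1\<^sub>m n" n] by simp
  have one_U: "1\<^sub>m n \<in> carrier (U_group n)" by (simp add: U_group_carrier mat_adjoint_one)
  have oneV: "\<one>\<^bsub>PU_group n\<^esub> \<in> ?V"
    using one one_U frob_one by (intro image_eqI[of _ _ "1\<^sub>m n"]) auto
  have "H \<inter> ?V = {\<one>\<^bsub>PU_group n\<^esub>}"
    if disc: "discrete_subgroup (PU_topology n) (PU_group n) H" and sub: "(PU_class n \<circ> \<rho>) ` carrier G \<subseteq> H" for H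
  proof -
    have H: "subgroup H (PU_group n)" and top: "subtopology (PU_topology n) H = discrete_topology H"
      using disc by (auto simp: discrete_subgroup_def)
    define H' where "H' = {A \<in> carrier (U_group n). PU_class n A \<in> H}"
    have H'_mult: "A * B \<in> H'" if "A \<in> H'" "B \<in> H'" for A B
      using that U_group_closed subgroup.m_closed[OF H] by (auto simp: H'_def PU_class_mult)
    have H'_adj: "mat_adjoint A \<in> H'" if "A \<in> H'" for A
      using that U_groupD(5) subgroup.m_inv_closed[OF H] by (auto simp: H'_def PU_class_inv)
    have H'_rep: "\<rho> g \<in> H'" if "g \<in> carrier G" for g
      using sub rep_closed[OF that] that by (auto simp: H'_def)
    obtain \<delta> where \<delta>: "0 < \<delta>" and scal: "\<And>X. X \<in> H' \<Longrightarrow> frob (X - 1\<^sub>m n) < \<delta> \<Longrightarrow> scalar_matrix n X"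
    proof -
      have "openin (subtopology (PU_topology n) H) {\<one>\<^bsub>PU_group n\<^esub>}"
        unfolding top using subgroup.one_closed[OF H] by simp
      then obtain W where W: "openin (PU_topology n) W" "{\<one>\<^bsub>PU_group n\<^esub>} = W \<inter> H"
        by (auto simp: openin_subtopology)
      have "openin (U_topology n) {A \<in> carrier (U_group n). PU_class n A \<in> W}"
        using W(1) by (simp add: openin_PU_topology)
      moreover have "1\<^sub>m n \<in> {A \<in> carrier (U_group n). PU_class n A \<in> W}"
        using W(2) one one_U by auto
      ultimately obtain \<delta> where \<delta>: "0 < \<delta>" "\<And>A. A \<in> carrier (U_group n) \<Longrightarrow> frob (A - 1\<^sub>m n) < \<delta> \<Longrightarrow>
          A \<in> {A \<in> carrier (U_group n). PU_class n A \<in> W}"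
        using open_nbhd_contains_frob_ball by blast
      have "scalar_matrix n X" if X: "X \<in> H'" "frob (X - 1\<^sub>m n) < \<delta>" for X
      proof -
        have XU: "X \<in> carrier (U_group n)" using X by (simp add: H'_def)
        then have "PU_class n X \<in> W \<inter> H" using \<delta>(2)[OF XU X(2)] X(1) by (simp add: H'_def)
        then have "PU_class n X = \<one>\<^bsub>PU_group n\<^esub>" using W(2) by blast
        then show ?thesis using PU_class_eq_one_iff[OF XU] circle_scalars_iff[OF XU n_pos] by simp
      qed
      then show thesis using that \<delta>(1) by blast
    qed
    define S where "S = {A \<in> H'. frob (A - 1\<^sub>m n) < 1 / 4}"
    have S_commute: "A * B = B * A" if "A \<in> S" "B \<in> S" for A B
      by (rule near_identity_commute[of H' n \<delta>])
        (use that \<delta> scal H'_mult H'_adj in \<open>auto simp: S_def ucomm_def H'_def\<close>)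
    have S_scalar: "scalar_matrix n A" if A: "A \<in> S" for A
    proof (rule ccontr)
      assume ns: "\<not> scalar_matrix n A"
      have "commuting_matrices n S"
      proof
        show "S \<subseteq> carrier_mat n n" by (auto simp: S_def H'_def U_group_carrier)
        show "mat_adjoint B \<in> S" if B: "B \<in> S" for B
        proof -
          have cB: "B \<in> carrier_mat n n" using B by (simp add: S_def H'_def U_group_carrier)
          have "mat_adjoint B - 1\<^sub>m n = mat_adjoint (B - 1\<^sub>m n)"
            using adjoint_minus[OF cB, of "1\<^sub>m n"] by (simp add: mat_adjoint_one)
          then have "frob (mat_adjoint B - 1\<^sub>m n) = frob (B - 1\<^sub>m n)"
            using frob_adjoint[of "B - 1\<^sub>m n" n n] by (simp add: minus_carrier_mat)
          then show ?thesis using B H'_adj by (simp add: S_def)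
        qed
      qed (use S_commute A ns in auto)
      moreover have "uconj (\<rho> g) B \<in> S" if g: "g \<in> carrier G" and B: "B \<in> S" for g B
      proof -
        have cB: "B \<in> carrier_mat n n" using B by (simp add: S_def H'_def U_group_carrier)
        have "uconj (\<rho> g) B \<in> H'"
          unfolding uconj_def using B H'_rep[OF g] by (intro H'_mult H'_adj) (auto simp: S_def)
        then show ?thesis using frob_uconj_minus_one[OF rep_closed[OF g] cB] B by (simp add: S_def)
      qed
      ultimately show False using commuting_matrices_imp_torus SU no_torus by blast
    qed
    show ?thesis
    proof (intro equalityI subsetI)
      fix x assume "x \<in> H \<inter> ?V"
      then obtain A where A: "A \<in> carrier (U_group n)" "A \<in> S" "x = PU_class n A"
        by (auto simp: S_def H'_def)
      then show "x \<in> {\<one>\<^bsub>PU_group n\<^esub>}"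
        using S_scalar[OF A(2)] PU_class_eq_one_iff[OF A(1)] circle_scalars_iff[OF A(1) n_pos] by simp
    qed (use oneV subgroup.one_closed[OF H] in auto)
  qed
  then show ?thesis
    unfolding uniformly_discrete_def using openin_PU_frob_ball[of "1 / 4" n] oneV by (intro exI[of _ ?V]) auto
qed

lemma maximal_discrete_subgroup_exists:
  assumes unif: "uniformly_discrete (PU_topology n) (PU_group n)
      {H. discrete_subgroup (PU_topology n) (PU_group n) H \<and> K \<subseteq> H}"
    and K: "discrete_subgroup (PU_topology n) (PU_group n) K"
  shows "\<exists>M. maximal_discrete_subgroup (PU_topology n) (PU_group n) M \<and> K \<subseteq> M"
proof -
  let ?A = "{H. discrete_subgroup (PU_topology n) (PU_group n) H \<and> K \<subseteq> H}"
  obtain V where V: "openin (PU_topology n) V" "\<one>\<^bsub>PU_group n\<^esub> \<in> V"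
    "\<And>H. H \<in> ?A \<Longrightarrow> H \<inter> V = {\<one>\<^bsub>PU_group n\<^esub>}"
    using unif by (auto simp: uniformly_discrete_def)
  have "\<exists>M\<in>?A. \<forall>X\<in>?A. M \<subseteq> X \<longrightarrow> X = M"
  proof (rule subset_Zorn_nonempty)
    show "?A \<noteq> {}" using K by blast
    fix C assume C: "C \<noteq> {}" "subset.chain ?A C"
    have CA: "C \<subseteq> ?A" and lin: "\<And>X Y. X \<in> C \<Longrightarrow> Y \<in> C \<Longrightarrow> X \<subseteq> Y \<or> Y \<subseteq> X"
      using C(2) by (auto simp: subset_chain_def)
    have sub: "subgroup X (PU_group n)" if "X \<in> C" for X
      using CA that by (auto simp: discrete_subgroup_def)
    have "subgroup (\<Union>C) (PU_group n)"
    proof (rule group.subgroupI[OF PU_group_group])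
      show "\<Union>C \<subseteq> carrier (PU_group n)" using sub by (auto dest: subgroup.subset)
      obtain X where "X \<in> C" using C(1) by blast
      then show "\<Union>C \<noteq> {}" using subgroup.one_closed[OF sub] by blast
      show "inv\<^bsub>PU_group n\<^esub> a \<in> \<Union>C" if "a \<in> \<Union>C" for a
        using that subgroup.m_inv_closed[OF sub] by blast
      show "a \<otimes>\<^bsub>PU_group n\<^esub> b \<in> \<Union>C" if ab: "a \<in> \<Union>C" "b \<in> \<Union>C" for a b
      proof -
        obtain X Y where XY: "X \<in> C" "a \<in> X" "Y \<in> C" "b \<in> Y" using ab by blast
        then obtain Z where "Z \<in> C" "a \<in> Z" "b \<in> Z" using lin[of X Y] by blast
        then show ?thesis using subgroup.m_closed[OF sub] by blast
      qed
    qed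
    moreover have "\<Union>C \<inter> V \<subseteq> {\<one>\<^bsub>PU_group n\<^esub>}" using V(3) CA by blast
    ultimately have "discrete_subgroup (PU_topology n) (PU_group n) (\<Union>C)"
      using V(1,2) by (intro discrete_if_trivial_near_one)
    then show "\<Union>C \<in> ?A" using CA C(1) by blast
  qed
  then obtain M where M: "M \<in> ?A" and max: "\<forall>X\<in>?A. M \<subseteq> X \<longrightarrow> X = M" by (elim bexE)
  have "\<not> M \<subset> H" if "discrete_subgroup (PU_topology n) (PU_group n) H" for H
  proof
    assume "M \<subset> H"
    moreover from this have "H \<in> ?A" using M that by auto
    ultimately show False using max by blast
  qed
  then have "maximal_discrete_subgroup (PU_topology n) (PU_group n) M"
    using M by (simp add: maximal_discrete_subgroup_def)
  then show ?thesis using M by blast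
qed

theorem proposition4p3:
  fixes G :: "('a, 'b) monoid_scheme" and n :: nat and \<pi> :: "'a \<Rightarrow> complex mat"
  assumes "group G" and "finite (carrier G)"
    and "\<pi> \<in> hom G (SU_group n)"
    and "irreducible_rep G n \<pi>" and "nontrivial_rep G n \<pi>"
  shows
    "(\<not> normalizes_nontrivial_torus n (\<pi> ` carrier G) \<longleftrightarrow>
       (\<forall>\<hh>. su_Lie_subalgebra n \<hh> \<and> abelian_Lie n \<hh> \<and> Ad_invariant n (\<pi> ` carrier G) \<hh>
              \<longrightarrow> \<hh> = {0\<^sub>m n n}))
     \<and> ((\<forall>\<phi>\<in>hom G (sym_group n). \<forall>g\<in>carrier G. \<phi> g = \<one>\<^bsub>sym_group n\<^esub>)
         \<longrightarrow> \<not> normalizes_nontrivial_torus n (\<pi> ` carrier G))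
     \<and> (n = least_nontrivial_irrep_dim G
         \<longrightarrow> \<not> normalizes_nontrivial_torus n (\<pi> ` carrier G))
     \<and> (\<not> normalizes_nontrivial_torus n (\<pi> ` carrier G) \<longrightarrow>
         uniformly_discrete (PU_topology n) (PU_group n)
           {H. discrete_subgroup (PU_topology n) (PU_group n) H \<and>
               (PU_class n \<circ> \<pi>) ` carrier G \<subseteq> H}
         \<and> (\<exists>M. maximal_discrete_subgroup (PU_topology n) (PU_group n) M \<and>
                (PU_class n \<circ> \<pi>) ` carrier G \<subseteq> M))"
proof -
  have \<pi>_U: "\<pi> \<in> hom G (U_group n)"
    using assms(3) by (auto simp: hom_def Pi_def SU_group_def)
  interpret irreducible_unitary_rep G n \<pi>
    using assms \<pi>_U
    by (simp add: irreducible_unitary_rep_def irreducible_unitary_rep_axioms_def unitary_rep_def unitary_rep_axioms_def)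
  have SU: "\<pi> ` carrier G \<subseteq> carrier (SU_group n)" using assms(3) by (auto simp: hom_def)
  let ?torus = "normalizes_nontrivial_torus n (\<pi> ` carrier G)"
  have Ad: "k * X * inv\<^bsub>SU_group n\<^esub> k = uconj k X" if "k \<in> \<pi> ` carrier G" for k X
    using SU_group_inv[of k n] SU that by (auto simp: uconj_def)

  let ?Lie = "\<exists>\<hh>. su_Lie_subalgebra n \<hh> \<and> abelian_Lie n \<hh> \<and> Ad_invariant n (\<pi> ` carrier G) \<hh>
              \<and> \<hh> \<noteq> {0\<^sub>m n n}"
  have Lie: "?torus \<longleftrightarrow> ?Lie"
  proof
    assume ?torus
    then obtain S where S: "commuting_matrices n S" "\<And>g A. g \<in> carrier G \<Longrightarrow> A \<in> S \<Longrightarrow> uconj (\<pi> g) A \<in> S"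
      using torus_imp_commuting_matrices SU by blast
    interpret commuting_matrices n S by (rule S(1))
    let ?h = "{X \<in> su_algebra n. \<forall>C\<in>commutant. C * X = X * C}"
    have "uconj (\<pi> g) X \<in> ?h" if g: "g \<in> carrier G" and X: "X \<in> ?h" for g X
    proof -
      note u = rep_closed[OF g]
      have X': "X \<in> carrier_mat n n" "mat_adjoint X = - X" "mtrace X = 0"
        using X by (auto simp: su_algebra_def mtrace_def)
      have "mtrace (uconj (\<pi> g) X) = 0" using mtrace_uconj[OF u X'(1)] X'(3) by simp
      moreover have "mat_adjoint (uconj (\<pi> g) X) = - uconj (\<pi> g) X"
      proof -
        have "- X = (-1) \<cdot>\<^sub>m X" "- uconj (\<pi> g) X = (-1) \<cdot>\<^sub>m uconj (\<pi> g) X" by (auto intro!: eq_matI)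
        then show ?thesis using uconj_adjoint[OF u X'(1)] X'(2) uconj_smult[OF u X'(1), of "-1"] by simp
      qed
      ultimately have "uconj (\<pi> g) X \<in> su_algebra n"
        using uconj_carrier[OF u X'(1)] by (auto simp: su_algebra_def mtrace_def)
      moreover have "C * uconj (\<pi> g) X = uconj (\<pi> g) X * C" if "C \<in> commutant" for C
        by (rule bicommutant_uconj[OF u _ X'(1) _ that]) (use S(2)[OF g] X in auto)
      ultimately show ?thesis by simp
    qed
    then have "Ad_invariant n (\<pi> ` carrier G) ?h"
      unfolding Ad_invariant_def using Ad by auto
    then show ?Lie
      using abelian_Lie_subalgebra by blast
  next
    assume ?Lie
    then obtain \<hh> where h: "su_Lie_subalgebra n \<hh>" "abelian_Lie n \<hh>" "\<hh> \<noteq> {0\<^sub>m n n}"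
      and inv: "Ad_invariant n (\<pi> ` carrier G) \<hh>" by blast
    have "uconj (\<pi> g) X \<in> \<hh>" if "g \<in> carrier G" "X \<in> \<hh>" for g X
      using inv that Ad[of "\<pi> g" X] by (force simp: Ad_invariant_def)
    then show ?torus using commuting_matrices_imp_torus[OF commuting_matrices_of_abelian_Lie[OF h] _ SU] by blast
  qed

  have sym: "\<exists>\<phi>\<in>hom G (sym_group n). \<exists>g\<in>carrier G. \<phi> g \<noteq> \<one>\<^bsub>sym_group n\<^esub>" if t: ?torus
  proof -
    obtain S where S: "commuting_matrices n S" "\<And>g A. g \<in> carrier G \<Longrightarrow> A \<in> S \<Longrightarrow> uconj (\<pi> g) A \<in> S"
      using torus_imp_commuting_matrices[OF t SU] by blast
    show ?thesis by (rule nontrivial_hom_to_sym_group[OF permuted_family_atoms[OF S]])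
  qed

  have least: "n \<noteq> least_nontrivial_irrep_dim G" if t: ?torus
  proof -
    obtain \<phi> where \<phi>: "\<phi> \<in> hom G (sym_group n)" "\<exists>g\<in>carrier G. \<phi> g \<noteq> \<one>\<^bsub>sym_group n\<^esub>" using sym[OF t] by blast
    obtain k where "k < n" "\<exists>\<tau>. irreducible_rep G k \<tau> \<and> nontrivial_rep G k \<tau>"
      using sym_group_hom_imp_small_irreducible[OF assms(1,2) \<phi>] by blast
    moreover from this(2) have "least_nontrivial_irrep_dim G \<le> k"
      unfolding least_nontrivial_irrep_dim_def by (rule Least_le)
    ultimately show ?thesis by simp
  qed

  let ?K = "(PU_class n \<circ> \<pi>) ` carrier G"
  have "PU_class n \<circ> \<pi> \<in> hom G (PU_group n)" using \<pi>_U PU_class_hom[of n] by (auto simp: hom_def Pi_def)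
  then have "subgroup ?K (PU_group n)"
    by (intro group_hom.img_is_subgroup) (simp add: group_hom_def group_hom_axioms_def assms(1) PU_group_group)
  then have K: "discrete_subgroup (PU_topology n) (PU_group n) ?K"
    by (rule finite_subgroup_discrete[OF n_pos]) (simp add: assms(2))
  have unif: "uniformly_discrete (PU_topology n) (PU_group n)
      {H. discrete_subgroup (PU_topology n) (PU_group n) H \<and> ?K \<subseteq> H}" if "\<not> ?torus"
    by (rule uniformly_discrete_of_no_torus[OF irreducible_unitary_rep_axioms SU that])
  show ?thesis
    using Lie sym least unif maximal_discrete_subgroup_exists[OF unif K] by blast
qed

end
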